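(* Let $G$ be a nilpotent group equipped with a generating $k$-tuple $S=(s_1,\dots,s_k)$ and let $a=(\alpha_1,\dots,\alpha_k)\in(0,\infty]^k$. Assume that the subgroup of $G$ generated by $\{s_i:\alpha_i<2\}$ is of finite index in $G$. Then there exists a real $D\ge 0$, depending on $(G,S,a)$, such that $$\mu_{S,a}^{(n)}(e)\simeq n^{-D}.$$
   Context: $e$ is the identity of $G$; repetitions are allowed in $S$. The probability measure $\mu_{S,a}$ on $G$ is $$\mu_{S,a}(g)=\frac1k\sum_{i=1}^k c(\alpha_i)\sum_{m\in\mathbb Z}(1+|m|)^{-\alpha_i-1}\mathbf 1_{s_i^m}(g),\qquad c(\alpha)^{-1}=\sum_{m\in\mathbb Z}(1+|m|)^{-\alpha-1},$$ where $\mathbf 1_{x}(g)=1$ if $g=x$ and $0$ otherwise, and with the convention that for $\alpha=\infty$ the quantity $(1+|m|)^{-\alpha-1}$ equals $1$ if $m\in\{0,\pm1\}$ and $0$ otherwise. $\mu^{(n)}$ denotes the $n$-fold convolution power of $\mu$. $f\simeq g$ means that there are constants $c_1,c_2,c_3,c_4>0$ such that $c_1f(c_2t)\le g(t)\le c_3f(c_4t)$ for all large $t$; in particular $\mu^{(n)}(e)\simeq n^{-D}$ means that $c\,n^{-D}\le\mu^{(n)}(e)\le C\,n^{-D}$ for some constants $c,C>0$ and all large integers $n$. *)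

theory Defs
  imports "HOL-Analysis.Analysis" "HOL-Algebra.Generated_Groups" "HOL-Algebra.Coset"
begin

fun lower_central_series :: "('a, 'b) monoid_scheme \<Rightarrow> nat \<Rightarrow> 'a set" where
  "lower_central_series G 0 = carrier G"
| "lower_central_series G (Suc n) =
     generate G (\<Union>x\<in>lower_central_series G n. \<Union>y\<in>carrier G.
       {x \<otimes>\<^bsub>G\<^esub> y \<otimes>\<^bsub>G\<^esub> inv\<^bsub>G\<^esub> x \<otimes>\<^bsub>G\<^esub> inv\<^bsub>G\<^esub> y})"

definition nilpotent_group :: "('a, 'b) monoid_scheme \<Rightarrow> bool" where
  "nilpotent_group G \<longleftrightarrow> group G \<and> (\<exists>n. lower_central_series G n = {\<one>\<^bsub>G\<^esub>})"

text \<open>The finite-index condition is independent of the side: inversion is a bijection between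
  right cosets and left cosets.\<close>

definition finite_index_subgroup :: "('a, 'b) monoid_scheme \<Rightarrow> 'a set \<Rightarrow> bool" where
  "finite_index_subgroup G H \<longleftrightarrow> subgroup H G \<and> finite (rcosets\<^bsub>G\<^esub> H)"

text \<open>The quantity \<open>(1 + |m|)\<^sup>-\<^sup>\<alpha>\<^sup>-\<^sup>1\<close>, with its convention for \<open>\<alpha> = \<infinity>\<close>.\<close>

definition power_weight :: "ereal \<Rightarrow> int \<Rightarrow> real" where
  "power_weight \<alpha> m =
     (if \<alpha> = \<infinity> then (if m \<in> {-1, 0, 1} then 1 else 0)
      else (1 + \<bar>real_of_int m\<bar>) powr (- real_of_ereal \<alpha> - 1))"

definition power_const :: "ereal \<Rightarrow> real" where
  "power_const \<alpha> = inverse (\<Sum>\<^sub>\<infinity>m\<in>UNIV. power_weight \<alpha> m)"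

definition walk_measure ::
    "('a, 'b) monoid_scheme \<Rightarrow> nat \<Rightarrow> (nat \<Rightarrow> 'a) \<Rightarrow> (nat \<Rightarrow> ereal) \<Rightarrow> 'a \<Rightarrow> real" where
  "walk_measure G k s \<alpha> g =
     1 / real k * (\<Sum>i=1..k. power_const (\<alpha> i) *
       (\<Sum>\<^sub>\<infinity>m\<in>UNIV. power_weight (\<alpha> i) m * of_bool (g = s i [^]\<^bsub>G\<^esub> (m::int))))"

definition convolution ::
    "('a, 'b) monoid_scheme \<Rightarrow> ('a \<Rightarrow> real) \<Rightarrow> ('a \<Rightarrow> real) \<Rightarrow> 'a \<Rightarrow> real" where
  "convolution G f h x = (\<Sum>\<^sub>\<infinity>y\<in>carrier G. f y * h (inv\<^bsub>G\<^esub> y \<otimes>\<^bsub>G\<^esub> x))"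

fun convolution_power ::
    "('a, 'b) monoid_scheme \<Rightarrow> ('a \<Rightarrow> real) \<Rightarrow> nat \<Rightarrow> 'a \<Rightarrow> real" where
  "convolution_power G f 0 = (\<lambda>x. of_bool (x = \<one>\<^bsub>G\<^esub>))"
| "convolution_power G f (Suc n) = convolution G (convolution_power G f n) f"

text \<open>The following lemmas show that no unordered sum above falls back on the default value \<open>0\<close> of
  \<open>infsum\<close> and that \<open>walk_measure\<close> and its convolution powers are probability measures.\<close>

lemma power_weight_nonneg: "power_weight \<alpha> m \<ge> 0"
  by (simp add: power_weight_def)

lemma power_weight_summable:
  assumes "\<alpha> > 0"
  shows "power_weight \<alpha> summable_on UNIV"
proof (cases "\<alpha> = \<infinity>")
  case True
  have "power_weight \<alpha> summable_on {-1, 0, 1}"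
    by simp
  then show ?thesis
    by (rule summable_on_cong_neutral[THEN iffD1, rotated -1])
       (auto simp: power_weight_def True)
next
  case False
  define a where "a = real_of_ereal \<alpha>"
  have a: "a > 0"
    using assms False unfolding a_def by (cases \<alpha>) auto
  define w where "w n = real (Suc n) powr (- a - 1)" for n
  have "summable w"
    unfolding w_def by (subst summable_Suc_iff) (use a in \<open>simp add: summable_real_powr_iff\<close>)
  then have w: "w summable_on UNIV"
    by (intro summable_nonneg_imp_summable_on) (auto simp: w_def)
  have pw: "power_weight \<alpha> m = w (nat \<bar>m\<bar>)" for m
    using False by (simp add: power_weight_def w_def a_def add.commute)
  have "power_weight \<alpha> summable_on (int ` UNIV)"
    by (subst summable_on_reindex) (auto simp: o_def pw w)
  moreover have "power_weight \<alpha> summable_on ((\<lambda>n. - int n) ` UNIV)"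
    by (subst summable_on_reindex) (auto simp: o_def pw w inj_on_def)
  ultimately have "power_weight \<alpha> summable_on (int ` UNIV \<union> (\<lambda>n. - int n) ` UNIV)"
    by (rule summable_on_union)
  moreover have "int ` UNIV \<union> (\<lambda>n. - int n) ` UNIV = UNIV"
    by (auto simp: image_iff) (metis int_cases2)
  ultimately show ?thesis
    by simp
qed

lemma power_weight_infsum_pos:
  assumes "\<alpha> > 0"
  shows "(\<Sum>\<^sub>\<infinity>m\<in>UNIV. power_weight \<alpha> m) > 0"
proof -
  have "1 = (\<Sum>m\<in>{0}. power_weight \<alpha> m)"
    by (simp add: power_weight_def)
  also have "\<dots> \<le> (\<Sum>\<^sub>\<infinity>m\<in>UNIV. power_weight \<alpha> m)"
    by (rule finite_sum_le_infsum)
       (auto simp: power_weight_nonneg power_weight_summable assms)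
  finally show ?thesis
    by simp
qed

lemma has_sum_finite_sum:
  fixes f :: "'i \<Rightarrow> 'a \<Rightarrow> real"
  assumes "finite I" "\<And>i. i \<in> I \<Longrightarrow> (f i has_sum S i) A"
  shows "((\<lambda>x. \<Sum>i\<in>I. f i x) has_sum (\<Sum>i\<in>I. S i)) A"
  using assms by (induction I rule: finite_induct) (auto intro!: has_sum_add)

lemma walk_measure_nonneg: "walk_measure G k s \<alpha> g \<ge> 0"
  unfolding walk_measure_def power_const_def
  by (intro mult_nonneg_nonneg sum_nonneg infsum_nonneg)
     (auto intro: infsum_nonneg simp: power_weight_nonneg)

lemma walk_measure_has_sum_1:
  assumes "group G" "k \<ge> 1"
    and "\<And>i. i \<in> {1..k} \<Longrightarrow> s i \<in> carrier G" "\<And>i. i \<in> {1..k} \<Longrightarrow> \<alpha> i > 0"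
  shows "(walk_measure G k s \<alpha> has_sum 1) (carrier G)"
proof -
  interpret group G by fact
  have *: "((\<lambda>g. \<Sum>\<^sub>\<infinity>m\<in>UNIV. power_weight (\<alpha> i) m * of_bool (g = s i [^]\<^bsub>G\<^esub> (m::int)))
      has_sum (\<Sum>\<^sub>\<infinity>m\<in>UNIV. power_weight (\<alpha> i) m)) (carrier G)"
    if i: "i \<in> {1..k}" for i
  proof -
    let ?w = "power_weight (\<alpha> i)"
    let ?F = "\<lambda>(g, m). ?w m * of_bool (g = s i [^]\<^bsub>G\<^esub> (m::int))"
    let ?T = "range (\<lambda>m::int. (s i [^]\<^bsub>G\<^esub> m, m))"
    have "(?w has_sum infsum ?w UNIV) UNIV"
      using power_weight_summable assms(4)[OF i] by (simp add: summable_iff_has_sum_infsum)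
    then have "(?F has_sum infsum ?w UNIV) ?T"
      by (subst has_sum_reindex) (auto simp: inj_on_def o_def)
    then have tot: "(?F has_sum infsum ?w UNIV) (carrier G \<times> UNIV)"
      by (rule has_sum_cong_neutral[THEN iffD1, rotated -1])
         (use assms(3)[OF i] in auto)
    have row: "((\<lambda>m. ?F (g, m)) has_sum (\<Sum>\<^sub>\<infinity>m\<in>UNIV. ?F (g, m))) UNIV" for g
    proof (rule has_sum_infsum, rule summable_on_comparison_test)
      show "?w summable_on UNIV"
        using power_weight_summable assms(4)[OF i] by simp
    qed (auto simp: power_weight_nonneg)
    show ?thesis
      using has_sum_SigmaD[OF tot row] by simp
  qed
  have "(walk_measure G k s \<alpha> has_sum
      (1 / real k * (\<Sum>i=1..k. power_const (\<alpha> i) * (\<Sum>\<^sub>\<infinity>m\<in>UNIV. power_weight (\<alpha> i) m)))) (carrier G)"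
    unfolding walk_measure_def
    by (intro has_sum_cmult_right has_sum_finite_sum *) auto
  also have "(\<Sum>i=1..k. power_const (\<alpha> i) * (\<Sum>\<^sub>\<infinity>m\<in>UNIV. power_weight (\<alpha> i) m)) = (\<Sum>i=1..k. 1)"
    using power_weight_infsum_pos assms(4)
    by (intro sum.cong) (force simp: power_const_def)+
  finally show ?thesis
    using assms(2) by simp
qed

lemma convolution_has_sum_1:
  assumes "group G"
    and f: "\<And>x. f x \<ge> 0" "(f has_sum 1) (carrier G)"
    and h: "\<And>x. h x \<ge> 0" "(h has_sum 1) (carrier G)"
  shows "(convolution G f h has_sum 1) (carrier G)"
    and "x \<in> carrier G \<Longrightarrow> (\<lambda>y. f y * h (inv\<^bsub>G\<^esub> y \<otimes>\<^bsub>G\<^esub> x)) summable_on carrier G"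
proof -
  interpret group G by fact
  let ?F = "\<lambda>(y, x). f y * h (inv\<^bsub>G\<^esub> y \<otimes>\<^bsub>G\<^esub> x)"
  have row: "((\<lambda>x. ?F (y, x)) has_sum f y) (carrier G)" if y: "y \<in> carrier G" for y
  proof -
    have "((\<lambda>x. h (inv\<^bsub>G\<^esub> y \<otimes>\<^bsub>G\<^esub> x)) has_sum 1) (carrier G)"
      by (rule has_sum_reindex_bij_witness[of _ "\<lambda>x. y \<otimes>\<^bsub>G\<^esub> x" "\<lambda>x. inv\<^bsub>G\<^esub> y \<otimes>\<^bsub>G\<^esub> x",
            THEN iffD2, OF _ _ _ _ _ _ h(2)])
         (use y in \<open>auto simp: m_assoc[symmetric]\<close>)
    from has_sum_cmult_right[OF this, of "f y"] show ?thesis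
      by simp
  qed
  have sF: "?F summable_on carrier G \<times> carrier G"
    by (rule summable_on_SigmaI[OF row]) (use f h in \<open>auto simp: summable_on_def\<close>)
  have "(?F has_sum 1) (carrier G \<times> carrier G)"
    by (rule has_sum_SigmaI[OF row f(2) sF])
  then have tot: "((\<lambda>(x, y). ?F (y, x)) has_sum 1) (carrier G \<times> carrier G)"
    by (subst (asm) has_sum_swap) simp
  have col: "(\<lambda>y. f y * h (inv\<^bsub>G\<^esub> y \<otimes>\<^bsub>G\<^esub> x)) summable_on carrier G" if "x \<in> carrier G" for x
    using summable_on_SigmaD1[of "\<lambda>x y. ?F (y, x)" "carrier G" "\<lambda>_. carrier G" x] tot that
    by (auto simp: summable_on_def)
  then show "x \<in> carrier G \<Longrightarrow> (\<lambda>y. f y * h (inv\<^bsub>G\<^esub> y \<otimes>\<^bsub>G\<^esub> x)) summable_on carrier G" .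
  have "((\<lambda>x. \<Sum>\<^sub>\<infinity>y\<in>carrier G. f y * h (inv\<^bsub>G\<^esub> y \<otimes>\<^bsub>G\<^esub> x)) has_sum 1) (carrier G)"
    by (rule has_sum_SigmaD[OF tot]) (use has_sum_infsum[OF col] in simp)
  then show "(convolution G f h has_sum 1) (carrier G)"
    by (simp add: convolution_def[abs_def])
qed

lemma convolution_power_nonneg:
  assumes "\<And>x. f x \<ge> 0"
  shows "convolution_power G f n x \<ge> 0"
  by (induction n arbitrary: x) (auto simp: convolution_def assms intro!: infsum_nonneg)

lemma convolution_power_has_sum_1:
  assumes "group G" "\<And>x. f x \<ge> 0" "(f has_sum 1) (carrier G)"
  shows "(convolution_power G f n has_sum 1) (carrier G)"
proof (induction n)
  case 0
  interpret group G by fact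
  have "(convolution_power G f 0 has_sum 1) {\<one>\<^bsub>G\<^esub>}"
    by (rule has_sum_finiteI) auto
  then show ?case
    by (rule has_sum_cong_neutral[THEN iffD1, rotated -1]) auto
next
  case (Suc n)
  show ?case
    unfolding convolution_power.simps
    by (rule convolution_has_sum_1(1)[OF assms(1) convolution_power_nonneg Suc assms(2,3)])
       (rule assms(2))
qed

end

theory Submission
  imports Defs
begin

text \<open>
  In time \<open>n\<close> the walk makes of the order of \<open>n\<close> steps along each generator \<open>s i\<close>, and if \<open>\<alpha> i < 2\<close> the largest
  exponents it sees are of order \<open>n\<close> to the power \<open>1 / \<alpha> i\<close>. So \<open>s i\<close> gets the weight
  \<open>w i = 1 / \<alpha> i\<close>, which exceeds \<open>1 / 2\<close>, and an iterated commutator of generators gets the sum of the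
  weights of its entries. By nilpotency only finitely many of these commutators are nontrivial.
  Sorted by weight, they generate a descending chain of subgroups with cyclic quotients: the
  subgroups generated by the commutators from some position on. The exponent \<open>D\<close> is the sum of the
  weights of those commutators that contribute an infinite cyclic quotient (\<open>infinite_rank\<close>).

  Two counts at scale \<open>R\<close> meet in this \<open>D\<close>. First, words in which each commutator of weight \<open>v\<close>
  occurs at most of the order of \<open>R powr v\<close> times represent at most \<open>C * R powr D\<close> elements
  (\<open>card_cost_ball\<close>). This is a collection process: moving a letter to one end of a word creates
  only commutators of larger weight, and few enough of them. Second, every length function that
  is at most \<open>1\<close> on the generators and, if \<open>\<alpha> i < 2\<close>, on the powers \<open>s i [^] m\<close> with \<open>\<bar>m\<bar> \<le> R powr w i\<close>,
  is bounded on at least \<open>R powr D\<close> elements, by a constant that does not depend on \<open>R\<close>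
  (\<open>exists_many_elements\<close>). Here commutators of
  powers of generators are used: they are multilinear modulo commutators of larger weight.

  The upper bound comes from the second count. The defect \<open>p (2 * n) \<one> - p (2 * n) g\<close> behaves like
  the square of a length function of \<open>g\<close>, its mean under the step distribution is the decrease
  of \<open>p\<close> from time \<open>2 * n\<close> to time \<open>2 * n + 1\<close>, and a one-dimensional argument bounds it on the powers
  of \<open>s i\<close> in terms of that mean. So it is small on \<open>R powr D\<close> elements, on which the sum of \<open>p (2 * n)\<close>
  is at most \<open>1\<close>. This gives a Nash-type inequality that relates \<open>p (2 * n) \<one>\<close> to its own decrement
  (\<open>return_profile\<close>), and the decay follows (\<open>powr_decay_of_spectral_profile\<close>).

  The lower bound comes from both counts. A tent function of the weighted word length at scale
  \<open>R\<close> is supported on at most \<open>C * R powr D\<close> elements, is at least \<open>1 / 2\<close> on at least \<open>R powr D\<close> elements, and has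
  a Rayleigh quotient of order \<open>1 / R\<close> for the identity minus the transition operator. Cauchy-Schwarz turns this into a lower bound for the
  return probability at times comparable to \<open>R\<close> (\<open>test_function_lower_bound\<close>).

  A generator with \<open>\<alpha> i \<ge> 2\<close> would naturally have weight \<open>1 / 2\<close>, with a logarithmic correction for
  \<open>\<alpha> i = 2\<close>. By the finite index assumption some power of it is a product of generators with
  \<open>\<alpha> j < 2\<close>, all of which have weight larger than \<open>1 / 2\<close>. So it may be given any weight strictly between
  \<open>1 / 2\<close> and the smallest of theirs: a weight above \<open>1 / 2\<close> keeps the Rayleigh quotient of order
  \<open>1 / R\<close> without a logarithm, and a weight below the others makes the generator torsion modulo
  larger weight, so that it leaves \<open>D\<close> unchanged.
\<close>

section \<open>Commutators and quotients\<close>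

definition commutator :: "('a, 'b) monoid_scheme \<Rightarrow> 'a \<Rightarrow> 'a \<Rightarrow> 'a" where
  "commutator G x y = x \<otimes>\<^bsub>G\<^esub> y \<otimes>\<^bsub>G\<^esub> inv\<^bsub>G\<^esub> x \<otimes>\<^bsub>G\<^esub> inv\<^bsub>G\<^esub> y"

context group
begin

lemma commutator_closed [simp, intro]:
  "x \<in> carrier G \<Longrightarrow> y \<in> carrier G \<Longrightarrow> commutator G x y \<in> carrier G"
  by (simp add: commutator_def)

lemma inv_commutator:
  "x \<in> carrier G \<Longrightarrow> y \<in> carrier G \<Longrightarrow> inv (commutator G x y) = commutator G y x"
  by (simp add: commutator_def inv_mult_group m_assoc)

lemma inv_cancel_left [simp]:
  "x \<in> carrier G \<Longrightarrow> y \<in> carrier G \<Longrightarrow> inv x \<otimes> (x \<otimes> y) = y"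
  "x \<in> carrier G \<Longrightarrow> y \<in> carrier G \<Longrightarrow> x \<otimes> (inv x \<otimes> y) = y"
  by (simp_all flip: m_assoc)

lemma commutator_mult_swap:
  assumes "x \<in> carrier G" "y \<in> carrier G"
  shows "commutator G x y \<otimes> (y \<otimes> x) = x \<otimes> y"
  using assms by (simp add: commutator_def m_assoc inv_solve_left)

lemma commutator_eq_iff:
  assumes "x \<in> carrier G" "y \<in> carrier G" "z \<in> carrier G"
  shows "commutator G x y = z \<longleftrightarrow> x \<otimes> y = z \<otimes> (y \<otimes> x)"
proof
  assume "x \<otimes> y = z \<otimes> (y \<otimes> x)"
  then have "commutator G x y \<otimes> (y \<otimes> x) = z \<otimes> (y \<otimes> x)"
    using commutator_mult_swap[of x y] assms by simp
  then show "commutator G x y = z"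
    using assms by simp
qed (use commutator_mult_swap[of x y] assms in auto)

text \<open>Each of the \<open>n\<close> factors \<open>y\<close> that \<open>x\<close> passes leaves one copy of the commutator behind, and this copy
  commutes with the remaining factors.\<close>

lemma commutator_nat_pow_right:
  assumes x: "x \<in> carrier G" and y: "y \<in> carrier G"
    and zy: "commutator G x y \<otimes> y = y \<otimes> commutator G x y"
  shows "commutator G x (y [^] (n::nat)) = commutator G x y [^] n"
proof -
  define z where "z = commutator G x y"
  have z: "z \<in> carrier G" using x y by (simp add: z_def)
  have xy: "x \<otimes> y = z \<otimes> (y \<otimes> x)"
    using commutator_mult_swap[OF x y] by (simp add: z_def)
  have zn: "z \<otimes> y [^] n = y [^] n \<otimes> z" for n :: nat
    using zy z y by (induction n) (auto simp: z_def[symmetric] simp flip: m_assoc, simp add: m_assoc)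
  have "x \<otimes> y [^] n = z [^] n \<otimes> (y [^] n \<otimes> x)"
  proof (induction n)
    case (Suc n)
    have "x \<otimes> y [^] Suc n = (z [^] n \<otimes> (y [^] n \<otimes> x)) \<otimes> y"
      using Suc x y z by (simp flip: m_assoc)
    also have "\<dots> = z [^] n \<otimes> (y [^] n \<otimes> (z \<otimes> (y \<otimes> x)))"
      using x y z by (simp add: m_assoc xy)
    also have "\<dots> = z [^] n \<otimes> ((y [^] n \<otimes> z) \<otimes> (y \<otimes> x))"
      using x y z by (simp add: m_assoc)
    also have "\<dots> = z [^] n \<otimes> ((z \<otimes> y [^] n) \<otimes> (y \<otimes> x))"
      by (simp add: zn)
    also have "\<dots> = z [^] Suc n \<otimes> (y [^] Suc n \<otimes> x)"
      using x y z by (simp add: m_assoc)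
    finally show ?case .
  qed (use x in simp)
  then show ?thesis
    using x y z by (simp add: commutator_eq_iff z_def)
qed

lemma commutator_int_pow_right:
  assumes x: "x \<in> carrier G" and y: "y \<in> carrier G"
    and zy: "commutator G x y \<otimes> y = y \<otimes> commutator G x y"
  shows "commutator G x (y [^] (b::int)) = commutator G x y [^] b"
proof (cases b)
  case (nonneg n)
  then show ?thesis using commutator_nat_pow_right[OF assms] by (simp add: int_pow_int)
next
  case (neg n)
  define z where "z = commutator G x y"
  define m where "m = Suc n"
  have z: "z \<in> carrier G" using x y by (simp add: z_def)
  have zn: "z [^] m \<otimes> y [^] m = y [^] m \<otimes> z [^] m"
    using zy z y by (metis nat_pow_closed group_commutes_pow z_def)
  have "x \<otimes> y [^] m = z [^] m \<otimes> (y [^] m \<otimes> x)"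
    using commutator_nat_pow_right[OF assms, of m] commutator_eq_iff[of x "y [^] m" "z [^] m"] x y z
    by (simp add: z_def)
  then have "x \<otimes> y [^] m = y [^] m \<otimes> (z [^] m \<otimes> x)"
    using zn x y z by (simp flip: m_assoc)
  then have "inv (y [^] m) \<otimes> (x \<otimes> y [^] m) \<otimes> inv (y [^] m) = inv (y [^] m) \<otimes> (y [^] m \<otimes> (z [^] m \<otimes> x)) \<otimes> inv (y [^] m)"
    by simp
  then have "inv (y [^] m) \<otimes> x = z [^] m \<otimes> (x \<otimes> inv (y [^] m))"
    using x y z by (simp add: m_assoc)
  then have "inv (z [^] m) \<otimes> (inv (y [^] m) \<otimes> x) = x \<otimes> inv (y [^] m)"
    using x y z by simp
  then have "commutator G x (inv (y [^] m)) = inv (z [^] m)"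
    using x y z by (subst commutator_eq_iff) auto
  then show ?thesis
    using x y z neg int_pow_neg_int[of y m] int_pow_neg_int[of z m]
    by (simp add: m_def z_def del: nat_pow_Suc)
qed

lemma commutator_eq_one_iff:
  "x \<in> carrier G \<Longrightarrow> y \<in> carrier G \<Longrightarrow> commutator G x y = \<one> \<longleftrightarrow> x \<otimes> y = y \<otimes> x"
  by (simp add: commutator_eq_iff)

lemma int_pow_commutes:
  assumes "x \<in> carrier G" "y \<in> carrier G" "x \<otimes> y = y \<otimes> x"
  shows "y [^] (b::int) \<otimes> x = x \<otimes> y [^] b"
proof -
  have "commutator G x y = \<one>"
    using assms commutator_eq_one_iff by simp
  then have "commutator G x (y [^] b) = \<one>"
    using commutator_int_pow_right[of x y b] assms by simp
  then show ?thesis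
    using assms commutator_eq_one_iff[of x "y [^] b"] by simp
qed

lemma commute_inv:
  assumes "x \<in> carrier G" "y \<in> carrier G" "x \<otimes> y = y \<otimes> x"
  shows "inv y \<otimes> x = x \<otimes> inv y"
  using int_pow_commutes[OF assms, of "-1"] assms by (simp add: int_pow_neg)

lemma commutator_int_pow:
  assumes x: "x \<in> carrier G" and y: "y \<in> carrier G"
    and zx: "commutator G x y \<otimes> x = x \<otimes> commutator G x y"
    and zy: "commutator G x y \<otimes> y = y \<otimes> commutator G x y"
  shows "commutator G (x [^] (a::int)) (y [^] (b::int)) = commutator G x y [^] (a * b)"
proof -
  define z where "z = commutator G x y"
  have z: "z \<in> carrier G" using x y by (simp add: z_def)
  have 1: "commutator G x (y [^] b) = z [^] b"
    using commutator_int_pow_right[OF x y zy] by (simp add: z_def)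
  have zb: "z [^] b \<otimes> x = x \<otimes> z [^] b"
    using int_pow_commutes[of x z b] zx x z by (simp add: z_def)
  have "inv (z [^] b) \<otimes> x = x \<otimes> inv (z [^] b)"
    using commute_inv[of x "z [^] b"] zb x z by simp
  then have "commutator G (y [^] b) (x [^] a) = (inv (z [^] b)) [^] a"
    using commutator_int_pow_right[of "y [^] b" x a] inv_commutator[of x "y [^] b"] 1 x y
    by simp
  then have "inv (commutator G (x [^] a) (y [^] b)) = inv ((z [^] b) [^] a)"
    using x y z by (simp add: inv_commutator int_pow_inv)
  then have "commutator G (x [^] a) (y [^] b) = (z [^] b) [^] a"
    using x y z by (metis commutator_closed int_pow_closed inv_inv)
  then show ?thesis
    using z by (simp add: int_pow_pow mult.commute z_def)
qed

end

lemma (in group_hom) hom_commutator: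
  "x \<in> carrier G \<Longrightarrow> y \<in> carrier G \<Longrightarrow> h (commutator G x y) = commutator H (h x) (h y)"
  by (simp add: commutator_def)

lemma (in group) commutes_generate:
  assumes "x \<in> carrier G" "Y \<subseteq> carrier G" "\<And>y. y \<in> Y \<Longrightarrow> x \<otimes> y = y \<otimes> x" "y \<in> generate G Y"
  shows "x \<otimes> y = y \<otimes> x"
  using assms(4)
proof (induction rule: generate.induct)
  case (inv h)
  then show ?case using assms commute_inv[of x h] by auto
next
  case (eng h1 h2)
  then have "h1 \<in> carrier G" "h2 \<in> carrier G" using assms(2) generate_incl by blast+
  then show ?case using eng assms(1) m_assoc by metis
qed (use assms in auto)

lemma (in group) inv_mult_eq_one_iff:
  "x \<in> carrier G \<Longrightarrow> y \<in> carrier G \<Longrightarrow> inv x \<otimes> y = \<one> \<longleftrightarrow> x = y"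
  by (metis inv_closed inv_equality inv_inv l_inv)

context normal begin

lemma quotient_hom: "group_hom G (G Mod H) (\<lambda>x. H #> x)"
  by (intro group_hom.intro group_hom_axioms.intro is_group factorgroup_is_group r_coset_hom_Mod)

lemma coset_eq_one_iff:
  assumes "x \<in> carrier G" shows "H #> x = \<one>\<^bsub>G Mod H\<^esub> \<longleftrightarrow> x \<in> H"
  using assms coset_join1[of H x] coset_join2[of x H] is_subgroup by auto

lemma coset_eq_iff_left:
  assumes "x \<in> carrier G" "y \<in> carrier G"
  shows "H #> x = H #> y \<longleftrightarrow> inv x \<otimes> y \<in> H"
proof -
  interpret Q: group_hom G "G Mod H" "\<lambda>x. H #> x" by (rule quotient_hom)
  have "inv x \<otimes> y \<in> H \<longleftrightarrow> H #> (inv x \<otimes> y) = \<one>\<^bsub>G Mod H\<^esub>"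
    by (rule coset_eq_one_iff[symmetric]) (use assms in auto)
  also have "\<dots> \<longleftrightarrow> inv\<^bsub>G Mod H\<^esub> (H #> x) \<otimes>\<^bsub>G Mod H\<^esub> (H #> y) = \<one>\<^bsub>G Mod H\<^esub>"
    using Q.hom_mult[of "inv x" y] Q.hom_inv[of x] assms by simp
  also have "\<dots> \<longleftrightarrow> H #> x = H #> y"
    by (rule Q.H.inv_mult_eq_one_iff) (rule Q.hom_closed, fact)+
  finally show ?thesis ..
qed

lemma commutator_mem_iff:
  assumes "x \<in> carrier G" "y \<in> carrier G"
  shows "commutator G x y \<in> H \<longleftrightarrow>
    (H #> x) \<otimes>\<^bsub>G Mod H\<^esub> (H #> y) = (H #> y) \<otimes>\<^bsub>G Mod H\<^esub> (H #> x)"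
proof -
  interpret Q: group_hom G "G Mod H" "\<lambda>x. H #> x" by (rule quotient_hom)
  have "commutator G x y \<in> H \<longleftrightarrow> H #> commutator G x y = \<one>\<^bsub>G Mod H\<^esub>"
    by (rule coset_eq_one_iff[symmetric]) (use assms in auto)
  also have "\<dots> \<longleftrightarrow> commutator (G Mod H) (H #> x) (H #> y) = \<one>\<^bsub>G Mod H\<^esub>"
    using Q.hom_commutator assms by simp
  also have "\<dots> \<longleftrightarrow> (H #> x) \<otimes>\<^bsub>G Mod H\<^esub> (H #> y) = (H #> y) \<otimes>\<^bsub>G Mod H\<^esub> (H #> x)"
    by (rule Q.H.commutator_eq_one_iff) (use assms Q.hom_closed in auto)
  finally show ?thesis .
qed

lemma coset_commutes_generate:
  assumes "x \<in> carrier G" "Y \<subseteq> carrier G" "\<And>y. y \<in> Y \<Longrightarrow> commutator G x y \<in> H" "y \<in> generate G Y"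
  shows "commutator G x y \<in> H"
proof -
  interpret Q: group_hom G "G Mod H" "\<lambda>x. H #> x" by (rule quotient_hom)
  have y: "y \<in> carrier G" using assms generate_incl by blast
  have "H #> y \<in> generate (G Mod H) ((\<lambda>x. H #> x) ` Y)"
    using Q.generate_img[OF assms(2)] assms(4) by blast
  then have "(H #> x) \<otimes>\<^bsub>G Mod H\<^esub> (H #> y) = (H #> y) \<otimes>\<^bsub>G Mod H\<^esub> (H #> x)"
  proof (rule Q.H.commutes_generate[rotated 3])
    fix z assume "z \<in> (\<lambda>x. H #> x) ` Y"
    then obtain u where u: "z = H #> u" "u \<in> Y" by auto
    then have "u \<in> carrier G" using assms(2) by auto
    then show "(H #> x) \<otimes>\<^bsub>G Mod H\<^esub> z = z \<otimes>\<^bsub>G Mod H\<^esub> (H #> x)"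
      unfolding u(1) using commutator_mem_iff[OF assms(1), of u] assms(3)[OF u(2)] by blast
  qed (use assms Q.hom_closed in auto)
  then show ?thesis
    using commutator_mem_iff[OF assms(1) y] by blast
qed

text \<open>Modulo \<open>H\<close> the statement says that two generated subgroups commute if their generators do, and
  this passes to the quotient group.\<close>

lemma commutator_generate:
  assumes "X \<subseteq> carrier G" "Y \<subseteq> carrier G" "\<And>x y. x \<in> X \<Longrightarrow> y \<in> Y \<Longrightarrow> commutator G x y \<in> H"
    and "x \<in> generate G X" "y \<in> generate G Y"
  shows "commutator G x y \<in> H"
proof -
  have sw: "commutator G a b \<in> H" if "commutator G b a \<in> H" "a \<in> carrier G" "b \<in> carrier G" for a b
    using that m_inv_closed[of "commutator G b a"] by (simp add: inv_commutator)
  have gen: "generate G X \<subseteq> carrier G" "generate G Y \<subseteq> carrier G"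
    using assms generate_incl by auto
  have "commutator G x' y \<in> H" if "x' \<in> X" for x'
    using coset_commutes_generate[of x' Y y] assms that by auto
  then have "commutator G y x \<in> H"
    by (intro coset_commutes_generate[OF _ assms(1) _ assms(4)]) (use assms gen sw in blast)+
  then show ?thesis
    using sw assms gen by blast
qed

end

section \<open>Weighted commutators of the generators\<close>

lemma (in group) commutator_absorb_left:
  assumes "a \<in> carrier G" "b \<in> carrier G" "c \<in> carrier G" "b \<otimes> c = c \<otimes> b"
  shows "commutator G (a \<otimes> b) c = commutator G a c"
proof -
  have "a \<otimes> b \<otimes> c = (a \<otimes> c) \<otimes> b"
    using assms by (simp add: m_assoc)
  also have "\<dots> = commutator G a c \<otimes> (c \<otimes> a) \<otimes> b"
    by (subst commutator_mult_swap) (use assms in auto)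
  also have "\<dots> = commutator G a c \<otimes> (c \<otimes> (a \<otimes> b))"
    using assms by (simp add: m_assoc)
  finally show ?thesis
    using assms by (subst commutator_eq_iff) auto
qed

lemma (in group) commutator_absorb_right:
  assumes "a \<in> carrier G" "b \<in> carrier G" "c \<in> carrier G" "c \<otimes> b = b \<otimes> c"
  shows "commutator G c (a \<otimes> b) = commutator G c a"
proof -
  have "inv (commutator G (a \<otimes> b) c) = inv (commutator G a c)"
    using commutator_absorb_left[of a b c] assms by simp
  then show ?thesis
    using assms by (simp add: inv_commutator)
qed

lemma (in group) subgroup_lower_central_series: "subgroup (lower_central_series G n) G"
proof (induction n)
  case (Suc n)
  then have "lower_central_series G n \<subseteq> carrier G"
    by (rule subgroup.subset)
  then show ?case
    unfolding lower_central_series.simps by (intro generate_is_subgroup) auto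
qed (simp add: subgroup_self)

text \<open>The commutator lies even deeper, in the term with index \<open>m + n + 1\<close>. The crude index that follows
  directly from the definition is enough to make deeply nested commutators trivial, and it avoids
  the three subgroups lemma.\<close>

lemma (in group) commutator_lower_central_series:
  assumes "x \<in> lower_central_series G m" "y \<in> lower_central_series G n"
  shows "commutator G x y \<in> lower_central_series G (Suc (max m n))"
proof -
  have left: "commutator G a b \<in> lower_central_series G (Suc l)"
    if "a \<in> lower_central_series G l" "b \<in> carrier G" for a b l
    unfolding lower_central_series.simps
    by (rule generate.incl) (use that in \<open>auto simp: commutator_def\<close>)
  have xy: "x \<in> carrier G" "y \<in> carrier G"
    using assms subgroup.subset[OF subgroup_lower_central_series] by blast+
  show ?thesis
  proof (cases "n \<le> m")
    case True
    then show ?thesis using left[OF assms(1) xy(2)] by (simp add: max_def)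
  next
    case False
    have "inv (commutator G y x) \<in> lower_central_series G (Suc n)"
      using left[OF assms(2) xy(1)] subgroup.m_inv_closed[OF subgroup_lower_central_series] by blast
    then show ?thesis using False xy by (simp add: inv_commutator max_def)
  qed
qed

lemma (in group) lower_central_series_trivial_mono:
  assumes "lower_central_series G m = {\<one>}" "m \<le> n"
  shows "lower_central_series G n = {\<one>}"
  using assms(2)
proof (induction n rule: dec_induct)
  case (step n)
  have "(\<Union>x\<in>{\<one>}. \<Union>y\<in>carrier G. {x \<otimes> y \<otimes> inv x \<otimes> inv y}) = {\<one>}"
    by (auto intro!: exI[of _ \<one>])
  then show ?case
    using step by (simp add: generate_one)
qed (use assms in simp)

locale weighted_generators = group G for G (structure) +
  fixes I :: "nat set" and s :: "nat \<Rightarrow> 'a" and w :: "nat \<Rightarrow> real"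
  assumes finite_I: "finite I"
    and s_carrier: "i \<in> I \<Longrightarrow> s i \<in> carrier G"
    and generating: "generate G (s ` I) = carrier G"
    and w_pos: "i \<in> I \<Longrightarrow> w i > 0"
    and nilpotent: "nilpotent_group G"
begin

text \<open>\<open>letter h x v\<close> says that \<open>x\<close> is the value of an iterated commutator of generators and inverse
  generators with nesting depth \<open>h\<close> and total weight \<open>v\<close>. The inverses are included because this
  makes the set of letters closed under inversion: the inverse of a commutator is the commutator
  with its arguments exchanged. The depth only serves to bound the set of nontrivial letters.\<close>

inductive letter :: "nat \<Rightarrow> 'a \<Rightarrow> real \<Rightarrow> bool" where
  gen: "i \<in> I \<Longrightarrow> letter 0 (s i) (w i)"
| gen_inv: "i \<in> I \<Longrightarrow> letter 0 (inv (s i)) (w i)"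
| comm: "letter m x u \<Longrightarrow> letter n y v \<Longrightarrow> letter (Suc (max m n)) (commutator G x y) (u + v)"

lemma letter_carrier: "letter h x v \<Longrightarrow> x \<in> carrier G"
  by (induction rule: letter.induct) (auto simp: s_carrier)

lemma letter_pos: "letter h x v \<Longrightarrow> v > 0"
  by (induction rule: letter.induct) (auto simp: w_pos)

lemma letter_inv: "letter h x v \<Longrightarrow> letter h (inv x) v"
proof (induction rule: letter.induct)
  case (comm m x u n y v)
  then show ?case
    using letter.comm[of n y v m x u] by (simp add: inv_commutator letter_carrier max.commute add.commute)
qed (auto simp: s_carrier intro: letter.intros)

lemma letter_lower_central_series: "letter h x v \<Longrightarrow> x \<in> lower_central_series G h"
  by (induction rule: letter.induct) (auto simp: s_carrier intro: commutator_lower_central_series simp del: lower_central_series.simps(2))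

lemma finite_letters_height: "finite {(x, v). \<exists>h\<le>n. letter h x v}" (is "finite (?A n)")
proof (induction n)
  case 0
  have "?A 0 \<subseteq> (\<lambda>i. (s i, w i)) ` I \<union> (\<lambda>i. (inv (s i), w i)) ` I"
  proof (clarsimp, goal_cases)
    case (1 x v)
    from \<open>letter 0 x v\<close> show ?case
      by cases (use 1 in auto)
  qed
  then show ?case
    by (rule finite_subset) (simp add: finite_I)
next
  case (Suc n)
  have "?A (Suc n) \<subseteq> ?A n \<union> (\<lambda>((x, u), (y, v)). (commutator G x y, u + v)) ` (?A n \<times> ?A n)"
  proof
    fix p assume "p \<in> ?A (Suc n)"
    then obtain x v h where p: "p = (x, v)" "h \<le> Suc n" and l: "letter h x v"
      by auto
    show "p \<in> ?A n \<union> (\<lambda>((x, u), (y, v)). (commutator G x y, u + v)) ` (?A n \<times> ?A n)"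
      using l
    proof cases
      case (comm m a u k b t)
      have "((a, u), (b, t)) \<in> ?A n \<times> ?A n"
        using comm p(2) by auto
      then show ?thesis
        using comm(2,3) p(1) by (intro UnI2 image_eqI[where x = "((a, u), (b, t))"]) auto
    qed (use l p(1) in \<open>auto intro!: exI[of _ 0]\<close>)
  qed
  then show ?case
    by (rule finite_subset) (intro finite_UnI finite_imageI finite_SigmaI Suc)
qed

text \<open>An element may occur with several weights.\<close>

definition alphabet :: "('a \<times> real) set" where
  "alphabet = {(x, v). x \<noteq> \<one> \<and> (\<exists>h. letter h x v)}"

lemma finite_alphabet: "finite alphabet"
proof -
  obtain N where N: "lower_central_series G N = {\<one>}"
    using nilpotent by (auto simp: nilpotent_group_def)
  have "alphabet \<subseteq> {(x, v). \<exists>h\<le>N. letter h x v}"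
  proof (clarsimp simp: alphabet_def)
    fix x v h assume x: "x \<noteq> \<one>" and l: "letter h x v"
    have "\<not> N \<le> h"
      using x letter_lower_central_series[OF l] lower_central_series_trivial_mono[OF N, of h] by auto
    then show "\<exists>h\<le>N. letter h x v" using l by (intro exI[of _ h]) auto
  qed
  then show ?thesis
    using finite_letters_height finite_subset by blast
qed

text \<open>The sets \<open>T\<close> of interest are half-lines: \<open>weight_subgroup {v..}\<close> for varying \<open>v\<close> is a weighted form
  of the lower central series, and \<open>weight_subgroup {v<..}\<close> is the next term after it.\<close>

definition weight_subgroup :: "real set \<Rightarrow> 'a set" where
  "weight_subgroup T = generate G {x. \<exists>h v. letter h x v \<and> v \<in> T}"

lemma weight_letters_carrier: "{x. \<exists>h v. letter h x v \<and> v \<in> T} \<subseteq> carrier G"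
  using letter_carrier by auto

lemma subgroup_weight_subgroup: "subgroup (weight_subgroup T) G"
  unfolding weight_subgroup_def by (rule generate_is_subgroup[OF weight_letters_carrier])

lemma weight_subgroup_carrier: "weight_subgroup T \<subseteq> carrier G"
  using subgroup.subset[OF subgroup_weight_subgroup] .

lemma letter_in_weight_subgroup: "letter h x v \<Longrightarrow> v \<in> T \<Longrightarrow> x \<in> weight_subgroup T"
  unfolding weight_subgroup_def by (rule generate.incl) auto

lemma weight_subgroup_mono: "T \<subseteq> U \<Longrightarrow> weight_subgroup T \<subseteq> weight_subgroup U"
  unfolding weight_subgroup_def by (rule mono_generate) auto

lemma generate_signed: "generate G (s ` I \<union> (\<lambda>i. inv (s i)) ` I) = carrier G"
proof
  show "carrier G \<subseteq> generate G (s ` I \<union> (\<lambda>i. inv (s i)) ` I)"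
    unfolding generating[symmetric] by (rule mono_generate) auto
  show "generate G (s ` I \<union> (\<lambda>i. inv (s i)) ` I) \<subseteq> carrier G"
    by (rule generate_incl) (auto simp: s_carrier)
qed

text \<open>Conjugating a letter \<open>x\<close> by a generator \<open>a\<close> gives the product of the commutator of \<open>a\<close> and \<open>x\<close>, whose
  weight is larger, with \<open>x\<close>.\<close>

lemma conj_weight_subgroup:
  assumes T: "\<And>v u. v \<in> T \<Longrightarrow> u > 0 \<Longrightarrow> u + v \<in> T"
    and g: "g \<in> carrier G" and x: "x \<in> weight_subgroup T"
  shows "g \<otimes> x \<otimes> inv g \<in> weight_subgroup T"
proof -
  interpret W: subgroup "weight_subgroup T" G by (rule subgroup_weight_subgroup)
  let ?S = "s ` I \<union> (\<lambda>i. inv (s i)) ` I"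
  have letter_case: "a \<otimes> x \<otimes> inv a \<in> weight_subgroup T"
    if a: "letter 0 a u" and x: "letter h x v" "v \<in> T" for a u x h v
  proof -
    have ac: "a \<in> carrier G" "x \<in> carrier G" using a x letter_carrier by auto
    have "letter (Suc (max 0 h)) (commutator G a x) (u + v)"
      by (rule letter.comm) fact+
    moreover have "u + v \<in> T" using T x letter_pos a by blast
    ultimately have "commutator G a x \<otimes> x \<in> weight_subgroup T"
      using x letter_in_weight_subgroup by blast
    moreover have "commutator G a x \<otimes> x = a \<otimes> x \<otimes> inv a"
      using ac by (simp add: commutator_def m_assoc)
    ultimately show ?thesis by simp
  qed
  have gen_case: "a \<otimes> x \<otimes> inv a \<in> weight_subgroup T" if a: "letter 0 a u" and x: "x \<in> weight_subgroup T" for a u x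
  proof -
    have ac: "a \<in> carrier G" using a letter_carrier by auto
    have "(\<lambda>x. a \<otimes> x \<otimes> inv a) \<in> hom G G"
      using ac by (auto simp: hom_def m_assoc)
    then interpret conj: group_hom G G "\<lambda>x. a \<otimes> x \<otimes> inv a"
      by (intro group_hom.intro group_hom_axioms.intro is_group)
    have "(\<lambda>x. a \<otimes> x \<otimes> inv a) ` weight_subgroup T
        = generate G ((\<lambda>x. a \<otimes> x \<otimes> inv a) ` {x. \<exists>h v. letter h x v \<and> v \<in> T})"
      unfolding weight_subgroup_def by (rule conj.generate_img[OF weight_letters_carrier, symmetric])
    also have "\<dots> \<subseteq> weight_subgroup T"
      by (rule generate_subgroup_incl[OF _ subgroup_weight_subgroup]) (use letter_case[OF a] in auto)
    finally have "(\<lambda>x. a \<otimes> x \<otimes> inv a) ` weight_subgroup T \<subseteq> weight_subgroup T" .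
    then show ?thesis
      using x by blast
  qed
  have "g \<in> generate G ?S" using g generate_signed by simp
  then have "\<forall>x\<in>weight_subgroup T. g \<otimes> x \<otimes> inv g \<in> weight_subgroup T"
  proof (induction rule: generate.induct)
    case one
    then show ?case using weight_subgroup_carrier by auto
  next
    case (incl h)
    then show ?case using gen_case letter.intros by blast
  next
    case (inv h)
    then have "\<exists>u. letter 0 (inv h) u"
      using letter.intros s_carrier by fastforce
    then show ?case using gen_case by blast
  next
    case (eng h1 h2)
    then have "h1 \<in> carrier G" "h2 \<in> carrier G"
      using generate_signed by auto
    show ?case
    proof
      fix x assume x: "x \<in> weight_subgroup T"
      then have "h1 \<otimes> (h2 \<otimes> x \<otimes> inv h2) \<otimes> inv h1 \<in> weight_subgroup T" using eng by blast
      also have "h1 \<otimes> (h2 \<otimes> x \<otimes> inv h2) \<otimes> inv h1 = h1 \<otimes> h2 \<otimes> x \<otimes> inv (h1 \<otimes> h2)"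
        using x weight_subgroup_carrier[of T] \<open>h1 \<in> carrier G\<close> \<open>h2 \<in> carrier G\<close>
        by (auto simp: inv_mult_group m_assoc)
      finally show "h1 \<otimes> h2 \<otimes> x \<otimes> inv (h1 \<otimes> h2) \<in> weight_subgroup T" .
    qed
  qed
  then show ?thesis using x by blast
qed

lemma normal_weight_subgroup:
  assumes "\<And>v u. v \<in> T \<Longrightarrow> u > 0 \<Longrightarrow> u + v \<in> T"
  shows "weight_subgroup T \<lhd> G"
  unfolding normal_inv_iff using conj_weight_subgroup[OF assms] subgroup_weight_subgroup by blast

lemma commutator_weight_subgroup:
  assumes "\<And>u v. u \<in> T \<Longrightarrow> v \<in> U \<Longrightarrow> u + v \<in> V" "\<And>v u. v \<in> V \<Longrightarrow> u > 0 \<Longrightarrow> u + v \<in> V"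
    and "x \<in> weight_subgroup T" "y \<in> weight_subgroup U"
  shows "commutator G x y \<in> weight_subgroup V"
proof -
  interpret normal "weight_subgroup V" G by (rule normal_weight_subgroup) fact
  show ?thesis
  proof (rule commutator_generate)
    fix a b assume "a \<in> {x. \<exists>h v. letter h x v \<and> v \<in> T}" "b \<in> {x. \<exists>h v. letter h x v \<and> v \<in> U}"
    then show "commutator G a b \<in> weight_subgroup V"
      using assms(1) letter.comm letter_in_weight_subgroup by blast
  qed (use weight_letters_carrier assms in \<open>auto simp: weight_subgroup_def\<close>)
qed

text \<open>Modulo larger weight than \<open>u + v\<close>, the element \<open>x\<close> may be multiplied by elements of weight larger
  than \<open>u\<close>, and \<open>y\<close> by elements of weight larger than \<open>v\<close>, without changing the commutator. The
  commutator of \<open>x\<close> and \<open>y\<close> itself becomes central for \<open>x\<close> and \<open>y\<close>, so that powers can be taken out.\<close>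

lemma commutator_bilinear:
  assumes x: "letter l x u" and y: "letter l' y v"
    and g: "g \<in> carrier G" "weight_subgroup {u<..} #> g = weight_subgroup {u<..} #> x [^] (a::int)"
    and h: "h \<in> carrier G" "weight_subgroup {v<..} #> h = weight_subgroup {v<..} #> y [^] (b::int)"
  shows "weight_subgroup {u+v<..} #> commutator G g h = weight_subgroup {u+v<..} #> commutator G x y [^] (a * b)"
proof -
  let ?M = "weight_subgroup {u+v<..}"
  let ?q = "\<lambda>x. ?M #> x" and ?Q = "G Mod ?M"
  have nn: "weight_subgroup {r<..} \<lhd> G" for r
    by (rule normal_weight_subgroup) auto
  interpret normal ?M G by (rule nn)
  interpret Q: group_hom G ?Q ?q by (rule quotient_hom)
  have xc: "x \<in> carrier G" "y \<in> carrier G" using x y letter_carrier by auto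
  have uv: "u > 0" "v > 0" using x y letter_pos by auto
  define t where "t = inv (x [^] a) \<otimes> g"
  define r where "r = inv (y [^] b) \<otimes> h"
  have t: "t \<in> weight_subgroup {u<..}" and r: "r \<in> weight_subgroup {v<..}"
    using normal.coset_eq_iff_left[OF nn] g(1) g(2)[symmetric] h(1) h(2)[symmetric] xc by (simp_all add: t_def r_def)
  have tc: "t \<in> carrier G" "r \<in> carrier G" using t r weight_subgroup_carrier by blast+
  have geq: "g = x [^] a \<otimes> t" and heq: "h = y [^] b \<otimes> r"
    using g h xc by (simp_all add: t_def r_def)
  have xW: "x \<in> weight_subgroup {u..}" and yW: "y \<in> weight_subgroup {v..}"
    using x y letter_in_weight_subgroup by auto
  have hW: "h \<in> weight_subgroup {v..}"
    unfolding heq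
    using yW r subgroup_int_pow_closed[OF subgroup_weight_subgroup, of y "{v..}" b]
      weight_subgroup_mono[of "{v<..}" "{v..}"] subgroup.m_closed[OF subgroup_weight_subgroup]
    by fastforce
  have xaW: "x [^] a \<in> weight_subgroup {u..}"
    using xW subgroup_int_pow_closed[OF subgroup_weight_subgroup] by blast
  define z where "z = commutator G x y"
  have zc: "z \<in> carrier G" using xc by (simp add: z_def)
  have zW: "z \<in> weight_subgroup {u+v..}"
    unfolding z_def by (rule commutator_weight_subgroup[OF _ _ xW yW]) auto
  have th: "commutator G t h \<in> ?M"
    by (rule commutator_weight_subgroup[OF _ _ t hW]) auto
  have xr: "commutator G (x [^] a) r \<in> ?M"
    by (rule commutator_weight_subgroup[OF _ _ xaW r]) auto
  have zx: "commutator G z x \<in> ?M"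
    by (rule commutator_weight_subgroup[OF _ _ zW xW]) (use uv in auto)
  have zy: "commutator G z y \<in> ?M"
    by (rule commutator_weight_subgroup[OF _ _ zW yW]) (use uv in auto)
  note qc = Q.hom_closed
  have "?q (commutator G g h) = commutator ?Q (?q g) (?q h)"
    using g h by (simp add: Q.hom_commutator)
  also have "?q g = ?q (x [^] a) \<otimes>\<^bsub>?Q\<^esub> ?q t"
    unfolding geq by (rule Q.hom_mult) (use xc tc in auto)
  also have "commutator ?Q (?q (x [^] a) \<otimes>\<^bsub>?Q\<^esub> ?q t) (?q h) = commutator ?Q (?q (x [^] a)) (?q h)"
    by (rule Q.H.commutator_absorb_left; (rule qc)?) (use xc tc h th commutator_mem_iff[of t h] in auto)
  also have "?q h = ?q (y [^] b) \<otimes>\<^bsub>?Q\<^esub> ?q r"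
    unfolding heq by (rule Q.hom_mult) (use xc tc in auto)
  also have "commutator ?Q (?q (x [^] a)) (?q (y [^] b) \<otimes>\<^bsub>?Q\<^esub> ?q r) = commutator ?Q (?q (x [^] a)) (?q (y [^] b))"
    by (rule Q.H.commutator_absorb_right; (rule qc)?) (use xc tc xr commutator_mem_iff[of "x [^] a" r] in auto)
  also have "\<dots> = commutator ?Q (?q x [^]\<^bsub>?Q\<^esub> a) (?q y [^]\<^bsub>?Q\<^esub> b)"
    using xc by (simp add: FactGroup_int_pow)
  also have "\<dots> = commutator ?Q (?q x) (?q y) [^]\<^bsub>?Q\<^esub> (a * b)"
  proof (rule Q.H.commutator_int_pow)
    have c: "commutator ?Q (?q x) (?q y) = ?q z"
      unfolding z_def using Q.hom_commutator xc by simp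
    show "commutator ?Q (?q x) (?q y) \<otimes>\<^bsub>?Q\<^esub> ?q x = ?q x \<otimes>\<^bsub>?Q\<^esub> commutator ?Q (?q x) (?q y)"
      unfolding c using zx zc xc commutator_mem_iff by simp
    show "commutator ?Q (?q x) (?q y) \<otimes>\<^bsub>?Q\<^esub> ?q y = ?q y \<otimes>\<^bsub>?Q\<^esub> commutator ?Q (?q x) (?q y)"
      unfolding c using zy zc xc commutator_mem_iff by simp
  qed (use xc qc in auto)
  also have "\<dots> = ?q (commutator G x y [^] (a * b))"
    using xc Q.hom_commutator[of x y] FactGroup_int_pow[of "commutator G x y" "a * b"] by simp
  finally show ?thesis .
qed

end

section \<open>Weighted word length and the size of its balls\<close>

context weighted_generators begin

text \<open>At scale \<open>R\<close> a letter of weight \<open>v\<close> costs \<open>R powr - v\<close>, so that a word of cost at most \<open>K\<close> contains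
  it at most \<open>K * R powr v\<close> times. All constants below are uniform in \<open>R\<close>.\<close>

inductive word_cost :: "('a \<times> real) set \<Rightarrow> real \<Rightarrow> 'a \<Rightarrow> real \<Rightarrow> bool" for Q R where
  one: "word_cost Q R \<one> 0"
| mult: "word_cost Q R g a \<Longrightarrow> (x, v) \<in> Q \<Longrightarrow> y = x \<or> y = inv x \<Longrightarrow>
    word_cost Q R (g \<otimes> y) (a + R powr - v)"

definition cost_le :: "('a \<times> real) set \<Rightarrow> real \<Rightarrow> real \<Rightarrow> 'a \<Rightarrow> bool" where
  "cost_le Q R B g \<longleftrightarrow> (\<exists>a\<le>B. word_cost Q R g a)"

lemma alphabet_carrier: "(x, v) \<in> alphabet \<Longrightarrow> x \<in> carrier G"
  by (auto simp: alphabet_def letter_carrier)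

lemma word_cost_carrier: "word_cost Q R g a \<Longrightarrow> Q \<subseteq> alphabet \<Longrightarrow> g \<in> carrier G"
  by (induction rule: word_cost.induct) (auto dest: alphabet_carrier)

lemma word_cost_nonneg: "word_cost Q R g a \<Longrightarrow> a \<ge> 0"
  by (induction rule: word_cost.induct) auto

lemma word_cost_mult:
  assumes "word_cost Q R h b" "word_cost Q R g a" "Q \<subseteq> alphabet"
  shows "word_cost Q R (g \<otimes> h) (a + b)"
  using assms(1)
proof (induction rule: word_cost.induct)
  case one
  then show ?case using assms word_cost_carrier by auto
next
  case (mult h b x v y)
  then have "y \<in> carrier G"
    using assms alphabet_carrier by auto
  then have "g \<otimes> (h \<otimes> y) = (g \<otimes> h) \<otimes> y"
    using mult assms word_cost_carrier by (auto simp: m_assoc)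
  then show ?case
    using word_cost.mult[OF mult.IH mult.hyps(2,3)] by (simp add: add.assoc)
qed

lemma word_cost_letter:
  assumes "(x, v) \<in> Q" "Q \<subseteq> alphabet" "y = x \<or> y = inv x"
  shows "word_cost Q R y (R powr - v)"
  using word_cost.mult[OF word_cost.one assms(1,3), of R] alphabet_carrier[of x v] assms by auto

lemma word_cost_inv:
  assumes "word_cost Q R g a" "Q \<subseteq> alphabet"
  shows "word_cost Q R (inv g) a"
  using assms(1)
proof (induction rule: word_cost.induct)
  case one
  then show ?case using word_cost.one by simp
next
  case (mult g a x v y)
  have x: "x \<in> carrier G" using mult assms alphabet_carrier by auto
  then have "inv (g \<otimes> y) = inv y \<otimes> inv g"
    using mult assms word_cost_carrier by (intro inv_mult_group) auto
  moreover have y: "word_cost Q R (inv y) (R powr - v)"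
    using word_cost_letter[OF mult.hyps(2) assms(2), of "inv y" R] mult.hyps(3) x by auto
  ultimately show ?case
    using word_cost_mult[OF mult.IH y assms(2)] by (simp add: add.commute)
qed

lemma cost_le_mono: "cost_le Q R B g \<Longrightarrow> B \<le> B' \<Longrightarrow> cost_le Q R B' g"
  unfolding cost_le_def by (meson order_trans)

lemma cost_le_carrier: "cost_le Q R B g \<Longrightarrow> Q \<subseteq> alphabet \<Longrightarrow> g \<in> carrier G"
  unfolding cost_le_def using word_cost_carrier by blast

lemma cost_le_one: "B \<ge> 0 \<Longrightarrow> cost_le Q R B \<one>"
  unfolding cost_le_def using word_cost.one by blast

lemma cost_le_mult:
  "cost_le Q R B g \<Longrightarrow> cost_le Q R B' h \<Longrightarrow> Q \<subseteq> alphabet \<Longrightarrow> cost_le Q R (B + B') (g \<otimes> h)"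
  unfolding cost_le_def using word_cost_mult by (meson add_mono)

lemma cost_le_inv: "cost_le Q R B g \<Longrightarrow> Q \<subseteq> alphabet \<Longrightarrow> cost_le Q R B (inv g)"
  unfolding cost_le_def using word_cost_inv by blast

lemma cost_le_letter: "(x, v) \<in> Q \<Longrightarrow> Q \<subseteq> alphabet \<Longrightarrow> cost_le Q R (R powr - v) x"
  unfolding cost_le_def using word_cost_letter by blast

lemma cost_le_nat_pow:
  assumes "cost_le Q R B g" "Q \<subseteq> alphabet"
  shows "cost_le Q R (real n * B) (g [^] n)"
proof (induction n)
  case (Suc n)
  then show ?case
    using cost_le_mult[OF Suc assms(1) assms(2)] by (simp add: algebra_simps)
qed (simp add: cost_le_one)

lemma cost_le_int_pow:
  assumes "cost_le Q R B g" "Q \<subseteq> alphabet"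
  shows "cost_le Q R (real_of_int \<bar>j\<bar> * B) (g [^] (j::int))"
proof (cases j)
  case (nonneg n)
  then show ?thesis using cost_le_nat_pow[OF assms] by (simp add: int_pow_int)
next
  case (neg n)
  have "g [^] j = inv (g [^] Suc n)"
    using int_pow_neg_int cost_le_carrier[OF assms] neg by blast
  moreover have "real_of_int \<bar>j\<bar> = real (Suc n)"
    using neg by simp
  ultimately show ?thesis
    using cost_le_inv[OF cost_le_nat_pow[OF assms, of "Suc n"] assms(2)] by simp
qed

lemma cost_le_generate:
  assumes "g \<in> generate G (fst ` Q)" "Q \<subseteq> alphabet" "\<And>x u. (x, u) \<in> Q \<Longrightarrow> v \<le> u"
  shows "\<exists>C\<ge>0. \<forall>R\<ge>1. cost_le Q R (C * R powr - v) g"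
  using assms(1)
proof (induction rule: generate.induct)
  case one
  then show ?case using cost_le_one by (intro exI[of _ 0]) auto
next
  case (incl h)
  then obtain u where u: "(h, u) \<in> Q" by auto
  have "cost_le Q R (1 * R powr - v) h" if "R \<ge> 1" for R
    by (rule cost_le_mono[OF cost_le_letter[OF u assms(2)]])
       (use assms(3)[OF u] that in \<open>auto intro: powr_mono\<close>)
  then show ?case by (intro exI[of _ 1]) auto
next
  case (inv h)
  then obtain u where u: "(h, u) \<in> Q" by auto
  have "cost_le Q R (1 * R powr - v) (inv h)" if "R \<ge> 1" for R
    by (rule cost_le_mono[OF cost_le_inv[OF cost_le_letter[OF u assms(2)] assms(2)]])
       (use assms(3)[OF u] that in \<open>auto intro: powr_mono\<close>)
  then show ?case by (intro exI[of _ 1]) auto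
next
  case (eng h1 h2)
  then obtain C1 C2 where "C1 \<ge> 0" "C2 \<ge> 0"
    and C: "\<forall>R\<ge>1. cost_le Q R (C1 * R powr - v) h1" "\<forall>R\<ge>1. cost_le Q R (C2 * R powr - v) h2"
    by blast
  then show ?case
    using cost_le_mult[OF _ _ assms(2)] by (intro exI[of _ "C1 + C2"]) (auto simp: algebra_simps)
qed

text \<open>This is what the tails of the sorted alphabet satisfy. The commutator of any letter with a member
  has larger weight than the member, so it is trivial or a later member.\<close>

definition upper_list :: "('a \<times> real) list \<Rightarrow> bool" where
  "upper_list qs \<longleftrightarrow> sorted (map snd qs) \<and> set qs \<subseteq> alphabet \<and>
     (\<forall>(x, v)\<in>set qs. \<forall>(y, u)\<in>alphabet. v < u \<longrightarrow> (y, u) \<in> set qs)"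

lemma upper_list_alphabet: "upper_list qs \<Longrightarrow> set qs \<subseteq> alphabet"
  by (simp add: upper_list_def)

lemma upper_list_Cons:
  assumes "upper_list ((c, v) # qs)"
  shows "upper_list qs" "(c, v) \<in> alphabet" "\<And>x u. (x, u) \<in> set qs \<Longrightarrow> v \<le> u"
    and "\<And>x u. (x, u) \<in> alphabet \<Longrightarrow> v < u \<Longrightarrow> (x, u) \<in> set qs"
proof -
  show le: "v \<le> u" if "(x, u) \<in> set qs" for x u
    using assms that by (force simp: upper_list_def)
  show "(x, u) \<in> set qs" if "(x, u) \<in> alphabet" "v < u" for x u
    using assms that by (force simp: upper_list_def)
  then show "upper_list qs"
    using assms le by (fastforce simp: upper_list_def)
qed (use assms in \<open>simp add: upper_list_def\<close>)

text \<open>Conjugating \<open>d\<close> by one more factor \<open>e\<close> multiplies the result by a conjugate of the commutator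
  \<open>f\<close> of \<open>e\<close> and \<open>d\<close>. The weight of \<open>f\<close> exceeds that of \<open>d\<close> by \<open>v\<close>, so each conjugate of \<open>f\<close> is cheaper by the
  factor \<open>R powr - v\<close>, which pays for the at most \<open>K * R powr v\<close> conjugates that accumulate. As \<open>f\<close> is a
  later letter, induction from the end of the list applies.\<close>

lemma conj_cost_le:
  assumes "upper_list rs" "set rs \<subseteq> set qs" "set qs \<subseteq> alphabet" and e: "letter h e v" and K: "K \<ge> 0"
  shows "\<exists>C\<ge>0. \<forall>R\<ge>1. \<forall>d u. (d, u) \<in> set rs \<longrightarrow> (\<forall>j::nat. real j \<le> K * R powr v \<longrightarrow>
    cost_le (set qs) R (C * R powr - u) (e [^] j \<otimes> d \<otimes> inv (e [^] j)))"
  using assms(1,2)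
proof (induction rs)
  case (Cons p rs)
  obtain d u where p: "p = (d, u)" by fastforce
  note up = upper_list_Cons[OF Cons.prems(1)[unfolded p]]
  obtain C where C: "C \<ge> 0" and IH: "\<And>R d u j. R \<ge> 1 \<Longrightarrow> (d, u) \<in> set rs \<Longrightarrow> real j \<le> K * R powr v \<Longrightarrow>
      cost_le (set qs) R (C * R powr - u) (e [^] j \<otimes> d \<otimes> inv (e [^] j))"
    using Cons.IH[OF up(1)] Cons.prems(2) by auto
  obtain hd where hd: "letter hd d u" using up(2) by (auto simp: alphabet_def)
  have ec: "e \<in> carrier G" and dc: "d \<in> carrier G" using e hd letter_carrier by auto
  have v: "v > 0" using e letter_pos by auto
  define f where "f = commutator G e d"
  have f: "f = \<one> \<or> (f, v + u) \<in> set rs"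
    using letter.comm[OF e hd] up(4)[of f "v + u"] v unfolding f_def alphabet_def by auto
  have fc: "f \<in> carrier G" using ec dc by (simp add: f_def)
  have step: "cost_le (set qs) R ((1 + real j * C * R powr - v) * R powr - u) (e [^] j \<otimes> d \<otimes> inv (e [^] j))"
    if R: "R \<ge> 1" and "real j \<le> K * R powr v" for R j
    using that(2)
  proof (induction j)
    case 0
    then show ?case
      using cost_le_letter[of d u "set qs" R] Cons.prems(2) assms(3) dc p by auto
  next
    case (Suc j)
    have "cost_le (set qs) R (C * R powr - (v + u)) (e [^] j \<otimes> f \<otimes> inv (e [^] j))"
    proof (cases "f = \<one>")
      case True
      then show ?thesis using C ec by (simp add: cost_le_one)
    next
      case False
      then show ?thesis using f IH[OF R, of f "v + u" j] Suc.prems by simp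
    qed
    from cost_le_mult[OF this Suc.IH assms(3)]
    have "cost_le (set qs) R (C * R powr - (v + u) + (1 + real j * C * R powr - v) * R powr - u)
        ((e [^] j \<otimes> f \<otimes> inv (e [^] j)) \<otimes> (e [^] j \<otimes> d \<otimes> inv (e [^] j)))"
      using Suc.prems by simp
    moreover have "(e [^] j \<otimes> f \<otimes> inv (e [^] j)) \<otimes> (e [^] j \<otimes> d \<otimes> inv (e [^] j))
        = e [^] j \<otimes> (f \<otimes> d) \<otimes> inv (e [^] j)"
      using ec fc dc by (simp add: m_assoc)
    moreover have "f \<otimes> d = e \<otimes> d \<otimes> inv e"
      using ec dc by (simp add: f_def commutator_def m_assoc)
    moreover have "e [^] j \<otimes> (e \<otimes> d \<otimes> inv e) \<otimes> inv (e [^] j) = e [^] Suc j \<otimes> d \<otimes> inv (e [^] Suc j)"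
      using ec dc by (simp add: m_assoc inv_mult_group)
    moreover have "C * R powr - (v + u) + (1 + real j * C * R powr - v) * R powr - u
        = (1 + real (Suc j) * C * R powr - v) * R powr - u"
    proof -
      have "R powr - (v + u) = R powr - v * R powr - u"
        by (simp flip: powr_add)
      then show ?thesis by (simp add: algebra_simps)
    qed
    ultimately show ?case by simp
  qed
  have main: "cost_le (set qs) R ((1 + C + K * C) * R powr - t) (e [^] j \<otimes> x \<otimes> inv (e [^] j))"
    if R: "R \<ge> 1" and x: "(x, t) \<in> set (p # rs)" and j: "real j \<le> K * R powr v" for R x t j
  proof (cases "(x, t) \<in> set rs")
    case True
    have "cost_le (set qs) R (C * R powr - t) (e [^] j \<otimes> x \<otimes> inv (e [^] j))"
      using IH[OF R True j] .
    then show ?thesis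
      by (rule cost_le_mono) (use C K in \<open>auto intro!: mult_right_mono\<close>)
  next
    case False
    then have xt: "x = d" "t = u" using x p by auto
    have "real j * R powr - v \<le> K * R powr v * R powr - v"
      by (intro mult_right_mono j) auto
    then have "real j * R powr - v \<le> K"
      using R by (simp add: powr_minus field_simps)
    then have "C * (real j * R powr - v) \<le> C * K"
      using C by (rule mult_left_mono)
    then show ?thesis
      unfolding xt using C
      by (intro cost_le_mono[OF step[OF R j]] mult_right_mono) (auto simp: mult.commute mult.left_commute)
  qed
  show ?case
    by (rule exI[of _ "1 + C + K * C"]) (use main C K in auto)
qed auto

text \<open>The collection step: all occurrences of the first letter \<open>c\<close> are moved to the right end of the
  word. Every other letter is then conjugated by a power of \<open>c\<close> with exponent at most the number of
  occurrences of \<open>c\<close>, so by the previous lemma its cost grows by a bounded factor only.\<close>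

lemma extract_head:
  assumes up: "upper_list ((c, v) # qs)" and K: "K \<ge> 0"
  shows "\<exists>C\<ge>0. \<forall>R\<ge>1. \<forall>g a. word_cost (set ((c, v) # qs)) R g a \<longrightarrow> a \<le> K \<longrightarrow>
    (\<exists>(j::int) h. g = h \<otimes> c [^] j \<and> real_of_int \<bar>j\<bar> * R powr - v \<le> a \<and> cost_le (set qs) R (C * a) h)"
proof -
  note up' = upper_list_Cons[OF up]
  have A: "set qs \<subseteq> alphabet" using up'(1) upper_list_alphabet by auto
  obtain hc where c: "letter hc c v" using up'(2) by (auto simp: alphabet_def)
  have cc: "c \<in> carrier G" using c letter_carrier by auto
  obtain C1 where C1: "C1 \<ge> 0" "\<And>R d u j. R \<ge> 1 \<Longrightarrow> (d, u) \<in> set qs \<Longrightarrow> real j \<le> K * R powr v \<Longrightarrow>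
      cost_le (set qs) R (C1 * R powr - u) (c [^] j \<otimes> d \<otimes> inv (c [^] j))"
    using conj_cost_le[OF up'(1) order_refl A c K] by metis
  obtain C2 where C2: "C2 \<ge> 0" "\<And>R d u j. R \<ge> 1 \<Longrightarrow> (d, u) \<in> set qs \<Longrightarrow> real j \<le> K * R powr v \<Longrightarrow>
      cost_le (set qs) R (C2 * R powr - u) (inv c [^] j \<otimes> d \<otimes> inv (inv c [^] j))"
    using conj_cost_le[OF up'(1) order_refl A letter_inv[OF c] K] by metis
  define C where "C = C1 + C2"
  have conj: "cost_le (set qs) R (C * R powr - u) (c [^] j \<otimes> d \<otimes> inv (c [^] j))"
    if R: "R \<ge> 1" and d: "(d, u) \<in> set qs" and j: "real_of_int \<bar>j\<bar> * R powr - v \<le> K" for R d u and j :: int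
  proof -
    have le: "C1 * R powr - u \<le> C * R powr - u" "C2 * R powr - u \<le> C * R powr - u"
      using C1(1) C2(1) by (auto simp: C_def intro!: mult_right_mono)
    have j': "real_of_int \<bar>j\<bar> \<le> K * R powr v"
      using j R by (simp add: powr_minus field_simps)
    show ?thesis
    proof (cases j)
      case (nonneg n)
      then show ?thesis
        using cost_le_mono[OF C1(2)[OF R d, of n] le(1)] j'
        by (auto simp: int_pow_int)
    next
      case (neg n)
      have "c [^] j = inv c [^] Suc n"
        unfolding neg(1) using int_pow_neg_int[OF cc, of "Suc n"] nat_pow_inv[OF cc, of "Suc n"] by simp
      then show ?thesis
        using cost_le_mono[OF C2(2)[OF R d, of "Suc n"] le(2)] neg j'
        by (auto simp del: nat_pow_Suc)
    qed
  qed
  have main: "\<exists>(j::int) h. g = h \<otimes> c [^] j \<and> real_of_int \<bar>j\<bar> * R powr - v \<le> a \<and> cost_le (set qs) R (C * a) h"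
    if R: "R \<ge> 1" and "word_cost (set ((c, v) # qs)) R g a" "a \<le> K" for R g a
    using that(2,3)
  proof (induction rule: word_cost.induct)
    case one
    show ?case
      by (intro exI[of _ 0] exI[of _ \<one>]) (simp add: cost_le_one)
  next
    case (mult g a x u y)
    have aK: "a \<le> K" using mult.prems by (smt (verit) powr_ge_zero)
    then obtain j h where jh: "g = h \<otimes> c [^] j" "real_of_int \<bar>j\<bar> * R powr - v \<le> a" "cost_le (set qs) R (C * a) h"
      using mult.IH by blast
    have hc: "h \<in> carrier G" using cost_le_carrier[OF jh(3) A] .
    show ?case
    proof (cases "(x, u) \<in> set qs")
      case True
      have xc: "x \<in> carrier G" using True A alphabet_carrier by auto
      have cx: "cost_le (set qs) R (C * R powr - u) (c [^] j \<otimes> x \<otimes> inv (c [^] j))"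
        by (rule conj[OF R True]) (use jh aK in linarith)
      have "inv (c [^] j \<otimes> x \<otimes> inv (c [^] j)) = c [^] j \<otimes> inv x \<otimes> inv (c [^] j)"
        using cc xc by (simp add: m_assoc inv_mult_group)
      then have "cost_le (set qs) R (C * R powr - u) (c [^] j \<otimes> y \<otimes> inv (c [^] j))"
        using cx cost_le_inv[OF cx A] mult.hyps(3) by auto
      then have "cost_le (set qs) R (C * a + C * R powr - u) (h \<otimes> (c [^] j \<otimes> y \<otimes> inv (c [^] j)))"
        by (rule cost_le_mult[OF jh(3) _ A])
      moreover have "g \<otimes> y = h \<otimes> (c [^] j \<otimes> y \<otimes> inv (c [^] j)) \<otimes> c [^] j"
        using hc cc xc jh(1) mult.hyps(3) by (auto simp: m_assoc)
      moreover have "real_of_int \<bar>j\<bar> * R powr - v \<le> a + R powr - u"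
        using jh(2) by (smt (verit) powr_ge_zero)
      ultimately show ?thesis by (auto simp: distrib_left)
    next
      case False
      then have x: "x = c" "u = v" using mult by auto
      obtain e :: int where e: "\<bar>e\<bar> = 1" "y = c [^] e"
        using that[of 1] that[of "- 1"] mult.hyps(3) cc by (auto simp: x int_pow_neg)
      have "g \<otimes> y = h \<otimes> c [^] (j + e)"
        using hc cc jh(1) by (simp add: m_assoc e int_pow_mult)
      moreover have "real_of_int \<bar>j + e\<bar> * R powr - v \<le> (real_of_int \<bar>j\<bar> + 1) * R powr - v"
        using e(1) by (intro mult_right_mono) auto
      moreover have "(real_of_int \<bar>j\<bar> + 1) * R powr - v \<le> a + R powr - u"
        using jh(2) by (simp add: x algebra_simps)
      moreover have "cost_le (set qs) R (C * (a + R powr - u)) h"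
        by (rule cost_le_mono[OF jh(3)]) (use C1(1) C2(1) in \<open>auto simp: C_def intro!: mult_left_mono\<close>)
      ultimately show ?thesis by (metis order_trans)
    qed
  qed
  show ?thesis
    by (rule exI[of _ C]) (use main C1(1) C2(1) in \<open>auto simp: C_def\<close>)
qed

end

context weighted_generators begin

text \<open>Weighted analogue of the number of infinite factors of a polycyclic series: a letter counts with
  its weight if no positive power of it lies in the subgroup generated by the later ones.\<close>

fun infinite_rank :: "('a \<times> real) list \<Rightarrow> real" where
  "infinite_rank [] = 0"
| "infinite_rank ((c, v) # qs) =
    (if \<exists>N\<ge>1::nat. c [^] N \<in> generate G (fst ` set qs) then 0 else v) + infinite_rank qs"

lemma infinite_rank_nonneg: "upper_list qs \<Longrightarrow> infinite_rank qs \<ge> 0"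
proof (induction qs rule: infinite_rank.induct)
  case (2 c v qs)
  have "v > 0" using upper_list_Cons(2)[OF 2(2)] letter_pos by (auto simp: alphabet_def)
  then show ?case using 2 upper_list_Cons(1)[OF 2(2)] by simp
qed simp

text \<open>If \<open>c [^] N\<close> is a word in the later letters, blocks of \<open>N\<close> copies of \<open>c\<close> can be replaced by this word.
  The later letters are at least as heavy as \<open>c\<close>, so that the replacement costs at most a constant
  times as much.\<close>

lemma reduce_dependent_head:
  assumes up: "upper_list ((c, v) # qs)" and K: "K \<ge> 0"
    and N: "N \<ge> (1::nat)" "c [^] N \<in> generate G (fst ` set qs)"
  shows "\<exists>C\<ge>0. \<forall>R\<ge>1. \<forall>g. cost_le (set ((c, v) # qs)) R K g \<longrightarrow>
    (\<exists>r<N. \<exists>h. g = h \<otimes> c [^] r \<and> cost_le (set qs) R C h)"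
proof -
  note up' = upper_list_Cons[OF up]
  have A: "set qs \<subseteq> alphabet" using up'(1) upper_list_alphabet by auto
  have cc: "c \<in> carrier G" using up'(2) alphabet_carrier by auto
  obtain C where C: "C \<ge> 0" and ext: "\<And>R g a. R \<ge> 1 \<Longrightarrow> word_cost (set ((c, v) # qs)) R g a \<Longrightarrow> a \<le> K \<Longrightarrow>
    (\<exists>(j::int) h. g = h \<otimes> c [^] j \<and> real_of_int \<bar>j\<bar> * R powr - v \<le> a \<and> cost_le (set qs) R (C * a) h)"
    using extract_head[OF up K] by blast
  obtain E where E: "E \<ge> 0" "\<And>R. R \<ge> 1 \<Longrightarrow> cost_le (set qs) R (E * R powr - v) (c [^] N)"
    using cost_le_generate[OF N(2) A, of v] up'(3) by blast
  have main: "\<exists>r<N. \<exists>h. g = h \<otimes> c [^] r \<and> cost_le (set qs) R (C * K + E * K) h"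
    if R: "R \<ge> 1" and g: "cost_le (set ((c, v) # qs)) R K g" for R g
  proof -
    obtain a where a: "a \<le> K" "word_cost (set ((c, v) # qs)) R g a"
      using g by (auto simp: cost_le_def)
    obtain j :: int and h where jh: "g = h \<otimes> c [^] j" "real_of_int \<bar>j\<bar> * R powr - v \<le> a" "cost_le (set qs) R (C * a) h"
      using ext[OF R a(2,1)] by blast
    have hc: "h \<in> carrier G" using cost_le_carrier[OF jh(3) A] .
    define q where "q = j div int N"
    define r where "r = nat (j mod int N)"
    have r: "r < N" using N(1) by (simp add: r_def nat_less_iff)
    have jqr: "j = int N * q + int r" using N(1) by (simp add: q_def r_def)
    have q: "\<bar>q\<bar> \<le> \<bar>j\<bar>"
    proof (cases "j \<ge> 0")
      case True
      then show ?thesis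
        using N(1) zdiv_mono2[of j 1 "int N"] by (simp add: q_def pos_imp_zdiv_nonneg_iff)
    next
      case False
      then have "q \<ge> j" using N(1) unfolding q_def
        by (smt (verit) div_by_1 zdiv_mono2_neg of_nat_1 of_nat_le_iff)
      moreover have "q \<le> 0" using False N(1) unfolding q_def
        by (smt (verit) pos_imp_zdiv_neg_iff of_nat_1 of_nat_le_iff)
      ultimately show ?thesis by simp
    qed
    have "c [^] j = (c [^] N) [^] q \<otimes> c [^] r"
      using cc by (simp add: jqr int_pow_mult int_pow_int flip: int_pow_pow)
    then have g': "g = (h \<otimes> (c [^] N) [^] q) \<otimes> c [^] r"
      using jh(1) hc cc by (simp add: m_assoc)
    have "cost_le (set qs) R (C * a + real_of_int \<bar>q\<bar> * (E * R powr - v)) (h \<otimes> (c [^] N) [^] q)"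
      by (rule cost_le_mult[OF jh(3) cost_le_int_pow[OF E(2)[OF R] A] A])
    moreover have "C * a \<le> C * K"
      using C a(1) by (rule mult_left_mono[rotated])
    moreover have "real_of_int \<bar>q\<bar> * (E * R powr - v) \<le> E * K"
    proof -
      have "real_of_int \<bar>q\<bar> * R powr - v \<le> real_of_int \<bar>j\<bar> * R powr - v"
        using q by (intro mult_right_mono) auto
      also have "\<dots> \<le> K" using jh(2) a(1) by simp
      finally show ?thesis using E(1) mult_left_mono[of "real_of_int \<bar>q\<bar> * R powr - v" K E]
        by (simp add: mult.left_commute mult.commute)
    qed
    ultimately have "cost_le (set qs) R (C * K + E * K) (h \<otimes> (c [^] N) [^] q)"
      by (elim cost_le_mono) linarith
    then show ?thesis using g' r by blast
  qed
  show ?thesis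
    by (rule exI[of _ "C * K + E * K"]) (use main C E(1) K in auto)
qed

text \<open>After collecting the first letter \<open>c\<close>, an element is determined by a word in the later letters and
  by an exponent of \<open>c\<close>. This exponent has boundedly many values if \<open>c\<close> has finite order modulo the
  later letters, and of the order of \<open>R powr v\<close> values in general.\<close>

lemma card_cost_ball:
  assumes "upper_list qs"
  shows "\<forall>K\<ge>0. \<exists>C\<ge>0. \<forall>R\<ge>1. finite {g. cost_le (set qs) R K g} \<and>
    real (card {g. cost_le (set qs) R K g}) \<le> C * R powr infinite_rank qs"
  using assms
proof (induction qs)
  case Nil
  have "{g. cost_le {} R K g} \<subseteq> {\<one>}" for R K
    by (auto simp: cost_le_def elim: word_cost.cases)
  then have "finite {g. cost_le {} R K g} \<and> card {g. cost_le {} R K g} \<le> 1" for R K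
    using card_mono[of "{\<one>}"] finite_subset by fastforce
  then show ?case by (auto intro!: exI[of _ 1])
next
  case (Cons p qs)
  obtain c v where p: "p = (c, v)" by fastforce
  note up = Cons.prems[unfolded p]
  note up' = upper_list_Cons[OF up]
  have A: "set qs \<subseteq> alphabet" using up'(1) upper_list_alphabet by auto
  let ?B = "\<lambda>R K. {g. cost_le (set (p # qs)) R K g}" and ?B' = "\<lambda>R K. {g. cost_le (set qs) R K g}"
  let ?D = "infinite_rank qs"
  show ?case
  proof (intro allI impI)
    fix K :: real assume K: "K \<ge> 0"
    show "\<exists>C\<ge>0. \<forall>R\<ge>1. finite (?B R K) \<and> real (card (?B R K)) \<le> C * R powr infinite_rank (p # qs)"
    proof (cases "\<exists>N\<ge>1::nat. c [^] N \<in> generate G (fst ` set qs)")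
      case True
      then obtain N :: nat where N: "N \<ge> 1" "c [^] N \<in> generate G (fst ` set qs)" by blast
      obtain K' where K': "K' \<ge> 0" and red: "\<And>R g. R \<ge> 1 \<Longrightarrow> cost_le (set ((c, v) # qs)) R K g \<Longrightarrow>
          (\<exists>r<N. \<exists>h. g = h \<otimes> c [^] r \<and> cost_le (set qs) R K' h)"
        using reduce_dependent_head[OF up K N] by blast
      obtain C where C: "C \<ge> 0" "\<And>R. R \<ge> 1 \<Longrightarrow> finite (?B' R K')"
          "\<And>R. R \<ge> 1 \<Longrightarrow> real (card (?B' R K')) \<le> C * R powr ?D"
        using Cons.IH[OF up'(1)] K' by blast
      have "finite (?B R K) \<and> real (card (?B R K)) \<le> real N * C * R powr ?D" if R: "R \<ge> 1" for R
      proof -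
        have sub: "?B R K \<subseteq> (\<lambda>(h, r). h \<otimes> c [^] r) ` (?B' R K' \<times> {..<N})"
          using red[OF R] p by fastforce
        have fin: "finite (?B' R K' \<times> {..<N})" using C(2)[OF R] by simp
        have "card (?B R K) \<le> card (?B' R K' \<times> {..<N})"
          by (rule surj_card_le[OF fin sub])
        then have "real (card (?B R K)) \<le> real (card (?B' R K')) * real N"
          by (simp add: card_cartesian_product flip: of_nat_mult)
        also have "\<dots> \<le> C * R powr ?D * real N"
          by (intro mult_right_mono C R) auto
        finally show ?thesis
          using finite_subset[OF sub] fin by (simp add: mult_ac)
      qed
      moreover have "infinite_rank (p # qs) = ?D" using True p by auto
      ultimately show ?thesis using C(1) by (intro exI[of _ "real N * C"]) auto
    next
      case False
      obtain C0 where C0: "C0 \<ge> 0" and ext: "\<And>R g a. R \<ge> 1 \<Longrightarrow> word_cost (set ((c, v) # qs)) R g a \<Longrightarrow> a \<le> K \<Longrightarrow>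
        (\<exists>(j::int) h. g = h \<otimes> c [^] j \<and> real_of_int \<bar>j\<bar> * R powr - v \<le> a \<and> cost_le (set qs) R (C0 * a) h)"
        using extract_head[OF up K] by blast
      have v: "v > 0" using up'(2) letter_pos by (auto simp: alphabet_def)
      define K' where "K' = C0 * K"
      have K': "K' \<ge> 0" using C0 K by (simp add: K'_def)
      obtain C where C: "C \<ge> 0" "\<And>R. R \<ge> 1 \<Longrightarrow> finite (?B' R K')"
          "\<And>R. R \<ge> 1 \<Longrightarrow> real (card (?B' R K')) \<le> C * R powr ?D"
        using Cons.IH[OF up'(1)] K' by blast
      have "finite (?B R K) \<and> real (card (?B R K)) \<le> ((2 * K + 1) * C) * R powr (v + ?D)" if R: "R \<ge> 1" for R
      proof -
        define M where "M = \<lfloor>K * R powr v\<rfloor>"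
        have M: "M \<ge> 0" using K by (simp add: M_def)
        have sub: "?B R K \<subseteq> (\<lambda>(h, j). h \<otimes> c [^] j) ` (?B' R K' \<times> {-M..M})"
        proof
          fix g assume "g \<in> ?B R K"
          then obtain a where a: "a \<le> K" "word_cost (set ((c, v) # qs)) R g a"
            using p by (auto simp: cost_le_def)
          obtain j :: int and h where jh: "g = h \<otimes> c [^] j" "real_of_int \<bar>j\<bar> * R powr - v \<le> a" "cost_le (set qs) R (C0 * a) h"
            using ext[OF R a(2,1)] by blast
          have "real_of_int \<bar>j\<bar> * R powr - v \<le> K" using jh a by simp
          then have "real_of_int \<bar>j\<bar> \<le> K * R powr v"
            using R by (simp add: powr_minus field_simps)
          then have "\<bar>j\<bar> \<le> M" by (simp add: M_def le_floor_iff)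
          moreover have "cost_le (set qs) R K' h"
            using jh(3) by (rule cost_le_mono) (use C0 a in \<open>auto simp: K'_def intro: mult_left_mono\<close>)
          ultimately show "g \<in> (\<lambda>(h, j). h \<otimes> c [^] j) ` (?B' R K' \<times> {-M..M})"
            using jh(1) by (intro image_eqI[of _ _ "(h, j)"]) auto
        qed
        have fin: "finite (?B' R K' \<times> {-M..M})" using C(2)[OF R] by simp
        have "card (?B R K) \<le> card (?B' R K' \<times> {-M..M})"
          by (rule surj_card_le[OF fin sub])
        then have "real (card (?B R K)) \<le> real (card (?B' R K')) * real_of_int (2 * M + 1)"
          using M of_nat_mono[of _ "card (?B' R K' \<times> {-M..M})", where 'a = real]
          by (simp add: card_cartesian_product)
        also have "real_of_int (2 * M + 1) \<le> 2 * (K * R powr v) + 1"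
          by (simp add: M_def)
        also have "2 * (K * R powr v) + 1 \<le> (2 * K + 1) * R powr v"
          using R v by (simp add: algebra_simps ge_one_powr_ge_zero)
        also have "real (card (?B' R K')) \<le> C * R powr ?D"
          by (intro C R)
        finally have "real (card (?B R K)) \<le> C * R powr ?D * ((2 * K + 1) * R powr v)"
          using K C(1) by (simp add: mult_left_mono mult_right_mono)
        also have "\<dots> = ((2 * K + 1) * C) * R powr (v + ?D)"
          by (simp add: powr_add)
        finally show ?thesis
          using finite_subset[OF sub] fin by simp
      qed
      moreover have "infinite_rank (p # qs) = v + ?D" using False p by auto
      ultimately show ?thesis using C(1) K by (intro exI[of _ "(2 * K + 1) * C"]) auto
    qed
  qed
qed

end

section \<open>Many elements of bounded length\<close>

text \<open>\<open>J\<close> collects the generators along which the walk makes long jumps. Each of the remaining generators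
  has a power in the subgroup generated by those in \<open>J\<close>, which are strictly heavier.\<close>

locale heavy_generators = weighted_generators +
  fixes J :: "nat set"
  assumes J_subset: "J \<subseteq> I"
    and light_power: "i \<in> I - J \<Longrightarrow> \<exists>N\<ge>1::nat. s i [^] N \<in> generate G (s ` J)"
    and light_weight: "i \<in> I - J \<Longrightarrow> j \<in> J \<Longrightarrow> w i < w j"
begin

text \<open>A length function up to the factor \<open>2\<close>, normalized at scale \<open>R\<close>. The factor admits squares of length
  functions. Long powers are controlled only along the generators in \<open>J\<close>.\<close>

definition adapted :: "real \<Rightarrow> ('a \<Rightarrow> real) \<Rightarrow> bool" where
  "adapted R \<rho> \<longleftrightarrow> \<rho> \<one> = 0 \<and> (\<forall>g\<in>carrier G. 0 \<le> \<rho> g \<and> \<rho> (inv g) = \<rho> g) \<and>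
     (\<forall>g\<in>carrier G. \<forall>h\<in>carrier G. \<rho> (g \<otimes> h) \<le> 2 * (\<rho> g + \<rho> h)) \<and>
     (\<forall>i\<in>I. \<rho> (s i) \<le> 1) \<and>
     (\<forall>i\<in>J. \<forall>m::int. \<bar>real_of_int m\<bar> \<le> R powr w i \<longrightarrow> \<rho> (s i [^] m) \<le> 1)"

lemma adapted_mult:
  "adapted R \<rho> \<Longrightarrow> g \<in> carrier G \<Longrightarrow> h \<in> carrier G \<Longrightarrow> \<rho> g \<le> A \<Longrightarrow> \<rho> h \<le> B \<Longrightarrow> \<rho> (g \<otimes> h) \<le> 2 * (A + B)"
  unfolding adapted_def by fastforce

lemma adapted_inv: "adapted R \<rho> \<Longrightarrow> g \<in> carrier G \<Longrightarrow> \<rho> (inv g) = \<rho> g"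
  unfolding adapted_def by blast

lemma adapted_bounded:
  assumes "g \<in> carrier G"
  shows "\<exists>C\<ge>0. \<forall>R \<rho>. adapted R \<rho> \<longrightarrow> \<rho> g \<le> C"
proof -
  have "g \<in> generate G (s ` I)" using assms generating by simp
  then show ?thesis
  proof (induction rule: generate.induct)
    case one
    show ?case by (rule exI[of _ 0]) (auto simp: adapted_def)
  next
    case (incl h)
    then show ?case by (intro exI[of _ 1]) (auto simp: adapted_def)
  next
    case (inv h)
    then have "\<rho> (inv h) \<le> 1" if "adapted R \<rho>" for R \<rho>
      using that s_carrier by (auto simp: adapted_def)
    then show ?case by (intro exI[of _ 1]) auto
  next
    case (eng h1 h2)
    then obtain C1 C2 where C: "C1 \<ge> 0" "C2 \<ge> 0" "\<forall>R \<rho>. adapted R \<rho> \<longrightarrow> \<rho> h1 \<le> C1" "\<forall>R \<rho>. adapted R \<rho> \<longrightarrow> \<rho> h2 \<le> C2"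
      by blast
    have "h1 \<in> carrier G" "h2 \<in> carrier G" using eng generating by auto
    then show ?case
      using C adapted_mult by (intro exI[of _ "2 * (C1 + C2)"]) auto
  qed
qed

text \<open>The powers of \<open>x\<close> up to \<open>n\<close> times the natural scale of its weight \<open>v\<close> are values, modulo larger weight,
  of elements whose length is bounded uniformly in \<open>R\<close> and \<open>\<rho>\<close>.\<close>

definition attainable :: "nat \<Rightarrow> 'a \<Rightarrow> real \<Rightarrow> bool" where
  "attainable n x v \<longleftrightarrow> (\<exists>C\<ge>0. \<forall>R\<ge>1. \<forall>\<rho>. adapted R \<rho> \<longrightarrow> (\<forall>m::int. \<bar>m\<bar> \<le> int n * \<lfloor>R powr v\<rfloor> \<longrightarrow>
     (\<exists>g\<in>carrier G. \<rho> g \<le> C \<and> weight_subgroup {v<..} #> g = weight_subgroup {v<..} #> x [^] m)))"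

lemma normal_above: "weight_subgroup {v<..} \<lhd> G"
  by (rule normal_weight_subgroup) auto

lemma coset_mult:
  assumes "N \<lhd> G" "a \<in> carrier G" "b \<in> carrier G" "c \<in> carrier G" "d \<in> carrier G"
    and "N #> a = N #> c" "N #> b = N #> d"
  shows "N #> (a \<otimes> b) = N #> (c \<otimes> d)"
  using normal.rcos_sum[OF assms(1)] assms by metis

lemma attainable_multiple:
  assumes "attainable 1 x v" and x: "x \<in> carrier G"
  shows "attainable n x v"
proof (induction n)
  case 0
  show ?case
    unfolding attainable_def
    by (rule exI[of _ 0]) (auto intro!: bexI[of _ \<one>] simp: adapted_def)
next
  case (Suc n)
  let ?W = "weight_subgroup {v<..}"
  obtain C1 where C1: "C1 \<ge> 0" "\<And>R \<rho> m::int. R \<ge> 1 \<Longrightarrow> adapted R \<rho> \<Longrightarrow> \<bar>m\<bar> \<le> \<lfloor>R powr v\<rfloor> \<Longrightarrow>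
     (\<exists>g\<in>carrier G. \<rho> g \<le> C1 \<and> ?W #> g = ?W #> x [^] m)"
    using assms(1) by (auto simp: attainable_def)
  obtain C2 where C2: "C2 \<ge> 0" "\<And>R \<rho> m::int. R \<ge> 1 \<Longrightarrow> adapted R \<rho> \<Longrightarrow> \<bar>m\<bar> \<le> int n * \<lfloor>R powr v\<rfloor> \<Longrightarrow>
     (\<exists>g\<in>carrier G. \<rho> g \<le> C2 \<and> ?W #> g = ?W #> x [^] m)"
    using Suc by (auto simp: attainable_def)
  have "\<exists>g\<in>carrier G. \<rho> g \<le> 2 * (C1 + C2) \<and> ?W #> g = ?W #> x [^] m"
    if R: "R \<ge> 1" "adapted R \<rho>" and m: "\<bar>m\<bar> \<le> int (Suc n) * \<lfloor>R powr v\<rfloor>" for R \<rho> m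
  proof -
    define B where "B = \<lfloor>R powr v\<rfloor>"
    have B: "B \<ge> 0" by (simp add: B_def)
    define m1 where "m1 = max (-B) (min B m)"
    have "\<bar>m\<bar> \<le> int n * B + B" using m by (simp add: B_def algebra_simps)
    moreover have "int n * B \<ge> 0" using B by simp
    ultimately have m1: "\<bar>m1\<bar> \<le> B" "\<bar>m - m1\<bar> \<le> int n * B"
      using B unfolding m1_def by linarith+
    obtain g1 where g1: "g1 \<in> carrier G" "\<rho> g1 \<le> C1" "?W #> g1 = ?W #> x [^] m1"
      using C1(2)[OF R] m1(1) by (auto simp: B_def)
    obtain g2 where g2: "g2 \<in> carrier G" "\<rho> g2 \<le> C2" "?W #> g2 = ?W #> x [^] (m - m1)"
      using C2(2)[OF R] m1(2) by (auto simp: B_def)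
    have "?W #> (g1 \<otimes> g2) = ?W #> (x [^] m1 \<otimes> x [^] (m - m1))"
      by (rule coset_mult[OF normal_above]) (use g1 g2 x in auto)
    also have "x [^] m1 \<otimes> x [^] (m - m1) = x [^] m"
      using x by (simp flip: int_pow_mult)
    finally show ?thesis
      using adapted_mult[OF R(2) g1(1) g2(1) g1(2) g2(2)] g1(1) g2(1) by blast
  qed
  then show ?case
    unfolding attainable_def using C1(1) C2(1) by (intro exI[of _ "2 * (C1 + C2)"]) auto
qed

text \<open>For a generator outside \<open>J\<close> some power lies in the subgroup generated by \<open>J\<close>, hence has larger
  weight. So modulo larger weight there are only finitely many powers to represent.\<close>

lemma attainable_generator:
  assumes i: "i \<in> I"
  shows "attainable 1 (s i) (w i)"
proof (cases "i \<in> J")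
  case True
  have "\<bar>real_of_int m\<bar> \<le> R powr w i" if "\<bar>m\<bar> \<le> \<lfloor>R powr w i\<rfloor>" for R m
    using that by (simp add: le_floor_iff)
  then show ?thesis
    unfolding attainable_def
    by (intro exI[of _ 1] conjI allI impI bexI[of _ "s i [^] _"])
       (use True i s_carrier in \<open>auto simp: adapted_def\<close>)
next
  case False
  let ?W = "weight_subgroup {w i<..}"
  have sc: "s i \<in> carrier G" using i s_carrier by auto
  obtain N :: nat where N: "N \<ge> 1" "s i [^] N \<in> generate G (s ` J)"
    using light_power False i by auto
  have "generate G (s ` J) \<subseteq> ?W"
    by (rule generate_subgroup_incl[OF _ subgroup_weight_subgroup])
       (use light_weight False i J_subset letter.gen letter_in_weight_subgroup in blast)
  then have NW: "s i [^] N \<in> ?W" using N by auto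
  have "\<forall>r. \<exists>C\<ge>0. \<forall>R \<rho>. adapted R \<rho> \<longrightarrow> \<rho> (s i [^] (r::nat)) \<le> C"
    using adapted_bounded sc by auto
  then obtain C where C: "\<And>r. C r \<ge> 0" "\<And>r R \<rho>. adapted R \<rho> \<Longrightarrow> \<rho> (s i [^] (r::nat)) \<le> C r"
    by metis
  have "\<exists>g\<in>carrier G. \<rho> g \<le> sum C {..<N} \<and> ?W #> g = ?W #> s i [^] m"
    if R: "adapted R \<rho>" for R \<rho> and m :: int
  proof -
    define r where "r = nat (m mod int N)"
    have r: "r < N" using N(1) by (simp add: r_def nat_less_iff)
    have m: "m = int r + int N * (m div int N)" using N(1) by (simp add: r_def)
    have "C r \<le> sum C {..<N}"
      by (rule member_le_sum) (use r C(1) in auto)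
    then have "\<rho> (s i [^] r) \<le> sum C {..<N}"
      using C(2)[OF R, of r] by simp
    moreover have "?W #> s i [^] r = ?W #> s i [^] m"
    proof (subst normal.coset_eq_iff_left[OF normal_above])
      have "inv (s i [^] r) \<otimes> s i [^] m = (s i [^] N) [^] (m div int N)"
        using sc by (subst m) (simp add: int_pow_mult int_pow_int flip: int_pow_pow)
      then show "inv (s i [^] r) \<otimes> s i [^] m \<in> ?W"
        using subgroup_int_pow_closed[OF subgroup_weight_subgroup NW] by simp
    qed (use sc in auto)
    ultimately show ?thesis using sc by blast
  qed
  then show ?thesis
    unfolding attainable_def using C(1) by (intro exI[of _ "sum C {..<N}"]) (auto intro: sum_nonneg)
qed

text \<open>Every integer up to \<open>R powr (u + v)\<close> is written as \<open>A * q + r\<close> with \<open>A\<close> and \<open>r\<close> of size \<open>R powr u\<close> and \<open>q\<close>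
  of size \<open>R powr v\<close>. By bilinearity the corresponding power of the commutator is then the product
  of two commutators of short elements.\<close>

lemma attainable_commutator:
  assumes x: "letter hx x u" "attainable 1 x u" and y: "letter hy y v" "attainable 1 y v"
  shows "attainable 1 (commutator G x y) (u + v)"
proof -
  let ?W = "\<lambda>t. weight_subgroup {t<..}" and ?z = "commutator G x y"
  have xc: "x \<in> carrier G" "y \<in> carrier G" using x y letter_carrier by auto
  have uv: "u > 0" "v > 0" using x y letter_pos by auto
  obtain C1 where C1: "C1 \<ge> 0" "\<And>R \<rho> m::int. R \<ge> 1 \<Longrightarrow> adapted R \<rho> \<Longrightarrow> \<bar>m\<bar> \<le> \<lfloor>R powr u\<rfloor> \<Longrightarrow>
     (\<exists>g\<in>carrier G. \<rho> g \<le> C1 \<and> ?W u #> g = ?W u #> x [^] m)"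
    using x(2) by (auto simp: attainable_def)
  obtain C2 where C2: "C2 \<ge> 0" "\<And>R \<rho> m::int. R \<ge> 1 \<Longrightarrow> adapted R \<rho> \<Longrightarrow> \<bar>m\<bar> \<le> 4 * \<lfloor>R powr v\<rfloor> \<Longrightarrow>
     (\<exists>g\<in>carrier G. \<rho> g \<le> C2 \<and> ?W v #> g = ?W v #> y [^] m)"
    using attainable_multiple[OF y(2) xc(2), of 4] by (auto simp: attainable_def)
  define C where "C = 2 * (2 * (2 * (C1 + C2) + C1) + C2)"
  have comm_bound: "\<rho> (commutator G g h) \<le> C"
    if a: "adapted R \<rho>" and g: "g \<in> carrier G" "\<rho> g \<le> C1" and h: "h \<in> carrier G" "\<rho> h \<le> C2" for R \<rho> g h
    unfolding commutator_def C_def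
    by (intro adapted_mult[OF a]) (use g h adapted_inv[OF a] in auto)
  have "\<exists>g\<in>carrier G. \<rho> g \<le> 2 * (C + C) \<and> ?W (u + v) #> g = ?W (u + v) #> ?z [^] m"
    if R: "R \<ge> 1" "adapted R \<rho>" and m: "\<bar>m\<bar> \<le> \<lfloor>R powr (u + v)\<rfloor>" for R \<rho> m
  proof -
    define A where "A = \<lfloor>R powr u\<rfloor>"
    define B where "B = \<lfloor>R powr v\<rfloor>"
    have A: "A \<ge> 1" and B: "B \<ge> 1"
      using R uv by (auto simp: A_def B_def le_floor_iff ge_one_powr_ge_zero)
    \<comment> \<open>The factor \<open>4\<close> makes up for the two roundings in \<open>A\<close> and \<open>B\<close>.\<close>
    have "real_of_int \<bar>m\<bar> \<le> R powr u * R powr v"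
      using m by (simp add: le_floor_iff powr_add)
    also have "\<dots> \<le> (2 * real_of_int A) * (2 * real_of_int B)"
    proof (intro mult_mono)
      show "R powr u \<le> 2 * real_of_int A" "R powr v \<le> 2 * real_of_int B"
        using A B unfolding A_def B_def by linarith+
    qed (use A in auto)
    finally have "real_of_int \<bar>m\<bar> \<le> real_of_int (4 * B * A)" by (simp add: mult_ac)
    then have mAB: "\<bar>m\<bar> \<le> 4 * B * A" by linarith
    define q where "q = m div A"
    define r where "r = m mod A"
    have r: "\<bar>r\<bar> \<le> A" using A pos_mod_bound[of A m] pos_mod_sign[of A m] unfolding r_def by linarith
    have mqr: "m = A * q + r * 1" by (simp add: q_def r_def)
    have q: "\<bar>q\<bar> \<le> 4 * B"
    proof -
      have "m div A \<le> (4 * B * A) div A" by (rule zdiv_mono1) (use mAB A in auto)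
      moreover have "(- (4 * B) * A) div A \<le> m div A" by (rule zdiv_mono1) (use mAB A in auto)
      moreover have "(- (4 * B) * A) div A = - (4 * B)" "(4 * B * A) div A = 4 * B"
        using A by (intro nonzero_mult_div_cancel_right; simp)+
      ultimately show ?thesis by (simp add: q_def)
    qed
    obtain g1 where g1: "g1 \<in> carrier G" "\<rho> g1 \<le> C1" "?W u #> g1 = ?W u #> x [^] A"
      using C1(2)[OF R, of A] A by (auto simp: A_def)
    obtain h1 where h1: "h1 \<in> carrier G" "\<rho> h1 \<le> C2" "?W v #> h1 = ?W v #> y [^] q"
      using C2(2)[OF R, of q] q by (auto simp: B_def)
    obtain g2 where g2: "g2 \<in> carrier G" "\<rho> g2 \<le> C1" "?W u #> g2 = ?W u #> x [^] r"
      using C1(2)[OF R, of r] r by (auto simp: A_def)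
    obtain h2 where h2: "h2 \<in> carrier G" "\<rho> h2 \<le> C2" "?W v #> h2 = ?W v #> y [^] (1::int)"
    proof -
      have "\<bar>1::int\<bar> \<le> 4 * \<lfloor>R powr v\<rfloor>" using B unfolding B_def by linarith
      then show ?thesis using C2(2)[OF R] that by blast
    qed
    have "?W (u + v) #> (commutator G g1 h1 \<otimes> commutator G g2 h2) = ?W (u + v) #> (?z [^] (A * q) \<otimes> ?z [^] (r * 1))"
      by (rule coset_mult[OF normal_above _ _ _ _ commutator_bilinear[OF x(1) y(1) g1(1,3) h1(1,3)]
            commutator_bilinear[OF x(1) y(1) g2(1,3) h2(1,3)]]) (use xc g1 h1 g2 h2 in auto)
    also have "?z [^] (A * q) \<otimes> ?z [^] (r * 1) = ?z [^] m"
      using xc by (subst mqr) (simp add: int_pow_mult)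
    finally show ?thesis
      using adapted_mult[OF R(2) _ _ comm_bound[OF R(2) g1(1,2) h1(1,2)] comm_bound[OF R(2) g2(1,2) h2(1,2)]]
        g1(1) g2(1) h1(1) h2(1) by blast
  qed
  then show ?thesis
    unfolding attainable_def using C1(1) C2(1) by (intro exI[of _ "2 * (C + C)"]) (auto simp: C_def)
qed

lemma attainable_letter: "letter h x v \<Longrightarrow> attainable 1 x v"
proof (induction rule: letter.induct)
  case (gen_inv i)
  have sc: "s i \<in> carrier G" using gen_inv s_carrier by auto
  have "inv (s i) [^] m = s i [^] (- m)" for m :: int
    using sc by (simp add: int_pow_inv int_pow_neg)
  then show ?case
    using attainable_generator[OF gen_inv] by (auto simp: attainable_def)
next
  case (gen i)
  then show ?case by (rule attainable_generator)
next
  case (comm m x u n y v)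
  then show ?case using attainable_commutator by blast
qed

text \<open>If the first letter \<open>c\<close> has infinite order modulo the later ones, its powers up to \<open>R powr v\<close> are
  attained by short elements modulo larger weight and lie in distinct cosets of the subgroup
  generated by the later letters. Multiplying the set found for the later letters by these
  elements enlarges it by the factor \<open>R powr v\<close>.\<close>

lemma exists_many_elements:
  assumes "upper_list qs"
  shows "\<exists>C\<ge>0. \<forall>R\<ge>1. \<forall>\<rho>. adapted R \<rho> \<longrightarrow> (\<exists>F\<subseteq>generate G (fst ` set qs). finite F \<and>
    R powr infinite_rank qs \<le> real (card F) \<and> (\<forall>g\<in>F. \<rho> g \<le> C))"
  using assms
proof (induction qs)
  case Nil
  show ?case
    by (intro exI[of _ 0]) (auto intro!: exI[of _ "{\<one>}"] simp: adapted_def generate.one)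
next
  case (Cons p qs)
  obtain c v where p: "p = (c, v)" by fastforce
  note up = Cons.prems[unfolded p]
  note up' = upper_list_Cons[OF up]
  have A: "set qs \<subseteq> alphabet" using up'(1) upper_list_alphabet by auto
  let ?L = "generate G (fst ` set qs)" and ?L' = "generate G (fst ` set (p # qs))"
  have cc: "c \<in> carrier G" using up'(2) alphabet_carrier by auto
  have Lsub: "subgroup ?L G"
    by (rule generate_is_subgroup) (use A alphabet_carrier in force)
  have L'sub: "subgroup ?L' G"
    by (rule generate_is_subgroup) (use A alphabet_carrier up'(2) p in force)
  have LL': "?L \<subseteq> ?L'" by (rule mono_generate) auto
  obtain C where C: "C \<ge> 0" and IH: "\<And>R \<rho>. R \<ge> 1 \<Longrightarrow> adapted R \<rho> \<Longrightarrow> (\<exists>F\<subseteq>?L. finite F \<and>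
    R powr infinite_rank qs \<le> real (card F) \<and> (\<forall>g\<in>F. \<rho> g \<le> C))"
    using Cons.IH[OF up'(1)] by blast
  show ?case
  proof (cases "\<exists>N\<ge>1::nat. c [^] N \<in> ?L")
    case True
    then have "infinite_rank (p # qs) = infinite_rank qs" using p by auto
    moreover have "\<exists>F\<subseteq>?L'. finite F \<and> R powr infinite_rank qs \<le> real (card F) \<and> (\<forall>g\<in>F. \<rho> g \<le> C)"
      if R: "R \<ge> 1" "adapted R \<rho>" for R \<rho>
    proof -
      obtain F where "F \<subseteq> ?L" "finite F \<and> R powr infinite_rank qs \<le> real (card F) \<and> (\<forall>g\<in>F. \<rho> g \<le> C)"
        using IH[OF R] by blast
      then show ?thesis using LL' by (intro exI[of _ F]) auto
    qed
    ultimately show ?thesis using C by (intro exI[of _ C]) auto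
  next
    case False
    then have rank: "infinite_rank (p # qs) = v + infinite_rank qs" using p by auto
    let ?W = "weight_subgroup {v<..}"
    obtain h where c: "letter h c v" using up'(2) by (auto simp: alphabet_def)
    obtain C1 where C1: "C1 \<ge> 0" "\<And>R \<rho> m::int. R \<ge> 1 \<Longrightarrow> adapted R \<rho> \<Longrightarrow> \<bar>m\<bar> \<le> \<lfloor>R powr v\<rfloor> \<Longrightarrow>
       (\<exists>g\<in>carrier G. \<rho> g \<le> C1 \<and> ?W #> g = ?W #> c [^] m)"
      using attainable_letter[OF c] by (auto simp: attainable_def)
    have WL: "?W \<subseteq> ?L"
      unfolding weight_subgroup_def
    proof (rule generate_subgroup_incl[OF _ Lsub], rule subsetI)
      fix x assume "x \<in> {x. \<exists>h t. letter h x t \<and> t \<in> {v<..}}"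
      then obtain l t where x: "letter l x t" "v < t" by auto
      show "x \<in> ?L"
      proof (cases "x = \<one>")
        case False
        then have "(x, t) \<in> set qs" using up'(4) x by (auto simp: alphabet_def)
        then show ?thesis by (intro generate.incl) force
      qed (simp add: generate.one)
    qed
    have "\<exists>F\<subseteq>?L'. finite F \<and> R powr infinite_rank (p # qs) \<le> real (card F) \<and> (\<forall>g\<in>F. \<rho> g \<le> 2 * (C1 + C))"
      if R: "R \<ge> 1" and ad: "adapted R \<rho>" for R \<rho>
    proof -
      define M where "M = \<lfloor>R powr v\<rfloor>"
      have M: "M \<ge> 0" by (simp add: M_def)
      have "\<exists>g. g \<in> carrier G \<and> \<rho> g \<le> C1 \<and> ?W #> g = ?W #> c [^] m" if "m \<in> {0..M}" for m :: int
      proof -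
        have "\<bar>m\<bar> \<le> \<lfloor>R powr v\<rfloor>" using that unfolding M_def atLeastAtMost_iff by linarith
        then show ?thesis using C1(2)[OF R ad] by blast
      qed
      then obtain \<gamma> where \<gamma>: "\<And>m. m \<in> {0..M} \<Longrightarrow> \<gamma> m \<in> carrier G" "\<And>m. m \<in> {0..M} \<Longrightarrow> \<rho> (\<gamma> m) \<le> C1"
          "\<And>m. m \<in> {0..M} \<Longrightarrow> ?W #> \<gamma> m = ?W #> c [^] m"
        by metis
      obtain F where F: "F \<subseteq> ?L" "finite F" "R powr infinite_rank qs \<le> real (card F)" "\<And>g. g \<in> F \<Longrightarrow> \<rho> g \<le> C"
        using IH[OF R ad] by blast
      have Fc: "F \<subseteq> carrier G" using F(1) subgroup.subset[OF Lsub] by blast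
      have \<gamma>t: "inv (c [^] m) \<otimes> \<gamma> m \<in> ?L" if "m \<in> {0..M}" for m
      proof -
        have "inv (c [^] m) \<otimes> \<gamma> m \<in> ?W"
          by (rule normal.coset_eq_iff_left[OF normal_above, THEN iffD1])
             (rule int_pow_closed[OF cc] \<gamma>(1)[OF that] \<gamma>(3)[OF that, symmetric])+
        then show ?thesis using WL by blast
      qed
      let ?f = "\<lambda>(m, g). \<gamma> m \<otimes> g"
      have inj: "inj_on ?f ({0..M} \<times> F)"
      proof (rule inj_onI, clarify)
        fix m g m' g' assume mg: "m \<in> {0..M}" "g \<in> F" "m' \<in> {0..M}" "g' \<in> F" and eq: "\<gamma> m \<otimes> g = \<gamma> m' \<otimes> g'"
        have gc: "g \<in> carrier G" "g' \<in> carrier G" "\<gamma> m \<in> carrier G" "\<gamma> m' \<in> carrier G"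
          using mg Fc \<gamma>(1) by auto
        define t where "t = inv (c [^] m) \<otimes> \<gamma> m"
        define t' where "t' = inv (c [^] m') \<otimes> \<gamma> m'"
        have t: "t \<in> ?L" "t' \<in> ?L" using \<gamma>t mg by (auto simp: t_def t'_def)
        have tc: "t \<in> carrier G" "t' \<in> carrier G" using gc cc by (auto simp: t_def t'_def)
        have gt: "\<gamma> m = c [^] m \<otimes> t" "\<gamma> m' = c [^] m' \<otimes> t'"
          using gc cc by (auto simp: t_def t'_def)
        have gL: "g \<in> ?L" "g' \<in> ?L" using mg F(1) by auto
        have "c [^] m \<otimes> (t \<otimes> g) = c [^] m' \<otimes> (t' \<otimes> g')"
          using eq gt gc tc cc by (simp add: m_assoc)
        then have "inv (c [^] m') \<otimes> (c [^] m \<otimes> (t \<otimes> g)) \<otimes> inv (t \<otimes> g) = t' \<otimes> g' \<otimes> inv (t \<otimes> g)"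
          using gc tc cc by simp
        moreover have "inv (c [^] m') \<otimes> (c [^] m \<otimes> (t \<otimes> g)) \<otimes> inv (t \<otimes> g) = c [^] (- m' + m)"
        proof -
          have "c [^] (- m' + m) = inv (c [^] m') \<otimes> c [^] m"
            using cc by (simp only: int_pow_mult int_pow_neg)
          then show ?thesis using gc tc cc by (simp only: m_assoc) (simp add: m_assoc)
        qed
        ultimately have mem: "c [^] (- m' + m) \<in> ?L"
          using gL t subgroup.m_closed[OF Lsub] subgroup.m_inv_closed[OF Lsub] by simp
        then have mem': "c [^] (- (- m' + m)) \<in> ?L"
          using subgroup.m_inv_closed[OF Lsub] int_pow_neg[OF cc] by metis
        have "c [^] nat \<bar>- m' + m\<bar> \<in> ?L"
          using mem mem' by (auto simp: abs_if simp flip: int_pow_int)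
        then have "\<not> nat \<bar>- m' + m\<bar> \<ge> 1"
          using False by blast
        then have "m = m'" by linarith
        then show "m = m' \<and> g = g'" using eq gc by simp
      qed
      have "R powr v \<le> real_of_int M + 1" unfolding M_def by linarith
      then have "R powr v * R powr infinite_rank qs \<le> (real_of_int M + 1) * real (card F)"
        by (intro mult_mono F(3)) (use M in auto)
      also have "\<dots> = real (card (?f ` ({0..M} \<times> F)))"
        using M by (simp add: card_image[OF inj] card_cartesian_product)
      finally have "R powr infinite_rank (p # qs) \<le> real (card (?f ` ({0..M} \<times> F)))"
        by (simp add: rank powr_add)
      moreover have "?f ` ({0..M} \<times> F) \<subseteq> ?L'"
      proof clarify
        fix m g assume mg: "m \<in> {0..M}" "g \<in> F"
        have "c \<in> ?L'" using p by (intro generate.incl) auto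
        then have "c [^] m \<in> ?L'" using subgroup_int_pow_closed[OF L'sub] by blast
        then have "c [^] m \<otimes> (inv (c [^] m) \<otimes> \<gamma> m) \<in> ?L'"
          using \<gamma>t[OF mg(1)] LL' subgroup.m_closed[OF L'sub] by blast
        then have "\<gamma> m \<in> ?L'" using cc \<gamma>(1)[OF mg(1)] by simp
        then show "\<gamma> m \<otimes> g \<in> ?L'"
          using mg(2) F(1) LL' subgroup.m_closed[OF L'sub] by blast
      qed
      moreover have "\<rho> x \<le> 2 * (C1 + C)" if im: "x \<in> ?f ` ({0..M} \<times> F)" for x
      proof -
        obtain m g where x: "x = \<gamma> m \<otimes> g" "m \<in> {0..M}" "g \<in> F"
          using im by auto
        then show ?thesis
          using adapted_mult[OF ad \<gamma>(1)[OF x(2)] _ \<gamma>(2)[OF x(2)] F(4)[OF x(3)]] Fc by auto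
      qed
      ultimately show ?thesis
        using F(2) by (intro exI[of _ "?f ` ({0..M} \<times> F)"] conjI ballI finite_imageI finite_cartesian_product) auto
    qed
    then show ?thesis
      using C C1(1) by (intro exI[of _ "2 * (C1 + C)"]) auto
  qed
qed

text \<open>The two counts in the form in which the walk uses them.\<close>

definition growth_le :: "real \<Rightarrow> bool" where
  "growth_le D \<longleftrightarrow> (\<forall>K\<ge>0. \<exists>C\<ge>0. \<forall>R\<ge>1. finite {g. cost_le alphabet R K g} \<and>
     real (card {g. cost_le alphabet R K g}) \<le> C * R powr D)"

definition growth_ge :: "real \<Rightarrow> bool" where
  "growth_ge D \<longleftrightarrow> (\<exists>C\<ge>0. \<forall>R\<ge>1. \<forall>\<rho>. adapted R \<rho> \<longrightarrow>
     (\<exists>F\<subseteq>carrier G. finite F \<and> R powr D \<le> real (card F) \<and> (\<forall>g\<in>F. \<rho> g \<le> C)))"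

lemma polynomial_growth: "\<exists>D\<ge>0. growth_le D \<and> growth_ge D"
proof -
  obtain xs where xs: "set xs = alphabet" using finite_list[OF finite_alphabet] by blast
  define ps where "ps = sort_key snd xs"
  have ps: "set ps = alphabet" "upper_list ps"
    using xs by (auto simp: ps_def upper_list_def)
  have "generate G (fst ` set ps) \<subseteq> carrier G"
    by (rule generate_incl) (use ps alphabet_carrier in force)
  then have "growth_ge (infinite_rank ps)"
    using exists_many_elements[OF ps(2)] unfolding growth_ge_def by (meson order_trans)
  moreover have "growth_le (infinite_rank ps)"
    using card_cost_ball[OF ps(2)] ps(1) by (simp add: growth_le_def)
  ultimately show ?thesis
    using infinite_rank_nonneg[OF ps(2)] by blast
qed

end

section \<open>Symmetric random walks\<close>

lemma has_sum_indicator: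
  fixes f :: "'a \<Rightarrow> real"
  assumes "a \<in> A"
  shows "((\<lambda>x. f x * of_bool (x = a)) has_sum f a) A"
proof -
  have "((\<lambda>x. f x * of_bool (x = a)) has_sum f a) {a}"
    by (rule has_sum_finiteI) auto
  then show ?thesis
    by (rule has_sum_cong_neutral[THEN iffD1, rotated -1]) (use assms in auto)
qed

lemma has_sum_real_diff:
  fixes f g :: "'a \<Rightarrow> real"
  assumes "(f has_sum a) A" "(g has_sum b) A"
  shows "((\<lambda>x. f x - g x) has_sum (a - b)) A"
  using has_sum_add[OF assms(1) has_sum_cmult_right[OF assms(2), of "-1"]] by simp

lemma has_sum_ge_term:
  fixes f :: "'a \<Rightarrow> real"
  assumes "(f has_sum S) A" "a \<in> A" "\<And>x. x \<in> A \<Longrightarrow> f x \<ge> 0"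
  shows "f a \<le> S"
proof -
  have "sum f {a} \<le> infsum f A"
    by (rule finite_sum_le_infsum) (use assms in \<open>auto simp: summable_on_def\<close>)
  then show ?thesis using assms(1) infsumI by fastforce
qed

lemma (in group) has_sum_translate:
  assumes "g \<in> carrier G"
  shows "((\<lambda>x. f (g \<otimes> x)) has_sum S) (carrier G) \<longleftrightarrow> (f has_sum S) (carrier G)"
  by (rule has_sum_reindex_bij_witness[of _ "\<lambda>x. inv g \<otimes> x" "\<lambda>x. g \<otimes> x"]) (use assms in auto)

definition density :: "('a, 'b) monoid_scheme \<Rightarrow> ('a \<Rightarrow> real) \<Rightarrow> bool" where
  "density G f \<longleftrightarrow> (\<forall>x. f x \<ge> 0) \<and> (f has_sum 1) (carrier G)"

context group begin

lemma density_le_1: "density G f \<Longrightarrow> x \<in> carrier G \<Longrightarrow> f x \<le> 1"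
  unfolding density_def using has_sum_ge_term by metis

lemma convolution_has_sum:
  assumes "density G f" "density G h" "x \<in> carrier G"
  shows "((\<lambda>y. f y * h (inv y \<otimes> x)) has_sum convolution G f h x) (carrier G)"
  unfolding convolution_def
  by (rule has_sum_infsum) (use convolution_has_sum_1(2)[OF is_group, of f h x] assms in \<open>auto simp: density_def\<close>)

text \<open>Both sides sum \<open>f y * g (inv y \<otimes> z) * h (inv z \<otimes> x)\<close> over all \<open>y\<close> and \<open>z\<close>, in a different order. The
  double sum converges because \<open>h\<close> is bounded by \<open>1\<close>.\<close>

lemma convolution_assoc:
  assumes f: "density G f" and g: "density G g" and h: "density G h" and x: "x \<in> carrier G"
  shows "convolution G f (convolution G g h) x = convolution G (convolution G f g) h x"
proof -
  let ?C = "carrier G"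
  let ?F = "\<lambda>(y, z). f y * g (inv y \<otimes> z) * h (inv z \<otimes> x)"
  have nn: "f a \<ge> 0" "g a \<ge> 0" "h a \<ge> 0" for a using f g h by (auto simp: density_def)
  have "(\<lambda>(y, z). f y * g (inv y \<otimes> z)) summable_on ?C \<times> ?C"
  proof (rule summable_on_SigmaI)
    fix y assume y: "y \<in> ?C"
    have "((\<lambda>z. g (inv y \<otimes> z)) has_sum 1) ?C"
      using has_sum_translate[of "inv y" g 1] g y by (simp add: density_def)
    from has_sum_cmult_right[OF this, of "f y"]
    show "((\<lambda>z. case (y, z) of (y, z) \<Rightarrow> f y * g (inv y \<otimes> z)) has_sum f y) ?C" by simp
  qed (use f nn in \<open>auto simp: density_def summable_on_def\<close>)
  then have sF: "?F summable_on ?C \<times> ?C"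
  proof (rule summable_on_comparison_test)
    fix p assume "p \<in> ?C \<times> ?C"
    then obtain y z where p: "p = (y, z)" "y \<in> ?C" "z \<in> ?C" by auto
    have "f y * g (inv y \<otimes> z) * h (inv z \<otimes> x) \<le> f y * g (inv y \<otimes> z) * 1"
      by (intro mult_left_mono density_le_1[OF h] mult_nonneg_nonneg nn) (use p x in auto)
    then show "?F p \<le> (case p of (y, z) \<Rightarrow> f y * g (inv y \<otimes> z))" using p by simp
  qed (use nn in auto)
  then obtain T where tot: "(?F has_sum T) (?C \<times> ?C)" by (auto simp: summable_on_def)
  have "((\<lambda>z. ?F (y, z)) has_sum f y * convolution G g h (inv y \<otimes> x)) ?C" if y: "y \<in> ?C" for y
  proof -
    have "((\<lambda>u. g u * h (inv u \<otimes> (inv y \<otimes> x))) has_sum convolution G g h (inv y \<otimes> x)) ?C"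
      by (rule convolution_has_sum[OF g h]) (use x y in auto)
    then have "((\<lambda>z. g (inv y \<otimes> z) * h (inv (inv y \<otimes> z) \<otimes> (inv y \<otimes> x))) has_sum convolution G g h (inv y \<otimes> x)) ?C"
      using has_sum_translate[of "inv y" "\<lambda>u. g u * h (inv u \<otimes> (inv y \<otimes> x))"] y by simp
    then have "((\<lambda>z. g (inv y \<otimes> z) * h (inv z \<otimes> x)) has_sum convolution G g h (inv y \<otimes> x)) ?C"
      by (rule has_sum_cong[THEN iffD1, rotated]) (use x y in \<open>simp add: inv_mult_group m_assoc\<close>)
    from has_sum_cmult_right[OF this, of "f y"] show ?thesis by (simp add: mult.assoc)
  qed
  from has_sum_SigmaD[OF tot this]
  have 1: "((\<lambda>y. f y * convolution G g h (inv y \<otimes> x)) has_sum T) ?C" .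
  have tot': "((\<lambda>(z, y). ?F (y, z)) has_sum T) (?C \<times> ?C)"
    using tot by (subst (asm) has_sum_swap) simp
  have "((\<lambda>y. case (z, y) of (z, y) \<Rightarrow> ?F (y, z)) has_sum convolution G f g z * h (inv z \<otimes> x)) ?C" if z: "z \<in> ?C" for z
    using has_sum_cmult_left[OF convolution_has_sum[OF f g z], of "h (inv z \<otimes> x)"] by simp
  from has_sum_SigmaD[OF tot' this]
  have 2: "((\<lambda>z. convolution G f g z * h (inv z \<otimes> x)) has_sum T) ?C" .
  show ?thesis
    using infsumI[OF 1] infsumI[OF 2] by (simp add: convolution_def)
qed

end

locale symmetric_walk = group G for G (structure) +
  fixes \<mu> :: "'a \<Rightarrow> real"
  assumes density_mu: "density G \<mu>"
    and mu_inv: "x \<in> carrier G \<Longrightarrow> \<mu> (inv x) = \<mu> x"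
    and mu_one: "\<mu> \<one> > 0"
begin

declare convolution_power.simps(2) [simp del]

abbreviation p :: "nat \<Rightarrow> 'a \<Rightarrow> real" where "p \<equiv> convolution_power G \<mu>"

lemma p_nonneg: "p n x \<ge> 0"
  by (rule convolution_power_nonneg) (use density_mu in \<open>auto simp: density_def\<close>)

lemma density_p: "density G (p n)"
  using convolution_power_has_sum_1[OF is_group, of \<mu> n] density_mu p_nonneg
  by (auto simp: density_def)

lemma p_add: "x \<in> carrier G \<Longrightarrow> p (m + n) x = convolution G (p m) (p n) x"
proof (induction n arbitrary: x)
  case 0
  have "((\<lambda>y. p m y * of_bool (y = x)) has_sum p m x) (carrier G)"
    by (rule has_sum_indicator) fact
  then have "((\<lambda>y. p m y * p 0 (inv y \<otimes> x)) has_sum p m x) (carrier G)"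
    by (rule has_sum_cong[THEN iffD1, rotated]) (use 0 inv_mult_eq_one_iff in auto)
  then show ?case
    by (simp add: convolution_def infsumI)
next
  case (Suc n)
  have "p (m + Suc n) x = convolution G (p (m + n)) \<mu> x"
    by (simp add: convolution_power.simps(2))
  also have "\<dots> = convolution G (convolution G (p m) (p n)) \<mu> x"
    unfolding convolution_def[of G _ \<mu>] using Suc by (intro infsum_cong) simp
  also have "\<dots> = convolution G (p m) (p (Suc n)) x"
    using convolution_assoc[OF density_p density_p density_mu Suc.prems] by (simp add: convolution_power.simps(2))
  finally show ?case .
qed

lemma p_1: "x \<in> carrier G \<Longrightarrow> p 1 x = \<mu> x"
proof -
  assume x: "x \<in> carrier G"
  have "((\<lambda>y. \<mu> (inv y \<otimes> x) * of_bool (y = \<one>)) has_sum \<mu> (inv \<one> \<otimes> x)) (carrier G)"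
    by (rule has_sum_indicator) auto
  then show ?thesis
    using x by (simp add: convolution_power.simps(2) convolution_def infsumI mult.commute)
qed

lemma p_has_sum:
  assumes "x \<in> carrier G"
  shows "((\<lambda>y. p m y * p n (inv y \<otimes> x)) has_sum p (m + n) x) (carrier G)"
  using convolution_has_sum[OF density_p density_p assms] by (simp add: p_add[OF assms])

lemma p_inv: "x \<in> carrier G \<Longrightarrow> p n (inv x) = p n x"
proof (induction n arbitrary: x)
  case 0
  then show ?case by auto
next
  case (Suc n)
  have "((\<lambda>z. p 1 z * p n (inv z \<otimes> x)) has_sum p (1 + n) x) (carrier G)"
    by (rule p_has_sum) fact
  then have "((\<lambda>y. p 1 (x \<otimes> y) * p n (inv (x \<otimes> y) \<otimes> x)) has_sum p (1 + n) x) (carrier G)"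
    using has_sum_translate[OF Suc.prems, of "\<lambda>z. p 1 z * p n (inv z \<otimes> x)"] by simp
  then have "((\<lambda>y. p n y * p 1 (inv y \<otimes> inv x)) has_sum p (1 + n) x) (carrier G)"
  proof (rule has_sum_cong[THEN iffD1, rotated])
    fix y assume y: "y \<in> carrier G"
    have "inv (x \<otimes> y) \<otimes> x = inv y" using Suc.prems y by (simp add: inv_mult_group m_assoc)
    moreover have "\<mu> (x \<otimes> y) = \<mu> (inv y \<otimes> inv x)"
      using mu_inv[of "x \<otimes> y"] Suc.prems y by (simp add: inv_mult_group)
    ultimately show "p 1 (x \<otimes> y) * p n (inv (x \<otimes> y) \<otimes> x) = p n y * p 1 (inv y \<otimes> inv x)"
      using Suc y p_1[of "x \<otimes> y"] p_1[of "inv y \<otimes> inv x"] by simp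
  qed
  moreover have "((\<lambda>y. p n y * p 1 (inv y \<otimes> inv x)) has_sum p (n + 1) (inv x)) (carrier G)"
    by (rule p_has_sum) (use Suc in simp)
  ultimately have "p (1 + n) x = p (n + 1) (inv x)"
    by (rule has_sum_unique)
  then show ?case by simp
qed

lemma p_inner:
  assumes "x \<in> carrier G" "y \<in> carrier G"
  shows "((\<lambda>z. p m (inv x \<otimes> z) * p n (inv y \<otimes> z)) has_sum p (m + n) (inv x \<otimes> y)) (carrier G)"
proof -
  have "((\<lambda>u. p m u * p n (inv u \<otimes> (inv x \<otimes> y))) has_sum p (m + n) (inv x \<otimes> y)) (carrier G)"
    by (rule p_has_sum) (use assms in auto)
  then have "((\<lambda>z. p m (inv x \<otimes> z) * p n (inv (inv x \<otimes> z) \<otimes> (inv x \<otimes> y))) has_sum p (m + n) (inv x \<otimes> y)) (carrier G)"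
    using has_sum_translate[of "inv x" "\<lambda>u. p m u * p n (inv u \<otimes> (inv x \<otimes> y))"] assms by simp
  then show ?thesis
  proof (rule has_sum_cong[THEN iffD1, rotated])
    fix z assume z: "z \<in> carrier G"
    have "inv (inv x \<otimes> z) \<otimes> (inv x \<otimes> y) = inv (inv y \<otimes> z)"
      using assms z by (simp add: inv_mult_group m_assoc)
    then show "p m (inv x \<otimes> z) * p n (inv (inv x \<otimes> z) \<otimes> (inv x \<otimes> y)) = p m (inv x \<otimes> z) * p n (inv y \<otimes> z)"
      using p_inv assms z by simp
  qed
qed

text \<open>By symmetry of the walk, \<open>p (2 * m) (inv x \<otimes> y)\<close> is the inner product of the translates of \<open>p m\<close> by
  \<open>x\<close> and \<open>y\<close>. The points are indexed so that they may coincide.\<close>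

lemma gram:
  assumes "finite K" "\<And>i. i \<in> K \<Longrightarrow> x i \<in> carrier G"
  shows "((\<lambda>z. (\<Sum>i\<in>K. c i * p m (inv (x i) \<otimes> z))\<^sup>2) has_sum
      (\<Sum>i\<in>K. \<Sum>j\<in>K. c i * c j * p (2 * m) (inv (x i) \<otimes> x j))) (carrier G)"
proof -
  have "((\<lambda>z. \<Sum>i\<in>K. \<Sum>j\<in>K. (c i * c j) * (p m (inv (x i) \<otimes> z) * p m (inv (x j) \<otimes> z))) has_sum
      (\<Sum>i\<in>K. \<Sum>j\<in>K. (c i * c j) * p (m + m) (inv (x i) \<otimes> x j))) (carrier G)"
    by (intro has_sum_finite_sum has_sum_cmult_right p_inner assms)
  moreover have "(\<Sum>i\<in>K. \<Sum>j\<in>K. (c i * c j) * (p m (inv (x i) \<otimes> z) * p m (inv (x j) \<otimes> z)))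
      = (\<Sum>i\<in>K. c i * p m (inv (x i) \<otimes> z))\<^sup>2" for z
    unfolding power2_eq_square sum_product by (intro sum.cong refl) (simp add: mult_ac)
  ultimately show ?thesis by (simp add: mult_2)
qed

lemma gram_nonneg:
  assumes "finite K" "\<And>i. i \<in> K \<Longrightarrow> x i \<in> carrier G"
  shows "(\<Sum>i\<in>K. \<Sum>j\<in>K. c i * c j * p (2 * m) (inv (x i) \<otimes> x j)) \<ge> 0"
  by (rule has_sum_nonneg[OF gram[OF assms]]) auto

text \<open>Half the squared distance between \<open>p n\<close> and its translate by \<open>g\<close>.\<close>

definition defect :: "nat \<Rightarrow> 'a \<Rightarrow> real" where
  "defect n g = p (2 * n) \<one> - p (2 * n) g"

lemma defect_one [simp]: "defect n \<one> = 0"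
  by (simp add: defect_def)

lemma defect_inv: "g \<in> carrier G \<Longrightarrow> defect n (inv g) = defect n g"
  by (simp add: defect_def p_inv)

lemma defect_nonneg:
  assumes g: "g \<in> carrier G"
  shows "defect n g \<ge> 0"
  using gram_nonneg[of "{0, 1 :: nat}" "\<lambda>i. if i = 0 then \<one> else g" "\<lambda>i. if i = 0 then 1 else - 1" n]
    p_inv[OF g] g by (simp add: defect_def)

text \<open>Positive definiteness at the points \<open>\<one>\<close>, \<open>g\<close>, \<open>g \<otimes> h\<close> with coefficients \<open>1\<close>, \<open>-2\<close>, \<open>1\<close>.\<close>

lemma defect_mult:
  assumes g: "g \<in> carrier G" and h: "h \<in> carrier G"
  shows "defect n (g \<otimes> h) \<le> 2 * (defect n g + defect n h)"
proof -
  have gh: "inv (g \<otimes> h) \<otimes> g = inv h"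
    using assms by (simp add: inv_mult_group m_assoc)
  have pos: "(\<Sum>i\<in>{0, 1, 2}. \<Sum>j\<in>{0, 1, 2}. c i * c j * p (2 * n) (inv (x i) \<otimes> x j)) \<ge> 0"
    if "c = (\<lambda>i::nat. if i = 1 then - 2 else 1)" "x = (\<lambda>i::nat. if i = 0 then \<one> else if i = 1 then g else g \<otimes> h)" for c x
    by (rule gram_nonneg) (use assms that in auto)
  show ?thesis
    using pos[OF refl refl] gh p_inv[OF g] p_inv[OF h] p_inv[of "g \<otimes> h"] g h
    by (simp add: defect_def)
qed

lemma defect_expectation:
  "((\<lambda>g. p k g * defect n g) has_sum (p (2 * n) \<one> - p (k + 2 * n) \<one>)) (carrier G)"
proof -
  have "((\<lambda>g. p k g * p (2 * n) \<one>) has_sum (1 * p (2 * n) \<one>)) (carrier G)"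
    by (rule has_sum_cmult_left) (use density_p in \<open>auto simp: density_def\<close>)
  moreover have "((\<lambda>g. p k g * p (2 * n) (inv g \<otimes> \<one>)) has_sum p (k + 2 * n) \<one>) (carrier G)"
    by (rule p_has_sum) auto
  ultimately have "((\<lambda>g. p k g * p (2 * n) \<one> - p k g * p (2 * n) (inv g \<otimes> \<one>)) has_sum
      (1 * p (2 * n) \<one> - p (k + 2 * n) \<one>)) (carrier G)"
    by (rule has_sum_real_diff)
  then have "((\<lambda>g. p k g * defect n g) has_sum (1 * p (2 * n) \<one> - p (k + 2 * n) \<one>)) (carrier G)"
    by (rule has_sum_cong[THEN iffD1, rotated]) (simp add: defect_def p_inv algebra_simps)
  then show ?thesis by simp
qed

lemma p_even_le: "p (k + 2 * n) \<one> \<le> p (2 * n) \<one>"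
  using has_sum_nonneg[OF defect_expectation[of k n]] p_nonneg defect_nonneg by fastforce

lemma p_Suc_ge: "p (Suc n) \<one> \<ge> \<mu> \<one> * p n \<one>"
proof -
  have "p n \<one> * p 1 (inv \<one> \<otimes> \<one>) \<le> p (n + 1) \<one>"
    by (rule has_sum_ge_term[OF p_has_sum]) (auto simp del: One_nat_def intro: mult_nonneg_nonneg p_nonneg)
  then show ?thesis using p_1[of \<one>] by (simp add: mult.commute)
qed

lemma p_2_ge:
  assumes g: "g \<in> carrier G"
  shows "p 2 g \<ge> \<mu> \<one> * \<mu> g"
proof -
  have "p 1 \<one> * p 1 (inv \<one> \<otimes> g) \<le> p (1 + 1) g"
    by (rule has_sum_ge_term[OF p_has_sum]) (use g in \<open>auto simp del: One_nat_def intro: mult_nonneg_nonneg p_nonneg\<close>)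
  then show ?thesis using p_1[of \<one>] p_1[OF g] g by (simp del: One_nat_def)
qed

text \<open>The spectrum of the walk stays away from \<open>-1\<close> because it may stand still, so the decrease in one
  step is comparable to the decrease in two steps. Concretely, the step distribution of two steps
  dominates \<open>\<mu> \<one> * \<mu>\<close>.\<close>

lemma defect_mean_le:
  assumes "((\<lambda>g. \<mu> g * defect n g) has_sum E) (carrier G)"
  shows "E \<le> (p (2 * n) \<one> - p (2 * Suc n) \<one>) / \<mu> \<one>"
proof -
  have "\<mu> \<one> * E \<le> p (2 * n) \<one> - p (2 + 2 * n) \<one>"
  proof (rule has_sum_mono[OF has_sum_cmult_right[OF assms] defect_expectation])
    fix g assume g: "g \<in> carrier G"
    have "(\<mu> \<one> * \<mu> g) * defect n g \<le> p 2 g * defect n g"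
      by (intro mult_right_mono p_2_ge defect_nonneg g)
    then show "\<mu> \<one> * (\<mu> g * defect n g) \<le> p 2 g * defect n g" by (simp add: mult.assoc)
  qed
  then show ?thesis using mu_one by (simp add: field_simps)
qed

text \<open>The second difference is the squared norm of \<open>p n - p (n + 2)\<close>.\<close>

lemma p_convex: "p (2 * Suc n) \<one> - p (2 * Suc (Suc n)) \<one> \<le> p (2 * n) \<one> - p (2 * Suc n) \<one>"
proof -
  have i: "((\<lambda>z. p a (inv \<one> \<otimes> z) * p b (inv \<one> \<otimes> z)) has_sum p (a + b) (inv \<one> \<otimes> \<one>)) (carrier G)" for a b
    by (rule p_inner) auto
  have "((\<lambda>z. p n (inv \<one> \<otimes> z) * p n (inv \<one> \<otimes> z) + p (n+2) (inv \<one> \<otimes> z) * p (n+2) (inv \<one> \<otimes> z)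
      - 2 * (p n (inv \<one> \<otimes> z) * p (n+2) (inv \<one> \<otimes> z))) has_sum
      (p (n + n) (inv \<one> \<otimes> \<one>) + p ((n+2) + (n+2)) (inv \<one> \<otimes> \<one>) - 2 * p (n + (n+2)) (inv \<one> \<otimes> \<one>))) (carrier G)"
    by (intro has_sum_real_diff has_sum_add has_sum_cmult_right i)
  then have "0 \<le> p (n + n) (inv \<one> \<otimes> \<one>) + p ((n+2) + (n+2)) (inv \<one> \<otimes> \<one>) - 2 * p (n + (n+2)) (inv \<one> \<otimes> \<one>)"
  proof (rule has_sum_nonneg)
    fix z
    have "0 \<le> (p n (inv \<one> \<otimes> z) - p (n+2) (inv \<one> \<otimes> z))\<^sup>2" by simp
    then show "0 \<le> p n (inv \<one> \<otimes> z) * p n (inv \<one> \<otimes> z) + p (n+2) (inv \<one> \<otimes> z) * p (n+2) (inv \<one> \<otimes> z)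
      - 2 * (p n (inv \<one> \<otimes> z) * p (n+2) (inv \<one> \<otimes> z))"
      by (simp add: power2_eq_square algebra_simps)
  qed
  moreover have "n + n = 2 * n" "(n + 2) + (n + 2) = 2 * Suc (Suc n)" "n + (n + 2) = 2 * Suc n" by auto
  ultimately have "0 \<le> p (2 * n) (inv \<one> \<otimes> \<one>) + p (2 * Suc (Suc n)) (inv \<one> \<otimes> \<one>) - 2 * p (2 * Suc n) (inv \<one> \<otimes> \<one>)"
    by metis
  then show ?thesis by simp
qed

text \<open>Let \<open>a m\<close> be the quadratic form of the \<open>m\<close>-step kernel at \<open>\<psi>\<close>. Cauchy-Schwarz gives
  \<open>(a m)\<^sup>2 \<le> a 0 * a (2 * m)\<close>, which propagates \<open>a 1 \<ge> t * a 0\<close> through the powers of two. On the other hand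
  the kernel is at most \<open>p (2 * m) \<one>\<close>, and \<open>\<psi>\<close> is supported on \<open>U\<close>.\<close>

lemma test_function_lower_bound:
  assumes U: "finite U" "U \<subseteq> carrier G"
    and S: "S = (\<Sum>x\<in>U. (\<psi> x)\<^sup>2)" "S > 0"
    and t: "t \<ge> 0" "t * S \<le> (\<Sum>x\<in>U. \<Sum>y\<in>U. \<psi> x * \<psi> y * \<mu> (inv x \<otimes> y))"
    and pos: "\<And>x. x \<in> U \<Longrightarrow> \<psi> x \<ge> 0"
  shows "t ^ (2 * 2 ^ j) \<le> p (2 * 2 ^ j) \<one> * real (card U)"
proof -
  define a where "a m = (\<Sum>x\<in>U. \<Sum>y\<in>U. \<psi> x * \<psi> y * p m (inv x \<otimes> y))" for m
  have Uc: "x \<in> carrier G" if "x \<in> U" for x using that U(2) by auto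
  have sq: "(a m)\<^sup>2 \<le> S * a (2 * m)" for m
  proof -
    let ?\<phi> = "\<lambda>z. \<Sum>x\<in>U. \<psi> x * p m (inv x \<otimes> z)"
    have "a m = (\<Sum>z\<in>U. \<psi> z * ?\<phi> z)"
      unfolding a_def sum_distrib_left by (subst sum.swap) (intro sum.cong refl; simp add: mult_ac)
    then have "(a m)\<^sup>2 \<le> (\<Sum>z\<in>U. (\<psi> z)\<^sup>2) * (\<Sum>z\<in>U. (?\<phi> z)\<^sup>2)"
      using Cauchy_Schwarz_ineq_sum[of \<psi> ?\<phi> U] by simp
    also have "(\<Sum>z\<in>U. (?\<phi> z)\<^sup>2) \<le> a (2 * m)"
    proof -
      have gr: "((\<lambda>z. (?\<phi> z)\<^sup>2) has_sum a (2 * m)) (carrier G)"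
        unfolding a_def by (rule gram) (use U in auto)
      have "(\<Sum>z\<in>U. (?\<phi> z)\<^sup>2) \<le> infsum (\<lambda>z. (?\<phi> z)\<^sup>2) (carrier G)"
        by (rule finite_sum_le_infsum) (use gr U in \<open>auto simp: summable_on_def\<close>)
      then show ?thesis using infsumI[OF gr] by simp
    qed
    finally show ?thesis using S by (simp add: mult_left_mono)
  qed
  have a1: "t * S \<le> a 1"
    unfolding a_def using t(2) Uc p_1 by (simp cong: sum.cong)
  have pw: "S * t ^ (2 ^ i) \<le> a (2 ^ i)" for i
  proof (induction i)
    case 0
    then show ?case using a1 by (simp add: mult.commute)
  next
    case (Suc i)
    have "(S * t ^ (2 ^ i))\<^sup>2 \<le> (a (2 ^ i))\<^sup>2"
      by (rule power_mono[OF Suc]) (use S t in auto)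
    also have "\<dots> \<le> S * a (2 * 2 ^ i)" by (rule sq)
    also have "(S * t ^ (2 ^ i))\<^sup>2 = S * (S * t ^ (2 * 2 ^ i))"
      by (simp add: power2_eq_square mult_2 power_add)
    finally show ?case using S by simp
  qed
  have "a (2 * m) \<le> p (2 * m) \<one> * (real (card U) * S)" for m
  proof -
    have "a (2 * m) \<le> (\<Sum>x\<in>U. \<Sum>y\<in>U. \<psi> x * \<psi> y * p (2 * m) \<one>)"
      unfolding a_def
    proof (intro sum_mono mult_left_mono mult_nonneg_nonneg pos)
      fix x y assume "x \<in> U" "y \<in> U"
      then show "p (2 * m) (inv x \<otimes> y) \<le> p (2 * m) \<one>"
        using defect_nonneg[of "inv x \<otimes> y" m] Uc by (simp add: defect_def)
    qed
    also have "\<dots> = p (2 * m) \<one> * (\<Sum>x\<in>U. \<psi> x)\<^sup>2"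
      unfolding power2_eq_square sum_product sum_distrib_left sum_distrib_right
      by (intro sum.cong refl) (simp add: mult_ac)
    also have "(\<Sum>x\<in>U. \<psi> x)\<^sup>2 \<le> real (card U) * S"
      using Cauchy_Schwarz_ineq_sum[of "\<lambda>_. 1" \<psi> U] S by simp
    finally show ?thesis using p_nonneg by (simp add: mult_left_mono)
  qed
  from order_trans[OF pw[of "Suc j"] this[of "2 ^ j", folded power_Suc]]
  have "S * t ^ (2 * 2 ^ j) \<le> S * (p (2 * 2 ^ j) \<one> * real (card U))"
    by (simp add: mult_ac)
  then show ?thesis using S by simp
qed

end

section \<open>Estimates for sequences and series\<close>

text \<open>As the decrements decrease, the decrement at time \<open>2 * n\<close> is at most \<open>u n / n\<close>. The choice
  \<open>r = \<eta> * n\<close> with a small \<open>\<eta>\<close> then bounds \<open>u (2 * n)\<close> by a multiple of \<open>n powr - D\<close> plus a small multiple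
  of \<open>u n\<close>, and this recursion is iterated.\<close>

lemma powr_decay_of_spectral_profile:
  fixes u :: "nat \<Rightarrow> real"
  assumes nonneg: "\<And>n. u n \<ge> 0" and decr: "\<And>n. u (Suc n) \<le> u n"
    and conv: "\<And>n. u (Suc n) - u (Suc (Suc n)) \<le> u n - u (Suc n)"
    and D: "D \<ge> 0" and C: "C > 0"
    and profile: "\<And>n r. r \<ge> 1 \<Longrightarrow> u n \<le> r powr - D + C * r * (u n - u (Suc n))"
  shows "\<exists>B>0. \<forall>n\<ge>1. u n \<le> B * real n powr - D"
proof -
  have anti: "u n \<le> u m" if "m \<le> n" for m n
    using decr that by (rule lift_Suc_antimono_le)
  have drop: "real n * (u (2 * n) - u (Suc (2 * n))) \<le> u n" for n
  proof -
    have danti: "u b - u (Suc b) \<le> u a - u (Suc a)" if "a \<le> b" for a b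
      using lift_Suc_antimono_le[of "\<lambda>n. u n - u (Suc n)" a b] conv that by auto
    have "real n * (u (2 * n) - u (Suc (2 * n))) = (\<Sum>j\<in>{n..<2 * n}. u (2 * n) - u (Suc (2 * n)))"
      by simp
    also have "\<dots> \<le> (\<Sum>j\<in>{n..<2 * n}. u j - u (Suc j))"
      by (intro sum_mono danti) auto
    also have "\<dots> = - (\<Sum>j\<in>{n..<2 * n}. u (Suc j) - u j)"
      by (simp flip: sum_negf)
    also have "\<dots> = u n - u (2 * n)"
      by (subst sum_Suc_diff') auto
    finally show ?thesis using nonneg[of "2 * n"] by simp
  qed
  \<comment> \<open>The base \<open>3\<close> comes from \<open>n \<le> 3 * (n div 2)\<close> for \<open>n \<ge> 2\<close>.\<close>
  define \<eta> where "\<eta> = 3 powr - D / (2 * C)"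
  have \<eta>: "\<eta> > 0" "C * \<eta> = 3 powr - D / 2" using C by (auto simp: \<eta>_def)
  define n0 where "n0 = nat \<lceil>1 / \<eta>\<rceil>"
  define B where "B = 2 * 3 powr D * \<eta> powr - D + (u 0 + 1) * (2 * real n0 + 2) powr D"
  have B: "B > 0" using \<eta> nonneg[of 0] by (auto simp: B_def intro!: add_pos_pos)
  have "u n \<le> B * real n powr - D" if "n \<ge> 1" for n
    using that
  proof (induction n rule: less_induct)
    case (less n)
    define k where "k = n div 2"
    have nk: "2 * k \<le> n" "n \<le> 2 * k + 1" by (auto simp: k_def)
    show ?case
    proof (cases "k < n0 \<or> k = 0")
      case True
      then have "real n \<le> 2 * real n0 + 2" using nk by linarith
      then have "real n powr D \<le> (2 * real n0 + 2) powr D" using D by (intro powr_mono2) auto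
      then have "(u 0 + 1) * real n powr D \<le> (u 0 + 1) * (2 * real n0 + 2) powr D"
        using nonneg[of 0] by (intro mult_left_mono) auto
      also have "\<dots> \<le> B" by (simp add: B_def)
      finally have "(u 0 + 1) * real n powr D * real n powr - D \<le> B * real n powr - D"
        by (intro mult_right_mono) auto
      moreover have "real n powr D * real n powr - D = 1"
        using less.prems by (simp flip: powr_add)
      ultimately show ?thesis using anti[of 0 n] by (simp add: mult.assoc)
    next
      case False
      then have k: "k \<ge> 1" "k \<ge> n0" "k < n" using nk by auto
      have "1 / \<eta> \<le> real k" using k(2) unfolding n0_def by linarith
      then have r: "\<eta> * real k \<ge> 1" using \<eta> by (simp add: field_simps)
      have "C * (\<eta> * real k) * (u (2 * k) - u (Suc (2 * k))) = C * \<eta> * (real k * (u (2 * k) - u (Suc (2 * k))))"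
        by simp
      also have "\<dots> \<le> C * \<eta> * u k"
        using C \<eta> by (intro mult_left_mono drop) auto
      also have "\<dots> \<le> C * \<eta> * (B * real k powr - D)"
        using C \<eta> less.IH[OF k(3,1)] by (intro mult_left_mono) auto
      finally have "u (2 * k) \<le> (\<eta> * real k) powr - D + C * \<eta> * (B * real k powr - D)"
        using profile[OF r, of "2 * k"] by linarith
      also have "\<dots> = (\<eta> powr - D + 3 powr - D / 2 * B) * real k powr - D"
        using \<eta> by (simp add: powr_mult algebra_simps)
      also have "\<eta> powr - D + 3 powr - D / 2 * B \<le> B * 3 powr - D"
      proof -
        have "2 * 3 powr D * \<eta> powr - D * 3 powr - D \<le> B * 3 powr - D"
          using nonneg[of 0] by (intro mult_right_mono) (auto simp: B_def)
        moreover have "(3::real) powr D * 3 powr - D = 1" by (simp flip: powr_add)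
        ultimately show ?thesis by (simp add: mult_ac)
      qed
      finally have "u (2 * k) \<le> B * (3 powr - D * real k powr - D)"
        by (simp add: mult_right_mono mult.assoc)
      also have "3 powr - D * real k powr - D = (3 * real k) powr - D"
        by (simp add: powr_mult)
      also have "B * (3 * real k) powr - D \<le> B * real n powr - D"
        using nk k B D by (intro mult_left_mono powr_mono2') auto
      finally show ?thesis using anti[OF nk(1)] by simp
    qed
  qed
  then show ?thesis using B by blast
qed

lemma sum_symmetric_interval:
  fixes g :: "nat \<Rightarrow> real"
  shows "(\<Sum>m\<in>{- int M..int M}. g (nat \<bar>m\<bar>)) = g 0 + 2 * (\<Sum>k\<in>{1..<Suc M}. g k)"
proof (induction M)
  case (Suc M)
  have "{- int (Suc M)..int (Suc M)} = insert (int (Suc M)) (insert (- int (Suc M)) {- int M..int M})"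
    by auto
  then have "(\<Sum>m\<in>{- int (Suc M)..int (Suc M)}. g (nat \<bar>m\<bar>)) = 2 * g (Suc M) + (\<Sum>m\<in>{- int M..int M}. g (nat \<bar>m\<bar>))"
    by (simp add: nat_add_distrib)
  then show ?case using Suc by simp
qed auto

lemma powr_diff_mvt:
  fixes x b :: real
  assumes "x > 0" "b \<noteq> 0"
  obtains z where "x < z" "z < x + 1" "(x + 1) powr b - x powr b = b * z powr (b - 1)"
proof -
  have "((\<lambda>t. t powr b) has_real_derivative b * t powr (b - 1)) (at t)" if "x \<le> t" for t
    by (rule has_real_derivative_powr) (use assms that in auto)
  then show ?thesis
    using MVT2[of x "x + 1" "\<lambda>t. t powr b" "\<lambda>t. b * t powr (b - 1)"] that by auto
qed

text \<open>For \<open>k\<close> below \<open>X\<close> the sum is that of \<open>k powr (1 - a)\<close> divided by the square of \<open>X\<close>, beyond \<open>X\<close> it is that of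
  \<open>k powr (- a - 1)\<close>. Both are compared with telescoping sums by the mean value theorem.\<close>

lemma truncated_second_moment:
  fixes a :: real
  assumes a: "0 < a" "a < 2"
  shows "\<exists>C\<ge>0. \<forall>X\<ge>1. \<forall>M. (\<Sum>k\<in>{1..<M}. (1 + real k) powr (- a - 1) * (min 1 (real k / X))\<^sup>2) \<le> C * X powr - a"
proof -
  define C where "C = 2 / (2 - a) * 4 + 1 / a"
  have "(\<Sum>k\<in>{1..<M}. (1 + real k) powr (- a - 1) * (min 1 (real k / X))\<^sup>2) \<le> C * X powr - a"
    if X: "X \<ge> 1" for X M
  proof -
    let ?h = "\<lambda>k. (1 + real k) powr (- a - 1) * (min 1 (real k / X))\<^sup>2"
    define N where "N = nat \<lceil>X\<rceil>"
    have N: "N \<ge> 1" "X \<le> real N" "real N \<le> 2 * X" using X unfolding N_def by linarith+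
    have near: "?h k \<le> X powr - 2 * (2 / (2 - a)) * (real (Suc k) powr (2 - a) - real k powr (2 - a))" if k: "k \<ge> 1" for k
    proof -
      obtain z where z: "real k < z" "z < real k + 1" "(real k + 1) powr (2 - a) - real k powr (2 - a) = (2 - a) * z powr (2 - a - 1)"
        using powr_diff_mvt[of "real k" "2 - a"] a k by auto
      have "(1 + real k) powr (1 - a) \<le> 2 * z powr (1 - a)"
      proof (cases "a \<ge> 1")
        case True
        then have "(1 + real k) powr (1 - a) \<le> z powr (1 - a)"
          using z k by (intro powr_mono2') auto
        then show ?thesis using powr_ge_zero[of z "1 - a"] by linarith
      next
        case False
        have "(1 + real k) powr (1 - a) \<le> (2 * z) powr (1 - a)"
          using False z k by (intro powr_mono2) auto
        also have "\<dots> = 2 powr (1 - a) * z powr (1 - a)" by (simp add: powr_mult)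
        also have "\<dots> \<le> 2 powr 1 * z powr (1 - a)"
          using a by (intro mult_right_mono powr_mono) auto
        finally show ?thesis by simp
      qed
      also have "2 * z powr (1 - a) = (2 / (2 - a)) * (real (Suc k) powr (2 - a) - real k powr (2 - a))"
        using z(3) a by (simp add: field_simps add.commute)
      finally have *: "(1 + real k) powr (1 - a) \<le> (2 / (2 - a)) * (real (Suc k) powr (2 - a) - real k powr (2 - a))" .
      have "(min 1 (real k / X))\<^sup>2 \<le> ((1 + real k) / X)\<^sup>2"
        using X by (intro power_mono) (auto simp: min_def field_simps)
      also have "\<dots> = X powr - 2 * (1 + real k) powr 2"
        using X by (simp add: power_divide powr_minus field_simps powr_numeral)
      finally have "?h k \<le> (1 + real k) powr (- a - 1) * (X powr - 2 * (1 + real k) powr 2)"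
        by (intro mult_left_mono) auto
      also have "\<dots> = X powr - 2 * ((1 + real k) powr (- a - 1) * (1 + real k) powr 2)"
        by (simp only: mult_ac)
      also have "(1 + real k) powr (- a - 1) * (1 + real k) powr 2 = (1 + real k) powr (1 - a)"
        by (subst powr_add[symmetric]) simp
      also have "X powr - 2 * (1 + real k) powr (1 - a) \<le> X powr - 2 * ((2 / (2 - a)) * (real (Suc k) powr (2 - a) - real k powr (2 - a)))"
        using * by (intro mult_left_mono) auto
      finally show ?thesis by (simp only: mult.assoc)
    qed
    have far: "?h k \<le> - (1 / a) * (real (Suc k) powr - a - real k powr - a)" if k: "k \<ge> 1" for k
    proof -
      obtain z where z: "real k < z" "z < real k + 1" "(real k + 1) powr - a - real k powr - a = - a * z powr (- a - 1)"
        using powr_diff_mvt[of "real k" "- a"] a k by auto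
      have "?h k \<le> (1 + real k) powr (- a - 1) * 1\<^sup>2"
        using X by (intro mult_left_mono power_mono) auto
      also have "\<dots> \<le> z powr (- a - 1)"
        using z k a by (simp add: powr_mono2')
      also have "\<dots> = - (1 / a) * (real (Suc k) powr - a - real k powr - a)"
        using z(3) a by (simp add: field_simps add.commute)
      finally show ?thesis .
    qed
    define M' where "M' = max M N"
    have "(\<Sum>k\<in>{1..<M}. ?h k) \<le> (\<Sum>k\<in>{1..<M'}. ?h k)"
      by (intro sum_mono2) (auto simp: M'_def)
    also have "\<dots> = (\<Sum>k\<in>{1..<N}. ?h k) + (\<Sum>k\<in>{N..<M'}. ?h k)"
      by (rule sum.atLeastLessThan_concat[symmetric]) (use N in \<open>auto simp: M'_def\<close>)
    also have "(\<Sum>k\<in>{1..<N}. ?h k) \<le> X powr - 2 * (2 / (2 - a)) * (\<Sum>k\<in>{1..<N}. real (Suc k) powr (2 - a) - real k powr (2 - a))"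
      unfolding sum_distrib_left by (intro sum_mono near) auto
    also have "(\<Sum>k\<in>{1..<N}. real (Suc k) powr (2 - a) - real k powr (2 - a)) = real N powr (2 - a) - real 1 powr (2 - a)"
      by (rule sum_Suc_diff') (use N in auto)
    also have "X powr - 2 * (2 / (2 - a)) * (real N powr (2 - a) - real 1 powr (2 - a)) \<le> X powr - 2 * (2 / (2 - a)) * (4 * X powr (2 - a))"
    proof (intro mult_left_mono)
      have "real N powr (2 - a) \<le> (2 * X) powr (2 - a)" using N a by (intro powr_mono2) auto
      also have "\<dots> = 2 powr (2 - a) * X powr (2 - a)" by (simp add: powr_mult)
      also have "\<dots> \<le> 2 powr 2 * X powr (2 - a)" using a by (intro mult_right_mono powr_mono) auto
      finally show "real N powr (2 - a) - real 1 powr (2 - a) \<le> 4 * X powr (2 - a)" by simp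
    qed (use a in auto)
    also have "X powr - 2 * (2 / (2 - a)) * (4 * X powr (2 - a)) = 2 / (2 - a) * 4 * X powr - a"
    proof -
      have "X powr - 2 * X powr (2 - a) = X powr - a" by (simp flip: powr_add)
      then show ?thesis by (simp add: mult_ac)
    qed
    also have "(\<Sum>k\<in>{N..<M'}. ?h k) \<le> - (1 / a) * (\<Sum>k\<in>{N..<M'}. real (Suc k) powr - a - real k powr - a)"
      unfolding sum_distrib_left by (intro sum_mono far) (use N in auto)
    also have "(\<Sum>k\<in>{N..<M'}. real (Suc k) powr - a - real k powr - a) = real M' powr - a - real N powr - a"
      by (rule sum_Suc_diff') (auto simp: M'_def)
    also have "- (1 / a) * (real M' powr - a - real N powr - a) \<le> 1 / a * X powr - a"
    proof -
      have "real N powr - a \<le> X powr - a" using N X a by (intro powr_mono2') auto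
      then have "real N powr - a - real M' powr - a \<le> X powr - a"
        using powr_ge_zero[of "real M'" "- a"] by linarith
      then have "1 / a * (real N powr - a - real M' powr - a) \<le> 1 / a * X powr - a"
        using a by (intro mult_left_mono) auto
      then show ?thesis by (simp add: algebra_simps)
    qed
    finally show ?thesis by (simp add: C_def algebra_simps)
  qed
  moreover have "C \<ge> 0" using a by (auto simp: C_def)
  ultimately show ?thesis by blast
qed

lemma infsum_le_of_intervals:
  fixes f :: "int \<Rightarrow> real"
  assumes "f summable_on UNIV" "\<And>m. f m \<ge> 0" "\<And>M::nat. (\<Sum>m\<in>{- int M..int M}. f m) \<le> b"
  shows "(\<Sum>\<^sub>\<infinity>m\<in>UNIV. f m) \<le> b"
proof (rule infsum_le_finite_sums[OF assms(1)])
  fix F :: "int set" assume F: "finite F" "F \<subseteq> UNIV"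
  define M where "M = nat (\<Sum>m\<in>F. \<bar>m\<bar>)"
  have "F \<subseteq> {- int M..int M}"
  proof
    fix m assume "m \<in> F"
    then have "\<bar>m\<bar> \<le> (\<Sum>m\<in>F. \<bar>m\<bar>)" using F by (intro member_le_sum) auto
    then show "m \<in> {- int M..int M}" by (auto simp: M_def)
  qed
  then have "sum f F \<le> (\<Sum>m\<in>{- int M..int M}. f m)"
    by (intro sum_mono2) (use assms in auto)
  then show "sum f F \<le> b" using assms(3)[of M] by linarith
qed

abbreviation capped_square :: "real \<Rightarrow> real \<Rightarrow> int \<Rightarrow> real" where
  "capped_square R w m \<equiv> (min 1 (\<bar>real_of_int m\<bar> * R powr - w))\<^sup>2"

lemma power_weight_truncated:
  "(\<lambda>m. power_weight \<alpha> m * capped_square R w m) summable_on UNIV" if "\<alpha> > 0"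
proof (rule summable_on_comparison_test[OF power_weight_summable[OF that]])
  fix m
  have "capped_square R w m \<le> 1\<^sup>2"
    by (intro power_mono) auto
  then show "power_weight \<alpha> m * capped_square R w m \<le> power_weight \<alpha> m"
    using power_weight_nonneg[of \<alpha> m] by (simp add: mult_left_le)
qed (auto simp: power_weight_nonneg)

text \<open>For \<open>\<alpha> < 2\<close> the weight is chosen such that the truncated second moment at \<open>R powr w\<close> is exactly of
  order \<open>1 / R\<close>. For \<open>\<alpha> \<ge> 2\<close> the exponent \<open>1 / w\<close> is less than \<open>2\<close>, so the truncated square is at most
  \<open>\<bar>m\<bar> powr (1 / w) / R\<close>, and the moment of order \<open>1 / w\<close> is finite because \<open>1 / w < \<alpha>\<close>.\<close>

lemma power_weight_energy:
  assumes "\<alpha> > 0" and w: "(\<alpha> < 2 \<and> w = 1 / real_of_ereal \<alpha>) \<or> (\<alpha> \<ge> 2 \<and> w > 1 / 2)"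
  shows "\<exists>C\<ge>0. \<forall>R\<ge>1. (\<Sum>\<^sub>\<infinity>m\<in>UNIV. power_weight \<alpha> m * capped_square R w m) \<le> C / R"
proof (cases "\<alpha> < 2")
  case True
  define a where "a = real_of_ereal \<alpha>"
  have a: "0 < a" "a < 2" "\<alpha> = ereal a" "w = 1 / a"
    using True w assms(1) by (cases \<alpha>; auto simp: a_def)+
  obtain C where C: "C \<ge> 0" "\<And>X M. X \<ge> 1 \<Longrightarrow> (\<Sum>k\<in>{1..<M}. (1 + real k) powr (- a - 1) * (min 1 (real k / X))\<^sup>2) \<le> C * X powr - a"
    using truncated_second_moment[OF a(1,2)] by blast
  have "(\<Sum>\<^sub>\<infinity>m\<in>UNIV. power_weight \<alpha> m * capped_square R w m) \<le> 2 * C / R" if R: "R \<ge> 1" for R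
  proof (rule infsum_le_of_intervals[OF power_weight_truncated[OF assms(1)]])
    fix M :: nat
    define g where "g k = (1 + real k) powr (- a - 1) * (min 1 (real k / R powr w))\<^sup>2" for k
    have "(\<Sum>m\<in>{- int M..int M}. power_weight \<alpha> m * capped_square R w m) = (\<Sum>m\<in>{- int M..int M}. g (nat \<bar>m\<bar>))"
      by (intro sum.cong refl) (simp add: g_def power_weight_def a(3) powr_minus divide_inverse)
    also have "\<dots> = 2 * (\<Sum>k\<in>{1..<Suc M}. g k)"
      by (subst sum_symmetric_interval) (simp add: g_def)
    also have "(\<Sum>k\<in>{1..<Suc M}. g k) \<le> C * (R powr w) powr - a"
      unfolding g_def by (rule C(2)) (use R a in \<open>auto intro: ge_one_powr_ge_zero\<close>)
    also have "(R powr w) powr - a = 1 / R"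
      using R a by (simp add: powr_powr powr_minus divide_inverse)
    finally show "(\<Sum>m\<in>{- int M..int M}. power_weight \<alpha> m * capped_square R w m) \<le> 2 * C / R"
      by simp
  qed (auto simp: power_weight_nonneg)
  then show ?thesis using C(1) by (intro exI[of _ "2 * C"]) auto
next
  case False
  then have al: "\<alpha> \<ge> 2" and w2: "w > 1 / 2" using w by auto
  define \<theta> where "\<theta> = 1 / w"
  have \<theta>: "0 < \<theta>" "\<theta> < 2" "w * \<theta> = 1" using w2 by (auto simp: \<theta>_def field_simps)
  \<comment> \<open>The factor \<open>\<bar>m\<bar> powr \<theta>\<close> lowers the exponent of the weight; \<open>\<alpha> = \<infinity>\<close> stays \<open>\<infinity>\<close>.\<close>
  define \<beta> where "\<beta> = \<alpha> - ereal \<theta>"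
  have \<beta>: "\<beta> > 0"
    using al \<theta> by (cases \<alpha>) (auto simp: \<beta>_def)
  have dom: "power_weight \<alpha> m * capped_square R w m \<le> power_weight \<beta> m * (1 / R)" if R: "R \<ge> 1" for R m
  proof -
    define y where "y = \<bar>real_of_int m\<bar> * R powr - w"
    have y: "y \<ge> 0" by (simp add: y_def)
    have "(min 1 y)\<^sup>2 \<le> y powr \<theta>"
    proof (cases "y \<le> 1")
      case True
      have "y\<^sup>2 \<le> y powr \<theta>"
      proof (cases "y = 0")
        case False
        then have "y powr 2 \<le> y powr \<theta>" using True y \<theta> by (intro powr_mono') auto
        then show ?thesis using y False by (simp add: powr_numeral)
      qed simp
      then show ?thesis using True by (simp add: min_def)
    next
      case False
      then show ?thesis using \<theta> by (simp add: min_def ge_one_powr_ge_zero)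
    qed
    also have "y powr \<theta> = \<bar>real_of_int m\<bar> powr \<theta> * (1 / R)"
    proof -
      have "(R powr - w) powr \<theta> = R powr - (w * \<theta>)" by (simp add: powr_powr)
      also have "\<dots> = 1 / R" unfolding \<theta>(3) using R by (simp add: powr_minus divide_inverse)
      finally show ?thesis by (simp add: y_def powr_mult)
    qed
    finally have "power_weight \<alpha> m * (min 1 y)\<^sup>2 \<le> power_weight \<alpha> m * (\<bar>real_of_int m\<bar> powr \<theta> * (1 / R))"
      by (rule mult_left_mono) (rule power_weight_nonneg)
    also have "\<dots> = (power_weight \<alpha> m * \<bar>real_of_int m\<bar> powr \<theta>) * (1 / R)" by simp
    also have "power_weight \<alpha> m * \<bar>real_of_int m\<bar> powr \<theta> \<le> power_weight \<beta> m"
    proof (cases "\<alpha> = \<infinity>")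
      case True
      then show ?thesis using \<theta> by (auto simp: power_weight_def \<beta>_def)
    next
      case False
      then obtain a where a: "\<alpha> = ereal a" using al by (cases \<alpha>) auto
      have "(1 + \<bar>real_of_int m\<bar>) powr (- a - 1) * \<bar>real_of_int m\<bar> powr \<theta> \<le> (1 + \<bar>real_of_int m\<bar>) powr (- a - 1) * (1 + \<bar>real_of_int m\<bar>) powr \<theta>"
        using \<theta> by (intro mult_left_mono powr_mono2) auto
      also have "\<dots> = (1 + \<bar>real_of_int m\<bar>) powr (- (a - \<theta>) - 1)"
        by (subst powr_add[symmetric]) (simp add: algebra_simps)
      finally show ?thesis by (simp add: power_weight_def a \<beta>_def)
    qed
    finally show ?thesis using R by (simp add: y_def divide_right_mono)
  qed
  have "(\<Sum>\<^sub>\<infinity>m\<in>UNIV. power_weight \<alpha> m * capped_square R w m) \<le> (\<Sum>\<^sub>\<infinity>m\<in>UNIV. power_weight \<beta> m) / R" if R: "R \<ge> 1" for R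
  proof -
    have "(\<Sum>\<^sub>\<infinity>m\<in>UNIV. power_weight \<alpha> m * capped_square R w m) \<le> (\<Sum>\<^sub>\<infinity>m\<in>UNIV. power_weight \<beta> m * (1 / R))"
      by (rule infsum_mono[OF power_weight_truncated[OF assms(1)] _ dom[OF R]])
         (intro summable_on_cmult_left power_weight_summable \<beta>)
    also have "\<dots> = (\<Sum>\<^sub>\<infinity>m\<in>UNIV. power_weight \<beta> m) * (1 / R)"
      by (rule infsum_cmult_left) (use power_weight_summable[OF \<beta>] in auto)
    finally show ?thesis by simp
  qed
  then show ?thesis
    using power_weight_infsum_pos[OF \<beta>] by (intro exI[of _ "\<Sum>\<^sub>\<infinity>m\<in>UNIV. power_weight \<beta> m"]) auto
qed

section \<open>Walks along powers of generators\<close>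

context weighted_generators begin

definition word_length :: "real \<Rightarrow> 'a \<Rightarrow> real" where
  "word_length R g = Inf {a. word_cost alphabet R g a}"

lemma word_cost_alphabet_letter:
  assumes "letter h x v"
  shows "\<exists>a\<le>R powr - v. word_cost alphabet R x a"
proof (cases "x = \<one>")
  case True
  then show ?thesis using word_cost.one by (intro exI[of _ 0]) auto
next
  case False
  then have "(x, v) \<in> alphabet" using assms by (auto simp: alphabet_def)
  then show ?thesis using word_cost_letter by blast
qed

lemma word_cost_exists:
  assumes "g \<in> carrier G"
  shows "\<exists>a. word_cost alphabet R g a"
proof -
  have "g \<in> generate G (s ` I)" using assms generating by simp
  then show ?thesis
  proof (induction rule: generate.induct)
    case one
    show ?case using word_cost.one by blast
  next
    case (incl h)
    then show ?case using word_cost_alphabet_letter letter.gen by blast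
  next
    case (inv h)
    then show ?case using word_cost_alphabet_letter letter.gen_inv by blast
  next
    case (eng h1 h2)
    then show ?case using word_cost_mult by blast
  qed
qed

lemma bdd_below_word_cost: "bdd_below {a. word_cost alphabet R g a}"
  using word_cost_nonneg by (intro bdd_belowI[of _ 0]) auto

lemma word_length_le: "word_cost alphabet R g a \<Longrightarrow> word_length R g \<le> a"
  unfolding word_length_def by (rule cInf_lower[OF _ bdd_below_word_cost]) simp

lemma word_length_nonneg: "g \<in> carrier G \<Longrightarrow> word_length R g \<ge> 0"
  unfolding word_length_def using word_cost_exists word_cost_nonneg by (intro cInf_greatest) auto

lemma word_length_less_cost_le:
  assumes "g \<in> carrier G" "word_length R g < K"
  shows "cost_le alphabet R K g"
proof -
  have ne: "{a. word_cost alphabet R g a} \<noteq> {}" using word_cost_exists[OF assms(1)] by auto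
  obtain a where "word_cost alphabet R g a" "a < K"
    using cInf_lessD[OF ne assms(2)[unfolded word_length_def]] by auto
  then show ?thesis unfolding cost_le_def by (intro exI[of _ a]) auto
qed

lemma word_length_one: "word_length R \<one> = 0"
  using word_length_le[OF word_cost.one] word_length_nonneg[of \<one>] by (simp add: order_antisym)

lemma word_length_mult:
  assumes "g \<in> carrier G" "h \<in> carrier G"
  shows "word_length R (g \<otimes> h) \<le> word_length R g + word_length R h"
proof (rule field_le_epsilon)
  fix e :: real assume e: "e > 0"
  have near: "\<exists>a. word_cost alphabet R x a \<and> a < word_length R x + e / 2" if "x \<in> carrier G" for x
  proof -
    have ne: "{a. word_cost alphabet R x a} \<noteq> {}" using word_cost_exists[OF that] by auto
    have "Inf {a. word_cost alphabet R x a} < word_length R x + e / 2"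
      using e by (simp add: word_length_def)
    from cInf_lessD[OF ne this] show ?thesis by auto
  qed
  obtain a b where "word_cost alphabet R g a" "a < word_length R g + e / 2"
    "word_cost alphabet R h b" "b < word_length R h + e / 2"
    using near[OF assms(1)] near[OF assms(2)] by blast
  then show "word_length R (g \<otimes> h) \<le> word_length R g + word_length R h + e"
    using word_length_le[OF word_cost_mult[of alphabet R h b g a]] by simp
qed

lemma word_length_inv:
  assumes "g \<in> carrier G"
  shows "word_length R (inv g) = word_length R g"
proof -
  have "word_cost alphabet R (inv g) a \<longleftrightarrow> word_cost alphabet R g a" for a
    using word_cost_inv[of alphabet R g a] word_cost_inv[of alphabet R "inv g" a] assms by auto
  then show ?thesis by (simp add: word_length_def)
qed

lemma word_length_generator_pow:
  assumes "i \<in> I"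
  shows "word_length R (s i [^] (m::int)) \<le> \<bar>real_of_int m\<bar> * R powr - w i"
proof -
  have "cost_le alphabet R (R powr - w i) (s i)"
    using word_cost_alphabet_letter[OF letter.gen[OF assms], of R] by (simp add: cost_le_def)
  from cost_le_int_pow[OF this, of m] obtain a where "a \<le> \<bar>real_of_int m\<bar> * R powr - w i" "word_cost alphabet R (s i [^] m) a"
    by (auto simp: cost_le_def)
  then show ?thesis using word_length_le by fastforce
qed

end

text \<open>Hence there are many elements of bounded word length, which makes the test function of the lower
  bound large on a set of the right size.\<close>

lemma (in heavy_generators) adapted_word_length:
  assumes R: "R \<ge> 1"
  shows "adapted R (word_length R)"
  unfolding adapted_def
proof (intro conjI ballI allI impI)
  show "word_length R \<one> = 0" by (rule word_length_one)
next
  fix g assume "g \<in> carrier G"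
  then show "0 \<le> word_length R g" "word_length R (inv g) = word_length R g"
    by (rule word_length_nonneg, rule word_length_inv)
next
  fix g h assume gh: "g \<in> carrier G" "h \<in> carrier G"
  then show "word_length R (g \<otimes> h) \<le> 2 * (word_length R g + word_length R h)"
    using word_length_mult[OF gh, of R] word_length_nonneg[of g R] word_length_nonneg[of h R] by simp
next
  fix i assume i: "i \<in> I"
  have "R powr - w i \<le> R powr 0" using R w_pos[OF i] by (intro powr_mono) auto
  then show "word_length R (s i) \<le> 1"
    using word_length_generator_pow[OF i, of R 1] R s_carrier[OF i] by simp
next
  fix i m assume i: "i \<in> J" and m: "\<bar>real_of_int m\<bar> \<le> R powr w i"
  have "\<bar>real_of_int m\<bar> * R powr - w i \<le> R powr w i * R powr - w i"
    using m by (intro mult_right_mono) auto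
  also have "\<dots> = 1" using R by (simp flip: powr_add)
  finally show "word_length R (s i [^] m) \<le> 1"
    using word_length_generator_pow[of i R m] i J_subset by force
qed

text \<open>For \<open>l\<close> in an interval of length \<open>A\<close>, about \<open>R powr (1 / a)\<close>, the value at \<open>x [^] m\<close> is controlled by those at
  \<open>x [^] (m + l)\<close> and \<open>x [^] l\<close>. All these exponents have weight at least of order \<open>A powr (- a - 1)\<close>, so the average
  over \<open>l\<close> is at most of order \<open>A powr a\<close> times the weighted sum, and \<open>A powr a \<le> R\<close>.\<close>

lemma (in group) power_defect_le:
  fixes \<rho> :: "'a \<Rightarrow> real"
  assumes x: "x \<in> carrier G" and a: "a > 0" and R: "R \<ge> 1"
    and nonneg: "\<And>g. g \<in> carrier G \<Longrightarrow> \<rho> g \<ge> 0"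
    and inv: "\<And>g. g \<in> carrier G \<Longrightarrow> \<rho> (inv g) = \<rho> g"
    and mult: "\<And>g h. g \<in> carrier G \<Longrightarrow> h \<in> carrier G \<Longrightarrow> \<rho> (g \<otimes> h) \<le> 2 * (\<rho> g + \<rho> h)"
    and W: "\<And>L. finite L \<Longrightarrow> (\<Sum>j\<in>L. power_weight (ereal a) j * \<rho> (x [^] (j::int))) \<le> W"
    and m: "\<bar>real_of_int m\<bar> \<le> R powr (1 / a)"
  shows "\<rho> (x [^] m) \<le> 4 * 3 powr (a + 1) * R * W"
proof -
  define A where "A = \<lfloor>R powr (1 / a)\<rfloor>"
  have A: "A \<ge> 1" using R a by (simp add: A_def le_floor_iff ge_one_powr_ge_zero)
  have mA: "\<bar>m\<bar> \<le> A" using m by (simp add: A_def le_floor_iff)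
  define T where "T = (\<Sum>j\<in>{-2*A..2*A}. \<rho> (x [^] j))"
  have nn: "\<rho> (x [^] j) \<ge> 0" for j :: int using nonneg x by simp
  have "real_of_int A * \<rho> (x [^] m) = (\<Sum>l\<in>{1..A}. \<rho> (x [^] m))"
    using A by simp
  also have "\<dots> \<le> (\<Sum>l\<in>{1..A}. 2 * (\<rho> (x [^] (m + l)) + \<rho> (x [^] l)))"
  proof (rule sum_mono)
    fix l :: int
    have "x [^] m = x [^] (m + l) \<otimes> inv (x [^] l)"
      using x by (simp add: int_pow_mult m_assoc)
    then show "\<rho> (x [^] m) \<le> 2 * (\<rho> (x [^] (m + l)) + \<rho> (x [^] l))"
      using mult[of "x [^] (m + l)" "inv (x [^] l)"] inv[of "x [^] l"] x by simp
  qed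
  also have "\<dots> = 2 * (\<Sum>l\<in>{1..A}. \<rho> (x [^] (m + l))) + 2 * (\<Sum>l\<in>{1..A}. \<rho> (x [^] l))"
    by (simp add: sum.distrib sum_distrib_left)
  also have "(\<Sum>l\<in>{1..A}. \<rho> (x [^] l)) \<le> T"
    unfolding T_def by (intro sum_mono2) (use A nn in auto)
  also have "(\<Sum>l\<in>{1..A}. \<rho> (x [^] (m + l))) = (\<Sum>j\<in>(\<lambda>l. m + l) ` {1..A}. \<rho> (x [^] j))"
    by (subst sum.reindex) auto
  also have "\<dots> \<le> T"
    unfolding T_def by (intro sum_mono2) (use A mA nn in auto)
  finally have 1: "real_of_int A * \<rho> (x [^] m) \<le> 4 * T" by simp
  have "T \<le> (\<Sum>j\<in>{-2*A..2*A}. (3 * real_of_int A) powr (a + 1) * (power_weight (ereal a) j * \<rho> (x [^] j)))"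
    unfolding T_def
  proof (rule sum_mono)
    fix j assume j: "j \<in> {-2*A..2*A}"
    have "(3 * real_of_int A) powr (a + 1) * (1 + \<bar>real_of_int j\<bar>) powr (- a - 1)
        \<ge> (3 * real_of_int A) powr (a + 1) * (3 * real_of_int A) powr (- a - 1)"
      using j A a by (intro mult_left_mono powr_mono2') auto
    moreover have "(3 * real_of_int A) powr (a + 1) * (3 * real_of_int A) powr (- a - 1) = 1"
      using A by (simp flip: powr_add)
    ultimately have "1 \<le> (3 * real_of_int A) powr (a + 1) * power_weight (ereal a) j"
      by (simp add: power_weight_def)
    then have "1 * \<rho> (x [^] j) \<le> (3 * real_of_int A) powr (a + 1) * power_weight (ereal a) j * \<rho> (x [^] j)"
      by (rule mult_right_mono) (rule nn)
    then show "\<rho> (x [^] j) \<le> (3 * real_of_int A) powr (a + 1) * (power_weight (ereal a) j * \<rho> (x [^] j))"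
      by (simp add: mult.assoc)
  qed
  also have "\<dots> \<le> (3 * real_of_int A) powr (a + 1) * W"
    unfolding sum_distrib_left[symmetric] by (intro mult_left_mono W) auto
  also have "(3 * real_of_int A) powr (a + 1) = real_of_int A * (3 powr (a + 1) * real_of_int A powr a)"
    using A by (simp add: powr_mult powr_add)
  finally have "real_of_int A * \<rho> (x [^] m) \<le> real_of_int A * (4 * 3 powr (a + 1) * real_of_int A powr a * W)"
    using 1 by (simp add: mult_ac)
  then have "\<rho> (x [^] m) \<le> 4 * 3 powr (a + 1) * real_of_int A powr a * W"
    using A by simp
  also have "\<dots> \<le> 4 * 3 powr (a + 1) * R * W"
  proof (intro mult_right_mono mult_left_mono)
    have "real_of_int A powr a \<le> (R powr (1 / a)) powr a"
      using A a by (intro powr_mono2) (auto simp: A_def)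
    then show "real_of_int A powr a \<le> R" using R a by (simp add: powr_powr)
    show "W \<ge> 0" using W[of "{}"] by simp
  qed auto
  finally show ?thesis .
qed

abbreviation (in group) power_mean :: "ereal \<Rightarrow> 'a \<Rightarrow> ('a \<Rightarrow> real) \<Rightarrow> real" where
  "power_mean \<alpha> x f \<equiv> \<Sum>\<^sub>\<infinity>m\<in>UNIV. power_weight \<alpha> m * f (x [^] (m::int))"

text \<open>The sum over pairs \<open>(g, m)\<close> with \<open>g = x [^] m\<close> is evaluated in both orders.\<close>

lemma (in group) power_sum_expectation:
  fixes f :: "'a \<Rightarrow> real"
  assumes "x \<in> carrier G" "\<alpha> > 0" and f: "\<And>g. g \<in> carrier G \<Longrightarrow> 0 \<le> f g \<and> f g \<le> B"
  shows "((\<lambda>m. power_weight \<alpha> m * f (x [^] m)) has_sum (power_mean \<alpha> x f)) UNIV"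
    and "((\<lambda>g. (\<Sum>\<^sub>\<infinity>m\<in>UNIV. power_weight \<alpha> m * of_bool (g = x [^] (m::int))) * f g) has_sum
      (power_mean \<alpha> x f)) (carrier G)"
proof -
  let ?w = "power_weight \<alpha>" and ?S = "power_mean \<alpha> x f"
  have "(\<lambda>m. ?w m * f (x [^] m)) summable_on UNIV"
  proof (rule summable_on_comparison_test)
    show "(\<lambda>m. ?w m * B) summable_on UNIV"
      by (intro summable_on_cmult_left power_weight_summable assms)
    show "?w m * f (x [^] m) \<le> ?w m * B" "0 \<le> ?w m * f (x [^] m)" for m
      using f[of "x [^] m"] assms(1) power_weight_nonneg[of \<alpha> m] by (auto intro: mult_left_mono)
  qed
  then show hs: "((\<lambda>m. ?w m * f (x [^] m)) has_sum ?S) UNIV"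
    by (rule has_sum_infsum)
  let ?F = "\<lambda>(g, m). ?w m * of_bool (g = x [^] (m::int)) * f g"
  let ?T = "range (\<lambda>m::int. (x [^] m, m))"
  have "(?F has_sum ?S) ?T"
    using hs by (subst has_sum_reindex) (auto simp: inj_on_def o_def)
  then have tot: "(?F has_sum ?S) (carrier G \<times> UNIV)"
    by (rule has_sum_cong_neutral[THEN iffD1, rotated -1]) (use assms(1) in auto)
  have row: "((\<lambda>m. ?F (g, m)) has_sum (\<Sum>\<^sub>\<infinity>m\<in>UNIV. ?w m * of_bool (g = x [^] m)) * f g) UNIV" for g
  proof -
    have "(\<lambda>m. ?w m * of_bool (g = x [^] m)) summable_on UNIV"
      by (rule summable_on_comparison_test[OF power_weight_summable[OF assms(2)]]) (auto simp: power_weight_nonneg)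
    from has_sum_cmult_left[OF has_sum_infsum[OF this], of "f g"] show ?thesis by simp
  qed
  show "((\<lambda>g. (\<Sum>\<^sub>\<infinity>m\<in>UNIV. ?w m * of_bool (g = x [^] (m::int))) * f g) has_sum ?S) (carrier G)"
    using has_sum_SigmaD[OF tot row] by simp
qed

lemma (in group) walk_measure_expectation:
  fixes f :: "'a \<Rightarrow> real"
  assumes "\<And>i. i \<in> {1..k} \<Longrightarrow> s i \<in> carrier G" "\<And>i. i \<in> {1..k} \<Longrightarrow> \<alpha> i > 0"
    and f: "\<And>g. g \<in> carrier G \<Longrightarrow> 0 \<le> f g \<and> f g \<le> B"
  shows "((\<lambda>g. walk_measure G k s \<alpha> g * f g) has_sum
    (1 / real k * (\<Sum>i=1..k. power_const (\<alpha> i) * (power_mean (\<alpha> i) (s i) f)))) (carrier G)"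
proof -
  have "((\<lambda>g. 1 / real k * (\<Sum>i=1..k. power_const (\<alpha> i) *
      ((\<Sum>\<^sub>\<infinity>m\<in>UNIV. power_weight (\<alpha> i) m * of_bool (g = s i [^] (m::int))) * f g))) has_sum
    (1 / real k * (\<Sum>i=1..k. power_const (\<alpha> i) * (power_mean (\<alpha> i) (s i) f)))) (carrier G)"
    by (intro has_sum_cmult_right has_sum_finite_sum power_sum_expectation(2)[OF _ _ f] assms) auto
  then show ?thesis
    by (rule has_sum_cong[THEN iffD1, rotated]) (simp add: walk_measure_def sum_distrib_right mult.assoc)
qed

lemma power_weight_minus: "power_weight \<alpha> (- m) = power_weight \<alpha> m"
  by (auto simp: power_weight_def)

lemma (in group) walk_measure_inv:
  assumes "\<And>i. i \<in> {1..k} \<Longrightarrow> s i \<in> carrier G" "x \<in> carrier G"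
  shows "walk_measure G k s \<alpha> (inv x) = walk_measure G k s \<alpha> x"
proof -
  have "(\<Sum>\<^sub>\<infinity>m\<in>UNIV. power_weight (\<alpha> i) m * of_bool (inv x = s i [^] (m::int))) =
      (\<Sum>\<^sub>\<infinity>m\<in>UNIV. power_weight (\<alpha> i) m * of_bool (x = s i [^] (m::int)))" if i: "i \<in> {1..k}" for i
  proof (rule infsum_reindex_bij_witness[of _ uminus uminus])
    fix m :: int
    have "inv x = s i [^] m \<longleftrightarrow> x = s i [^] (- m)"
      using assms(1)[OF i] assms(2) by (metis int_pow_neg inv_inv int_pow_closed)
    then show "power_weight (\<alpha> i) (- m) * of_bool (x = s i [^] (- m)) = power_weight (\<alpha> i) m * of_bool (inv x = s i [^] m)"
      by (simp add: power_weight_minus)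
  qed auto
  then have "(\<Sum>i=1..k. power_const (\<alpha> i) * (\<Sum>\<^sub>\<infinity>m\<in>UNIV. power_weight (\<alpha> i) m * of_bool (inv x = s i [^] (m::int)))) =
      (\<Sum>i=1..k. power_const (\<alpha> i) * (\<Sum>\<^sub>\<infinity>m\<in>UNIV. power_weight (\<alpha> i) m * of_bool (x = s i [^] (m::int))))"
    by (intro sum.cong refl) metis
  then show ?thesis
    unfolding walk_measure_def by (rule arg_cong)
qed

lemma power_const_pos: "\<alpha> > 0 \<Longrightarrow> power_const \<alpha> > 0"
  using power_weight_infsum_pos by (simp add: power_const_def)

text \<open>The strict inequality for \<open>\<alpha> i \<ge> 2\<close> removes the logarithm that weight \<open>1 / 2\<close> would produce for \<open>\<alpha> i = 2\<close>.\<close>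

locale power_walk = heavy_generators G "{1..k}" s w "{i \<in> {1..k}. \<alpha> i < 2}"
  for G (structure) and k :: nat and s :: "nat \<Rightarrow> 'a" and w :: "nat \<Rightarrow> real" and \<alpha> :: "nat \<Rightarrow> ereal" +
  assumes k_pos: "k \<ge> 1"
    and alpha_pos: "i \<in> {1..k} \<Longrightarrow> \<alpha> i > 0"
    and heavy_w: "i \<in> {1..k} \<Longrightarrow> \<alpha> i < 2 \<Longrightarrow> w i = 1 / real_of_ereal (\<alpha> i)"
    and light_w: "i \<in> {1..k} \<Longrightarrow> \<alpha> i \<ge> 2 \<Longrightarrow> w i > 1 / 2"
begin

abbreviation \<mu> :: "'a \<Rightarrow> real" where "\<mu> \<equiv> walk_measure G k s \<alpha>"

lemma mu_nonneg: "\<mu> g \<ge> 0"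
  by (rule walk_measure_nonneg)

lemma expectation:
  assumes "\<And>g. g \<in> carrier G \<Longrightarrow> 0 \<le> f g \<and> f g \<le> B"
  shows "((\<lambda>g. \<mu> g * f g) has_sum
    (1 / real k * (\<Sum>i=1..k. power_const (\<alpha> i) * (power_mean (\<alpha> i) (s i) f)))) (carrier G)"
  by (rule walk_measure_expectation[OF s_carrier alpha_pos assms])

lemma power_expectation_le:
  assumes f: "\<And>g. g \<in> carrier G \<Longrightarrow> 0 \<le> f g \<and> f g \<le> B"
    and E: "((\<lambda>g. \<mu> g * f g) has_sum E) (carrier G)"
    and i: "i \<in> {1..k}" and L: "finite L"
  shows "(\<Sum>m\<in>L. power_weight (\<alpha> i) m * f (s i [^] (m::int))) \<le> real k / power_const (\<alpha> i) * E"
proof -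
  let ?T = "\<lambda>i. power_mean (\<alpha> i) (s i) f"
  have nn: "power_weight (\<alpha> j) m * f (s j [^] m) \<ge> 0" if "j \<in> {1..k}" for j and m :: int
    using f[of "s j [^] m"] s_carrier[OF that] power_weight_nonneg by simp
  have c: "power_const (\<alpha> j) > 0" if "j \<in> {1..k}" for j
    using power_const_pos alpha_pos that by blast
  have Teq: "1 / real k * (\<Sum>j=1..k. power_const (\<alpha> j) * ?T j) = E"
    by (rule has_sum_unique[OF expectation[OF f] E])
  have "(\<Sum>m\<in>L. power_weight (\<alpha> i) m * f (s i [^] m)) \<le> ?T i"
    by (rule finite_sum_le_infsum)
       (use L nn[OF i] has_sum_imp_summable[OF power_sum_expectation(1)[OF s_carrier[OF i] alpha_pos[OF i] f]] in auto)
  moreover have "power_const (\<alpha> i) * ?T i \<le> (\<Sum>j=1..k. power_const (\<alpha> j) * ?T j)"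
    by (rule member_le_sum[OF i]) (auto intro!: mult_nonneg_nonneg infsum_nonneg nn less_imp_le[OF c])
  then have "power_const (\<alpha> i) * ?T i \<le> real k * E"
    using Teq k_pos by (simp add: field_simps)
  then have "?T i \<le> real k / power_const (\<alpha> i) * E"
    using c[OF i] by (simp add: field_simps)
  ultimately show ?thesis by linarith
qed

sublocale symmetric_walk G \<mu>
proof
  have "(\<mu> has_sum 1) (carrier G)"
    by (rule walk_measure_has_sum_1[OF is_group k_pos]) (rule s_carrier alpha_pos; assumption)+
  then show "density G \<mu>"
    unfolding density_def using mu_nonneg by blast
  show "\<mu> (inv x) = \<mu> x" if "x \<in> carrier G" for x
    by (rule walk_measure_inv[OF s_carrier that])
  have one: "((\<lambda>g. \<mu> g * of_bool (g = \<one>)) has_sum \<mu> \<one>) (carrier G)"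
    by (rule has_sum_indicator) auto
  have 1: "1 \<in> {1..k}" using k_pos by auto
  have "(\<Sum>m\<in>{0}. power_weight (\<alpha> 1) m * of_bool (s 1 [^] (m::int) = \<one>)) \<le> real k / power_const (\<alpha> 1) * \<mu> \<one>"
    by (rule power_expectation_le[where B = 1, OF _ one 1]) auto
  moreover have "power_weight (\<alpha> 1) 0 = 1"
    by (simp add: power_weight_def)
  ultimately have "0 < real k / power_const (\<alpha> 1) * \<mu> \<one>"
    by (simp del: One_nat_def)
  then show "\<mu> \<one> > 0"
    using mu_nonneg[of \<one>] by (metis less_eq_real_def mult_zero_right)
qed

text \<open>The mean \<open>E\<close> of the defect dominates a multiple of its weighted sum along the powers of each generator.
  A single step is one of its terms; for powers up to \<open>R powr w i\<close> the one-dimensional estimate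
  costs the factor \<open>R\<close>.\<close>

lemma generator_defect_le:
  obtains K :: real where "K > 0"
    and "\<And>n E i. ((\<lambda>g. \<mu> g * defect n g) has_sum E) (carrier G) \<Longrightarrow> i \<in> {1..k} \<Longrightarrow> defect n (s i) \<le> K * E"
    and "\<And>n E i R m. ((\<lambda>g. \<mu> g * defect n g) has_sum E) (carrier G) \<Longrightarrow> i \<in> {1..k} \<Longrightarrow> \<alpha> i < 2 \<Longrightarrow> R \<ge> 1 \<Longrightarrow>
        \<bar>real_of_int m\<bar> \<le> R powr w i \<Longrightarrow> defect n (s i [^] m) \<le> K * (R * E)"
proof -
  define K1 where "K1 i = real k / power_const (\<alpha> i) / power_weight (\<alpha> i) 1" for i
  define K2 where "K2 i = 4 * 3 powr (real_of_ereal (\<alpha> i) + 1) * (real k / power_const (\<alpha> i))" for i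
  define K where "K = 1 + (\<Sum>i=1..k. K1 i + K2 i)"
  have c: "power_const (\<alpha> i) > 0" if "i \<in> {1..k}" for i
    using power_const_pos alpha_pos that by blast
  have w1: "power_weight \<beta> 1 > 0" for \<beta>
    by (simp add: power_weight_def)
  have K1: "K1 i \<ge> 0" and K2: "K2 i \<ge> 0" if "i \<in> {1..k}" for i
    using c[OF that] w1[of "\<alpha> i"] by (auto simp: K1_def K2_def)
  have le: "K1 i \<le> K \<and> K2 i \<le> K" if i: "i \<in> {1..k}" for i
  proof -
    have "K1 i + K2 i \<le> (\<Sum>i=1..k. K1 i + K2 i)"
      by (rule member_le_sum[OF i]) (use K1 K2 in \<open>auto intro!: add_nonneg_nonneg\<close>)
    then show ?thesis using K1[OF i] K2[OF i] by (simp add: K_def)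
  qed
  have "K > 0"
    unfolding K_def using K1 K2 by (intro add_pos_nonneg sum_nonneg add_nonneg_nonneg) auto
  have bd: "0 \<le> defect n g \<and> defect n g \<le> p (2 * n) \<one>" if "g \<in> carrier G" for n g
    using defect_nonneg[OF that] p_nonneg by (simp add: defect_def)
  have E0: "E \<ge> 0" if "((\<lambda>g. \<mu> g * defect n g) has_sum E) (carrier G)" for n E
    by (rule has_sum_nonneg[OF that]) (intro mult_nonneg_nonneg mu_nonneg defect_nonneg)
  show ?thesis
  proof (rule that[OF \<open>K > 0\<close>])
    fix n E i assume E: "((\<lambda>g. \<mu> g * defect n g) has_sum E) (carrier G)" and i: "i \<in> {1..k}"
    have "(\<Sum>m\<in>{1}. power_weight (\<alpha> i) m * defect n (s i [^] (m::int))) \<le> real k / power_const (\<alpha> i) * E"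
      by (rule power_expectation_le[OF bd E i]) auto
    then have "defect n (s i) \<le> real k / power_const (\<alpha> i) * E / power_weight (\<alpha> i) 1"
      using s_carrier[OF i] w1[of "\<alpha> i"] by (subst pos_le_divide_eq) (auto simp: mult.commute)
    then have "defect n (s i) \<le> K1 i * E"
      by (simp add: K1_def)
    also have "\<dots> \<le> K * E" using le[OF i] E0[OF E] by (intro mult_right_mono) auto
    finally show "defect n (s i) \<le> K * E" .
  next
    fix n E i R m assume E: "((\<lambda>g. \<mu> g * defect n g) has_sum E) (carrier G)" and i: "i \<in> {1..k}"
      and a2: "\<alpha> i < 2" and R: "R \<ge> 1" and m: "\<bar>real_of_int m\<bar> \<le> R powr w i"
    define a where "a = real_of_ereal (\<alpha> i)"
    have a: "\<alpha> i = ereal a" "a > 0" using a2 alpha_pos[OF i] by (cases "\<alpha> i"; auto simp: a_def)+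
    have "defect n (s i [^] m) \<le> 4 * 3 powr (a + 1) * R * (real k / power_const (\<alpha> i) * E)"
    proof (rule power_defect_le[where \<rho> = "defect n", OF s_carrier[OF i] a(2) R defect_nonneg defect_inv defect_mult])
      show "(\<Sum>j\<in>L. power_weight (ereal a) j * defect n (s i [^] j)) \<le> real k / power_const (\<alpha> i) * E"
        if "finite L" for L
        using power_expectation_le[OF bd E i that] by (simp add: a)
      show "\<bar>real_of_int m\<bar> \<le> R powr (1 / a)"
        using m heavy_w[OF i a2] by (simp add: a_def)
    qed
    also have "\<dots> = K2 i * (R * E)" by (simp add: K2_def a_def)
    also have "\<dots> \<le> K * (R * E)" using le[OF i] E0[OF E] R by (intro mult_right_mono) auto
    finally show "defect n (s i [^] m) \<le> K * (R * E)" .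
  qed
qed

text \<open>Divided by a multiple of \<open>r * E\<close>, where \<open>E\<close> is its mean, the defect is adapted to the scale \<open>r\<close>. So
  there are \<open>r powr D\<close> elements \<open>g\<close> at which \<open>p (2 * n) g\<close> differs from \<open>p (2 * n) \<one>\<close> by at most a multiple
  of \<open>r * E\<close>, while these values of \<open>p (2 * n)\<close> add up to at most \<open>1\<close>.\<close>

lemma return_profile:
  assumes growth: "growth_ge D"
  shows "\<exists>C>0. \<forall>n. \<forall>r\<ge>1. p (2 * n) \<one> \<le> r powr - D + C * r * (p (2 * n) \<one> - p (2 * Suc n) \<one>)"
proof -
  obtain C0 where C0: "C0 \<ge> 0" and gr: "\<And>R \<rho>. R \<ge> 1 \<Longrightarrow> adapted R \<rho> \<Longrightarrow> (\<exists>F\<subseteq>carrier G. finite F \<and>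
        R powr D \<le> real (card F) \<and> (\<forall>g\<in>F. \<rho> g \<le> C0))"
    using growth unfolding growth_ge_def by blast
  obtain K where K: "K > 0"
    and K1: "\<And>n E i. ((\<lambda>g. \<mu> g * defect n g) has_sum E) (carrier G) \<Longrightarrow> i \<in> {1..k} \<Longrightarrow> defect n (s i) \<le> K * E"
    and K2: "\<And>n E i R m. ((\<lambda>g. \<mu> g * defect n g) has_sum E) (carrier G) \<Longrightarrow> i \<in> {1..k} \<Longrightarrow> \<alpha> i < 2 \<Longrightarrow> R \<ge> 1 \<Longrightarrow>
        \<bar>real_of_int m\<bar> \<le> R powr w i \<Longrightarrow> defect n (s i [^] m) \<le> K * (R * E)"
    using generator_defect_le by blast
  define C where "C = (C0 + 1) * K / \<mu> \<one>"
  have main: "p (2 * n) \<one> \<le> r powr - D + C * r * (p (2 * n) \<one> - p (2 * Suc n) \<one>)"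
    if r: "r \<ge> 1" for n r
  proof -
    define E where "E = p (2 * n) \<one> - p (1 + 2 * n) \<one>"
    have E: "((\<lambda>g. \<mu> g * defect n g) has_sum E) (carrier G)"
      unfolding E_def
      by (rule has_sum_cong[THEN iffD1, OF _ defect_expectation]) (use p_1 in auto)
    have E0: "E \<ge> 0" using p_even_le[of 1 n] by (simp add: E_def)
    \<comment> \<open>The mean \<open>E\<close> may vanish, so \<open>\<delta>\<close> keeps the divisor positive.\<close>
    have le: "p (2 * n) \<one> \<le> r powr - D + (C0 + 1) * K * r * (E + \<delta>)" if \<delta>: "\<delta> > 0" for \<delta>
    proof -
      define Z where "Z = K * r * (E + \<delta>)"
      have Z: "Z > 0" using K r E0 \<delta> by (simp add: Z_def)
      have rKE: "K * E \<le> Z" "K * (r * E) \<le> Z"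
        using K r E0 \<delta> mult_mono[of 1 r E "E + \<delta>"] by (auto simp: Z_def mult.assoc)
      have "adapted r (\<lambda>g. defect n g / Z)"
        unfolding adapted_def
      proof (intro conjI ballI allI impI)
        fix g h assume "g \<in> carrier G" "h \<in> carrier G"
        then show "defect n (g \<otimes> h) / Z \<le> 2 * (defect n g / Z + defect n h / Z)"
          using defect_mult[of g h n] Z by (simp add: field_simps)
      next
        fix i assume "i \<in> {1..k}"
        then show "defect n (s i) / Z \<le> 1"
          using K1[OF E, of i] rKE Z by simp
      next
        fix i m assume "i \<in> {i \<in> {1..k}. \<alpha> i < 2}" "\<bar>real_of_int m\<bar> \<le> r powr w i"
        then show "defect n (s i [^] m) / Z \<le> 1"
          using K2[OF E _ _ r, of i m] rKE Z by simp
      qed (use defect_nonneg defect_inv Z in auto)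
      then obtain F where F: "F \<subseteq> carrier G" "finite F" "r powr D \<le> real (card F)" "\<forall>g\<in>F. defect n g / Z \<le> C0"
        using gr[OF r] by blast
      have rD: "r powr D > 0" using r by simp
      have N: "real (card F) > 0" using F(3) rD by linarith
      have "(\<Sum>g\<in>F. p (2 * n) g) \<le> infsum (p (2 * n)) (carrier G)"
        by (rule finite_sum_le_infsum) (use F density_p p_nonneg in \<open>auto simp: density_def summable_on_def\<close>)
      also have "\<dots> = 1" using density_p by (intro infsumI) (simp add: density_def)
      finally have "(\<Sum>g\<in>F. p (2 * n) g) \<le> 1" .
      moreover have "(\<Sum>g\<in>F. p (2 * n) \<one> - C0 * Z) \<le> (\<Sum>g\<in>F. p (2 * n) g)"
        using F(4) Z by (intro sum_mono) (auto simp: defect_def field_simps)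
      ultimately have "real (card F) * (p (2 * n) \<one> - C0 * Z) \<le> 1" by simp
      then have "p (2 * n) \<one> - C0 * Z \<le> 1 / real (card F)"
        using N by (simp add: field_simps)
      also have "\<dots> \<le> 1 / r powr D" using F(3) rD by (intro divide_left_mono mult_pos_pos N) auto
      finally have "p (2 * n) \<one> \<le> r powr - D + C0 * Z" by (simp add: powr_minus divide_inverse)
      also have "C0 * Z \<le> (C0 + 1) * Z" using Z by simp
      finally show ?thesis by (simp add: Z_def mult.assoc)
    qed
    have "p (2 * n) \<one> \<le> r powr - D + (C0 + 1) * K * r * E"
    proof (rule field_le_epsilon)
      fix e :: real assume e: "e > 0"
      have pos: "(C0 + 1) * K * r > 0" using C0 K r by simp
      have split: "X * (E + e / X) = X * E + e" if "X > 0" for X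
        using that by (simp add: distrib_left)
      show "p (2 * n) \<one> \<le> r powr - D + (C0 + 1) * K * r * E + e"
        using le[of "e / ((C0 + 1) * K * r)"] e pos split[OF pos] by simp
    qed
    also have "(C0 + 1) * K * r * E \<le> (C0 + 1) * K * r * ((p (2 * n) \<one> - p (2 * Suc n) \<one>) / \<mu> \<one>)"
      using C0 K r by (intro mult_left_mono defect_mean_le[OF E]) auto
    finally show ?thesis by (simp add: C_def)
  qed
  have "C > 0" using C0 K mu_one by (simp add: C_def)
  then show ?thesis using main by blast
qed

lemma return_upper_bound:
  assumes D: "D \<ge> 0" and growth: "growth_ge D"
  shows "\<exists>C>0. \<forall>n\<ge>2. p n \<one> \<le> C * real n powr - D"
proof -
  obtain C where C: "C > 0" "\<And>n r. r \<ge> 1 \<Longrightarrow> p (2 * n) \<one> \<le> r powr - D + C * r * (p (2 * n) \<one> - p (2 * Suc n) \<one>)"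
    using return_profile[OF growth] by blast
  have decr: "p (2 * Suc n) \<one> \<le> p (2 * n) \<one>" for n
    using p_even_le[of 2 n] by simp
  obtain B where B: "B > 0" "\<And>n. n \<ge> 1 \<Longrightarrow> p (2 * n) \<one> \<le> B * real n powr - D"
    using powr_decay_of_spectral_profile[of "\<lambda>n. p (2 * n) \<one>", OF p_nonneg decr p_convex D C] by blast
  have "p n \<one> \<le> B * 3 powr D * real n powr - D" if n: "n \<ge> 2" for n
  proof -
    define m where "m = n div 2"
    have "m \<ge> 1" "n \<le> 3 * m" using n unfolding m_def by presburger+
    then have m: "m \<ge> 1" "real n \<le> 3 * real m" by linarith+
    have "p n \<one> \<le> p (2 * m) \<one>"
      using p_even_le[of "n mod 2" m] by (simp add: m_def)
    also have "\<dots> \<le> B * real m powr - D" by (rule B(2)[OF m(1)])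
    also have "\<dots> \<le> B * (real n / 3) powr - D"
      using m n D B(1) by (intro mult_left_mono powr_mono2') auto
    also have "(real n / 3) powr - D = 3 powr D * real n powr - D"
    proof -
      have "(3::real) powr D * 3 powr - D = 1" by (simp flip: powr_add)
      then have "(real n / 3) powr - D = 3 powr D * (3 powr - D * (real n / 3) powr - D)"
        by (simp flip: mult.assoc)
      also have "3 powr - D * (real n / 3) powr - D = (3 * (real n / 3)) powr - D"
        by (rule powr_mult[symmetric])
      finally show ?thesis by simp
    qed
    finally show ?thesis by (simp only: mult.assoc)
  qed
  then show ?thesis using B(1) by (intro exI[of _ "B * 3 powr D"]) auto
qed

end

context power_walk begin

text \<open>On the union of \<open>U\<close> and its translate, which has at most \<open>2 * card U\<close> elements, the correlation is the sum of
  squares minus half the sum of the squared increments.\<close>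

lemma sum_correlation_ge:
  fixes \<psi> :: "'a \<Rightarrow> real"
  assumes U: "finite U" "U \<subseteq> carrier G" "\<And>x. x \<in> carrier G - U \<Longrightarrow> \<psi> x = 0"
    and t: "t \<in> carrier G" and \<delta>: "\<And>x. x \<in> carrier G \<Longrightarrow> \<bar>\<psi> x - \<psi> (x \<otimes> t)\<bar> \<le> \<delta>"
  shows "(\<Sum>x\<in>U. \<psi> x * \<psi> (x \<otimes> t)) \<ge> (\<Sum>x\<in>U. (\<psi> x)\<^sup>2) - real (card U) * \<delta>\<^sup>2"
proof -
  define V where "V = (\<lambda>x. x \<otimes> inv t) ` U"
  define W where "W = U \<union> V"
  have W: "finite W" "W \<subseteq> carrier G" "U \<subseteq> W" using U t by (auto simp: W_def V_def)
  have cW: "card W \<le> 2 * card U"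
    using card_Un_le[of U V] card_image_le[OF U(1), of "\<lambda>x. x \<otimes> inv t"] by (simp add: W_def V_def)
  have 1: "(\<Sum>x\<in>U. \<psi> x * \<psi> (x \<otimes> t)) = (\<Sum>x\<in>W. \<psi> x * \<psi> (x \<otimes> t))"
    by (rule sum.mono_neutral_left) (use W U in auto)
  have 2: "(\<Sum>x\<in>U. (\<psi> x)\<^sup>2) = (\<Sum>x\<in>W. (\<psi> x)\<^sup>2)"
    by (rule sum.mono_neutral_left) (use W U in auto)
  have inj: "inj_on (\<lambda>x. x \<otimes> t) W"
    using W(2) t by (intro inj_onI) (metis right_cancel subsetD)
  have "(\<Sum>x\<in>W. (\<psi> (x \<otimes> t))\<^sup>2) = (\<Sum>y\<in>(\<lambda>x. x \<otimes> t) ` W. (\<psi> y)\<^sup>2)"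
    by (simp add: sum.reindex[OF inj])
  also have "\<dots> = (\<Sum>x\<in>U. (\<psi> x)\<^sup>2)"
  proof (rule sum.mono_neutral_right)
    show "U \<subseteq> (\<lambda>x. x \<otimes> t) ` W"
    proof
      fix x assume x: "x \<in> U"
      then have "x = (x \<otimes> inv t) \<otimes> t" using U t by (auto simp: m_assoc)
      then show "x \<in> (\<lambda>x. x \<otimes> t) ` W" using x by (auto simp: W_def V_def)
    qed
  qed (use W U t in auto)
  finally have 3: "(\<Sum>x\<in>W. (\<psi> (x \<otimes> t))\<^sup>2) = (\<Sum>x\<in>U. (\<psi> x)\<^sup>2)" .
  have "(\<Sum>x\<in>W. (\<psi> x - \<psi> (x \<otimes> t))\<^sup>2) \<le> (\<Sum>x\<in>W. \<delta>\<^sup>2)"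
  proof (rule sum_mono)
    fix x assume "x \<in> W"
    then have "\<bar>\<psi> x - \<psi> (x \<otimes> t)\<bar>\<^sup>2 \<le> \<delta>\<^sup>2" using \<delta> W by (intro power_mono) auto
    then show "(\<psi> x - \<psi> (x \<otimes> t))\<^sup>2 \<le> \<delta>\<^sup>2" by simp
  qed
  also have "\<dots> \<le> (2 * real (card U)) * \<delta>\<^sup>2"
    using cW by (simp add: mult_right_mono)
  finally have "(\<Sum>x\<in>W. (\<psi> x - \<psi> (x \<otimes> t))\<^sup>2) \<le> 2 * real (card U) * \<delta>\<^sup>2" .
  moreover have "(\<Sum>x\<in>W. (\<psi> x - \<psi> (x \<otimes> t))\<^sup>2) = (\<Sum>x\<in>W. (\<psi> x)\<^sup>2) + (\<Sum>x\<in>W. (\<psi> (x \<otimes> t))\<^sup>2) - 2 * (\<Sum>x\<in>W. \<psi> x * \<psi> (x \<otimes> t))"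
    by (simp add: power2_diff sum.distrib sum_subtractf sum_distrib_left mult.assoc)
  ultimately show ?thesis using 1 2 3 by simp
qed

text \<open>The subtracted terms are summed by \<open>power_weight_energy\<close>: each generator contributes at most
  of order \<open>V / R\<close>.\<close>

lemma expectation_ge:
  "\<exists>C\<ge>0. \<forall>R\<ge>1. \<forall>V\<ge>0. \<forall>f B S. (\<forall>g\<in>carrier G. 0 \<le> f g \<and> f g \<le> B) \<longrightarrow>
    (\<forall>i\<in>{1..k}. \<forall>m::int. f (s i [^] m) \<ge> S - V * capped_square R (w i) m) \<longrightarrow>
    (\<exists>E. ((\<lambda>g. \<mu> g * f g) has_sum E) (carrier G) \<and> E \<ge> S - V * C / R)"
proof -
  have "\<exists>C\<ge>0. \<forall>R\<ge>1. (\<Sum>\<^sub>\<infinity>m\<in>UNIV. power_weight (\<alpha> i) m * capped_square R (w i) m) \<le> C / R" if "i \<in> {1..k}" for i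
  proof (rule power_weight_energy[OF alpha_pos[OF that]])
    show "(\<alpha> i < 2 \<and> w i = 1 / real_of_ereal (\<alpha> i)) \<or> (\<alpha> i \<ge> 2 \<and> w i > 1 / 2)"
      using heavy_w[OF that] light_w[OF that] not_less by blast
  qed
  then obtain c where c: "\<And>i. i \<in> {1..k} \<Longrightarrow> c i \<ge> 0"
    "\<And>i R. i \<in> {1..k} \<Longrightarrow> R \<ge> 1 \<Longrightarrow> (\<Sum>\<^sub>\<infinity>m\<in>UNIV. power_weight (\<alpha> i) m * capped_square R (w i) m) \<le> c i / R"
    by metis
  have pc: "power_const (\<alpha> i) > 0" if "i \<in> {1..k}" for i
    using power_const_pos alpha_pos that by blast
  define C where "C = (\<Sum>i=1..k. power_const (\<alpha> i) * c i)"
  have C: "C \<ge> 0" unfolding C_def using c(1) pc by (intro sum_nonneg mult_nonneg_nonneg) (auto intro: less_imp_le)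
  show ?thesis
  proof (rule exI[of _ C], intro conjI allI impI C)
    fix f :: "'a \<Rightarrow> real" and B S V R :: real
    assume R: "R \<ge> 1" and V: "V \<ge> 0" and "\<forall>g\<in>carrier G. 0 \<le> f g \<and> f g \<le> B"
      and "\<forall>i\<in>{1..k}. \<forall>m::int. f (s i [^] m) \<ge> S - V * capped_square R (w i) m"
    then have f: "\<And>g. g \<in> carrier G \<Longrightarrow> 0 \<le> f g \<and> f g \<le> B"
      and low: "\<And>i m. i \<in> {1..k} \<Longrightarrow> f (s i [^] (m::int)) \<ge> S - V * capped_square R (w i) m"
      by blast+
    let ?T = "\<lambda>i. power_mean (\<alpha> i) (s i) f"
    have T: "power_const (\<alpha> i) * ?T i \<ge> S - V * (power_const (\<alpha> i) * c i) / R" if i: "i \<in> {1..k}" for i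
    proof -
      let ?w = "power_weight (\<alpha> i)" and ?q = "capped_square R (w i)"
      have "((\<lambda>m. ?w m * S - V * (?w m * ?q m)) has_sum ((\<Sum>\<^sub>\<infinity>m\<in>UNIV. ?w m) * S - V * (\<Sum>\<^sub>\<infinity>m\<in>UNIV. ?w m * ?q m))) UNIV"
        by (intro has_sum_real_diff has_sum_cmult_left has_sum_cmult_right has_sum_infsum power_weight_summable power_weight_truncated alpha_pos i)
      moreover have "((\<lambda>m. ?w m * f (s i [^] m)) has_sum ?T i) UNIV"
        by (rule power_sum_expectation(1)[OF s_carrier[OF i] alpha_pos[OF i] f])
      ultimately have "(\<Sum>\<^sub>\<infinity>m\<in>UNIV. ?w m) * S - V * (\<Sum>\<^sub>\<infinity>m\<in>UNIV. ?w m * ?q m) \<le> ?T i"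
      proof (rule has_sum_mono)
        fix m :: int
        show "?w m * S - V * (?w m * ?q m) \<le> ?w m * f (s i [^] m)"
          using mult_left_mono[OF low[OF i, of m] power_weight_nonneg[of "\<alpha> i" m]] by (simp add: algebra_simps)
      qed
      moreover have "V * (\<Sum>\<^sub>\<infinity>m\<in>UNIV. ?w m * ?q m) \<le> V * (c i / R)"
        by (intro mult_left_mono c(2) i R V)
      ultimately have "(\<Sum>\<^sub>\<infinity>m\<in>UNIV. ?w m) * S - V * (c i / R) \<le> ?T i" by linarith
      then have "power_const (\<alpha> i) * ((\<Sum>\<^sub>\<infinity>m\<in>UNIV. ?w m) * S - V * (c i / R)) \<le> power_const (\<alpha> i) * ?T i"
        using pc[OF i] by (intro mult_left_mono) auto
      moreover have "power_const (\<alpha> i) * (\<Sum>\<^sub>\<infinity>m\<in>UNIV. ?w m) = 1"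
        using power_weight_infsum_pos[OF alpha_pos[OF i]] by (simp add: power_const_def)
      then have "power_const (\<alpha> i) * ((\<Sum>\<^sub>\<infinity>m\<in>UNIV. ?w m) * S - V * (c i / R)) = S - V * (power_const (\<alpha> i) * c i) / R"
        by (simp add: right_diff_distrib flip: mult.assoc)
      ultimately show ?thesis by simp
    qed
    have "real k * S - V * C / R = (\<Sum>i=1..k. S - V * (power_const (\<alpha> i) * c i) / R)"
      by (simp add: sum_subtractf C_def sum_distrib_left sum_divide_distrib)
    also have "\<dots> \<le> (\<Sum>i=1..k. power_const (\<alpha> i) * ?T i)"
      by (rule sum_mono) (rule T)
    finally have "1 / real k * (real k * S - V * C / R) \<le> 1 / real k * (\<Sum>i=1..k. power_const (\<alpha> i) * ?T i)"
      by (rule mult_left_mono) auto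
    moreover have "1 / real k * (real k * S - V * C / R) \<ge> S - V * C / R"
    proof -
      have "V * C / R / real k \<le> V * C / R / 1"
        using V C R k_pos by (intro divide_left_mono) auto
      moreover have "1 / real k * (real k * S - V * C / R) = S - V * C / R / real k"
        using k_pos by (simp add: right_diff_distrib)
      ultimately show ?thesis by simp
    qed
    ultimately have "S - V * C / R \<le> 1 / real k * (\<Sum>i=1..k. power_const (\<alpha> i) * ?T i)" by linarith
    then show "\<exists>E. ((\<lambda>g. \<mu> g * f g) has_sum E) (carrier G) \<and> E \<ge> S - V * C / R"
      by (intro exI[of _ "1 / real k * (\<Sum>i=1..k. power_const (\<alpha> i) * ?T i)"] conjI expectation[OF f])
  qed
qed

text \<open>The test function is a tent of the weighted word length at scale \<open>R\<close>, proportional to the time.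
  Translation by \<open>s i [^] m\<close> changes it by at most \<open>\<bar>m\<bar> * R powr - w i\<close> and by at most \<open>1\<close>, which makes its Rayleigh
  quotient of order \<open>1 / R\<close>. The two counts show that its support and the set where it is at least
  \<open>1 / 2\<close> both have size of order \<open>R powr D\<close>.\<close>

lemma return_lower_bound:
  assumes D: "D \<ge> 0"
    and balls: "growth_le D"
    and growth: "growth_ge D"
  shows "\<exists>c>0. \<forall>n\<ge>2. c * real n powr - D \<le> p n \<one>"
proof -
  obtain C0 where C0: "C0 \<ge> 0" and gr: "\<And>R \<rho>. R \<ge> 1 \<Longrightarrow> adapted R \<rho> \<Longrightarrow> (\<exists>F\<subseteq>carrier G. finite F \<and>
        R powr D \<le> real (card F) \<and> (\<forall>g\<in>F. \<rho> g \<le> C0))"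
    using growth unfolding growth_ge_def by blast
  define K where "K = 2 * C0 + 1"
  have K: "K \<ge> 1" using C0 by (simp add: K_def)
  obtain C1' where C1': "C1' \<ge> 0" "\<And>R. R \<ge> 1 \<Longrightarrow> finite {g. cost_le alphabet R K g}"
     "\<And>R. R \<ge> 1 \<Longrightarrow> real (card {g. cost_le alphabet R K g}) \<le> C1' * R powr D"
    using balls[unfolded growth_le_def, rule_format, of K] K by auto
  define C1 where "C1 = C1' + 1"
  have C1: "C1 > 0" using C1' by (simp add: C1_def)
  obtain C2 where C2: "C2 \<ge> 0" and ex: "\<forall>R\<ge>1. \<forall>V\<ge>0. \<forall>f B S. (\<forall>g\<in>carrier G. 0 \<le> f g \<and> f g \<le> B) \<longrightarrow>
      (\<forall>i\<in>{1..k}. \<forall>m::int. f (s i [^] m) \<ge> S - V * capped_square R (w i) m) \<longrightarrow>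
      (\<exists>E. ((\<lambda>g. \<mu> g * f g) has_sum E) (carrier G) \<and> E \<ge> S - V * C2 / R)"
    using expectation_ge by (elim exE conjE)
  define C3 where "C3 = 4 * C1 * C2 + 1"
  have C3: "C3 \<ge> 1" using C1 C2 by (simp add: C3_def)
  have dyadic: "1 / (2 * C1 * (2 * C3) powr D) * (2 * 2 ^ j) powr - D \<le> p (2 * 2 ^ j) \<one>" for j
  proof -
    define M :: nat where "M = 2 * 2 ^ j"
    have "1 \<le> 2 * (2::real) ^ j" using one_le_power[of "2::real" j] by linarith
    then have M: "real M \<ge> 1" by (simp add: M_def)
    \<comment> \<open>With this scale the Rayleigh quotient is at most \<open>1 / (2 * M)\<close>, and \<open>(1 - 1 / (2 * M)) ^ M \<ge> 1 / 2\<close>.\<close>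
    define R where "R = 2 * C3 * real M"
    have "1 * 1 \<le> C3 * real M" using C3 M by (intro mult_mono) auto
    then have R: "R \<ge> 1" by (simp add: R_def)
    define U where "U = {g \<in> carrier G. word_length R g < K}"
    define \<psi> where "\<psi> g = max 0 (1 - word_length R g / K)" for g
    have Usub: "U \<subseteq> {g. cost_le alphabet R K g}"
      using word_length_less_cost_le by (auto simp: U_def)
    have U: "finite U" "U \<subseteq> carrier G"
      using finite_subset[OF Usub C1'(2)[OF R]] by (auto simp: U_def)
    have "real (card U) \<le> real (card {g. cost_le alphabet R K g})"
      using card_mono[OF C1'(2)[OF R] Usub] by simp
    also have "\<dots> \<le> C1' * R powr D" by (rule C1'(3)[OF R])
    also have "\<dots> \<le> C1 * R powr D" by (intro mult_right_mono) (auto simp: C1_def)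
    finally have cU: "real (card U) \<le> C1 * R powr D" .
    have \<psi>01: "0 \<le> \<psi> g \<and> \<psi> g \<le> 1" if "g \<in> carrier G" for g
      using word_length_nonneg[OF that, of R] K by (simp add: \<psi>_def)
    have \<psi>0: "\<psi> g = 0" if "g \<in> carrier G - U" for g
      using that K by (auto simp: U_def \<psi>_def max_def field_simps)
    define S where "S = (\<Sum>x\<in>U. (\<psi> x)\<^sup>2)"
    obtain F where F: "F \<subseteq> carrier G" "finite F" "R powr D \<le> real (card F)" "\<And>g. g \<in> F \<Longrightarrow> word_length R g \<le> C0"
      using gr[OF R adapted_word_length[OF R]] by blast
    have FU: "F \<subseteq> U" using F K C0 by (fastforce simp: U_def K_def)
    have "R powr D / 4 \<le> real (card F) * (1 / 4)" using F(3) by simp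
    also have "\<dots> = (\<Sum>x\<in>F. 1 / 4)" by simp
    also have "\<dots> \<le> (\<Sum>x\<in>F. (\<psi> x)\<^sup>2)"
    proof (rule sum_mono)
      fix x assume x: "x \<in> F"
      have "word_length R x / K \<le> 1 / 2" using F(4)[OF x] K by (simp add: K_def field_simps)
      then have "1 / 2 \<le> \<psi> x" unfolding \<psi>_def by linarith
      then have "(1 / 2)\<^sup>2 \<le> (\<psi> x)\<^sup>2" by (intro power_mono) auto
      then show "1 / 4 \<le> (\<psi> x)\<^sup>2" by (simp add: power_divide)
    qed
    also have "\<dots> \<le> S" unfolding S_def by (intro sum_mono2 FU U) auto
    finally have SR: "R powr D / 4 \<le> S" .
    have RD: "R powr D > 0" using R by simp
    then have S: "S > 0" using SR by linarith
    have cUS: "real (card U) \<le> 4 * C1 * S"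
    proof -
      have "C1 * R powr D \<le> C1 * (4 * S)" using SR C1 by (intro mult_left_mono) auto
      then show ?thesis using cU by simp
    qed
    define f where "f g = (\<Sum>x\<in>U. \<psi> x * \<psi> (x \<otimes> g))" for g
    have fbound: "0 \<le> f g \<and> f g \<le> real (card U)" if g: "g \<in> carrier G" for g
    proof
      show "0 \<le> f g" unfolding f_def using U g \<psi>01 by (intro sum_nonneg mult_nonneg_nonneg) auto
      have "f g \<le> (\<Sum>x\<in>U. 1)"
        unfolding f_def
      proof (rule sum_mono)
        fix x assume "x \<in> U"
        then have "x \<in> carrier G" "x \<otimes> g \<in> carrier G" using U g by auto
        then show "\<psi> x * \<psi> (x \<otimes> g) \<le> 1" using \<psi>01 by (intro mult_le_one) auto
      qed
      then show "f g \<le> real (card U)" by simp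
    qed
    have flow: "f (s i [^] m) \<ge> S - real (card U) * capped_square R (w i) m" if i: "i \<in> {1..k}" for i and m :: int
      unfolding f_def S_def
    proof (rule sum_correlation_ge[OF U \<psi>0])
      show t: "s i [^] m \<in> carrier G" using s_carrier[OF i] by auto
      fix x assume x: "x \<in> carrier G"
      let ?t = "s i [^] m"
      have "word_length R (x \<otimes> ?t) \<le> word_length R x + word_length R ?t"
        by (rule word_length_mult[OF x t])
      moreover have "word_length R ((x \<otimes> ?t) \<otimes> inv ?t) \<le> word_length R (x \<otimes> ?t) + word_length R (inv ?t)"
        by (rule word_length_mult) (use x t in auto)
      then have "word_length R x \<le> word_length R (x \<otimes> ?t) + word_length R ?t"
        using x t word_length_inv[OF t, of R] by (simp add: m_assoc)
      moreover have "word_length R ?t \<le> \<bar>real_of_int m\<bar> * R powr - w i"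
        by (rule word_length_generator_pow[OF i])
      ultimately have "\<bar>word_length R x - word_length R (x \<otimes> ?t)\<bar> \<le> \<bar>real_of_int m\<bar> * R powr - w i"
        by linarith
      moreover have "\<bar>\<psi> x - \<psi> (x \<otimes> ?t)\<bar> \<le> \<bar>word_length R x - word_length R (x \<otimes> ?t)\<bar>"
      proof -
        have "\<bar>\<psi> x - \<psi> (x \<otimes> ?t)\<bar> \<le> \<bar>word_length R x / K - word_length R (x \<otimes> ?t) / K\<bar>"
          unfolding \<psi>_def by linarith
        also have "\<dots> = \<bar>word_length R x - word_length R (x \<otimes> ?t)\<bar> / K"
          using K by (simp flip: diff_divide_distrib)
        also have "\<dots> \<le> \<bar>word_length R x - word_length R (x \<otimes> ?t)\<bar> / 1"
          using K by (intro divide_left_mono) auto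
        finally show ?thesis by simp
      qed
      moreover have "\<bar>\<psi> x - \<psi> (x \<otimes> ?t)\<bar> \<le> 1"
        using \<psi>01[OF x] \<psi>01[of "x \<otimes> ?t"] x t by auto
      ultimately show "\<bar>\<psi> x - \<psi> (x \<otimes> ?t)\<bar> \<le> min 1 (\<bar>real_of_int m\<bar> * R powr - w i)"
        by linarith
    qed auto
    obtain E where E: "((\<lambda>g. \<mu> g * f g) has_sum E) (carrier G)" "E \<ge> S - real (card U) * C2 / R"
    proof -
      have "\<exists>E. ((\<lambda>g. \<mu> g * f g) has_sum E) (carrier G) \<and> E \<ge> S - real (card U) * C2 / R"
        by (rule ex[rule_format, OF R _ fbound flow]) auto
      then show ?thesis using that by (elim exE conjE)
    qed
    have "((\<lambda>g. \<Sum>x\<in>U. \<psi> x * (\<mu> g * \<psi> (x \<otimes> g))) has_sum (\<Sum>x\<in>U. \<psi> x * (\<Sum>y\<in>U. \<mu> (inv x \<otimes> y) * \<psi> y))) (carrier G)"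
    proof (intro has_sum_finite_sum U(1) has_sum_cmult_right)
      fix x assume "x \<in> U"
      then have x: "x \<in> carrier G" using U by auto
      have "((\<lambda>y. \<mu> (inv x \<otimes> y) * \<psi> y) has_sum (\<Sum>y\<in>U. \<mu> (inv x \<otimes> y) * \<psi> y)) U"
        by (rule has_sum_finite[OF U(1)])
      then have "((\<lambda>y. \<mu> (inv x \<otimes> y) * \<psi> y) has_sum (\<Sum>y\<in>U. \<mu> (inv x \<otimes> y) * \<psi> y)) (carrier G)"
        by (rule has_sum_cong_neutral[THEN iffD1, rotated -1]) (use U \<psi>0 in auto)
      then have "((\<lambda>g. \<mu> (inv x \<otimes> (x \<otimes> g)) * \<psi> (x \<otimes> g)) has_sum (\<Sum>y\<in>U. \<mu> (inv x \<otimes> y) * \<psi> y)) (carrier G)"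
        using has_sum_translate[OF x, of "\<lambda>y. \<mu> (inv x \<otimes> y) * \<psi> y"] by simp
      then show "((\<lambda>g. \<mu> g * \<psi> (x \<otimes> g)) has_sum (\<Sum>y\<in>U. \<mu> (inv x \<otimes> y) * \<psi> y)) (carrier G)"
        by (rule has_sum_cong[THEN iffD1, rotated]) (use x in simp)
    qed
    then have "((\<lambda>g. \<mu> g * f g) has_sum (\<Sum>x\<in>U. \<psi> x * (\<Sum>y\<in>U. \<mu> (inv x \<otimes> y) * \<psi> y))) (carrier G)"
      by (rule has_sum_cong[THEN iffD1, rotated]) (simp add: f_def sum_distrib_left mult.left_commute)
    then have "E = (\<Sum>x\<in>U. \<psi> x * (\<Sum>y\<in>U. \<mu> (inv x \<otimes> y) * \<psi> y))"
      using E(1) has_sum_unique by blast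
    also have "\<dots> = (\<Sum>x\<in>U. \<Sum>y\<in>U. \<psi> x * \<psi> y * \<mu> (inv x \<otimes> y))"
      unfolding sum_distrib_left by (intro sum.cong refl) (simp add: mult_ac)
    finally have Eeq: "E = (\<Sum>x\<in>U. \<Sum>y\<in>U. \<psi> x * \<psi> y * \<mu> (inv x \<otimes> y))" .
    define t where "t = 1 - 1 / (2 * real M)"
    have t: "0 \<le> t" using M by (simp add: t_def field_simps)
    have tS: "t * S \<le> (\<Sum>x\<in>U. \<Sum>y\<in>U. \<psi> x * \<psi> y * \<mu> (inv x \<otimes> y))"
    proof -
      have "real (card U) * C2 / R \<le> (4 * C1 * S) * C2 / R"
        using cUS C2 R by (intro divide_right_mono mult_right_mono) auto
      also have "\<dots> \<le> S * C3 / R"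
        using S R by (intro divide_right_mono) (auto simp: C3_def algebra_simps)
      also have "\<dots> = S * (1 / (2 * real M))"
        using C3 M by (simp add: R_def)
      finally show ?thesis using E(2) unfolding Eeq[symmetric] by (simp add: t_def algebra_simps)
    qed
    have "t ^ (2 * 2 ^ j) \<le> p (2 * 2 ^ j) \<one> * real (card U)"
      by (rule test_function_lower_bound[OF U S_def S t tS]) (use \<psi>01 U in auto)
    moreover have "1 / 2 \<le> t ^ (2 * 2 ^ j)"
    proof -
      have "1 + real M * (- 1 / (2 * real M)) \<le> (1 + (- 1 / (2 * real M))) ^ M"
        by (rule Bernoulli_inequality) (use M in \<open>simp add: field_simps\<close>)
      then show ?thesis using M by (simp add: t_def M_def[symmetric])
    qed
    ultimately have "1 / 2 \<le> p M \<one> * real (card U)" by (simp add: M_def)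
    also have "\<dots> \<le> p M \<one> * (C1 * R powr D)" by (intro mult_left_mono cU p_nonneg)
    also have "R powr D = (2 * C3) powr D * real M powr D"
      using C3 by (simp add: R_def powr_mult)
    finally have low: "1 / 2 \<le> p M \<one> * (C1 * ((2 * C3) powr D * real M powr D))" .
    have "1 / (2 * C1 * (2 * C3) powr D) * real M powr - D \<le> p M \<one>"
    proof -
      have pos: "C1 * ((2 * C3) powr D * real M powr D) > 0" using C1 C3 M by simp
      have "1 / (2 * C1 * (2 * C3) powr D) * real M powr - D = (1 / 2) / (C1 * ((2 * C3) powr D * real M powr D))"
        unfolding powr_minus_divide by simp
      also have "\<dots> \<le> p M \<one>" using low pos by (simp add: pos_divide_le_eq)
      finally show ?thesis .
    qed
    then show ?thesis by (simp add: M_def)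
  qed
  define c where "c = 1 / (2 * C1 * (2 * C3) powr D)"
  have c: "c > 0" using C1 C3 by (simp add: c_def)
  have decr: "p (2 * Suc n) \<one> \<le> p (2 * n) \<one>" for n
    using p_even_le[of 2 n] by simp
  have anti: "p (2 * b) \<one> \<le> p (2 * a) \<one>" if "a \<le> b" for a b
    using lift_Suc_antimono_le[of "\<lambda>n. p (2 * n) \<one>", OF decr that] .
  have even_low: "c * 4 powr - D * real m powr - D \<le> p (2 * m) \<one>" if m: "m \<ge> 1" for m
  proof -
    obtain j where j: "m \<le> 2 ^ j" "2 ^ j \<le> 2 * m"
    proof -
      define j where "j = (LEAST j. m \<le> 2 ^ j)"
      have ex: "\<exists>j. m \<le> 2 ^ j" by (rule exI[of _ m]) (rule less_imp_le[OF less_exp])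
      have 1: "m \<le> 2 ^ j" unfolding j_def by (rule LeastI_ex[OF ex])
      have "2 ^ j \<le> 2 * m"
      proof (cases j)
        case (Suc i)
        then have "\<not> m \<le> 2 ^ i" using not_less_Least[of i "\<lambda>j. m \<le> 2 ^ j"] by (simp add: j_def)
        then show ?thesis using Suc by simp
      qed (use m in simp)
      then show ?thesis using 1 that by blast
    qed
    have "real (2 * 2 ^ j) \<le> 4 * real m" using j(2) by linarith
    then have "(4 * real m) powr - D \<le> (2 * 2 ^ j) powr - D"
      using m D by (intro powr_mono2') auto
    then have "c * (4 * real m) powr - D \<le> c * (2 * 2 ^ j) powr - D"
      using c by (intro mult_left_mono) auto
    also have "\<dots> \<le> p (2 * 2 ^ j) \<one>" using dyadic[of j] by (simp add: c_def)
    also have "\<dots> \<le> p (2 * m) \<one>" by (rule anti[OF j(1)])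
    finally show ?thesis by (simp add: powr_mult mult.assoc)
  qed
  have mu1: "\<mu> \<one> \<le> 1" using density_le_1[OF density_mu] by simp
  have "\<mu> \<one> * (c * 4 powr - D) * real n powr - D \<le> p n \<one>" if n: "n \<ge> 2" for n
  proof -
    define m where "m = n div 2"
    have m: "m \<ge> 1" "m \<le> n" using n by (auto simp: m_def)
    have "real n powr - D \<le> real m powr - D" using m D by (intro powr_mono2') auto
    then have "c * 4 powr - D * real n powr - D \<le> c * 4 powr - D * real m powr - D"
      using c by (intro mult_left_mono) auto
    also have "\<dots> \<le> p (2 * m) \<one>" by (rule even_low[OF m(1)])
    finally have "\<mu> \<one> * (c * 4 powr - D * real n powr - D) \<le> \<mu> \<one> * p (2 * m) \<one>"
      using mu_one by (intro mult_left_mono) auto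
    also have "\<dots> \<le> p n \<one>"
    proof (cases "even n")
      case True
      then show ?thesis using mu1 p_nonneg[of n \<one>] by (simp add: m_def mult_left_le_one_le mu_nonneg)
    next
      case False
      then have "n = Suc (2 * m)" by (simp add: m_def)
      then show ?thesis using p_Suc_ge[of "2 * m"] by simp
    qed
    finally show ?thesis by (simp add: mult.assoc)
  qed
  moreover have "\<mu> \<one> * (c * 4 powr - D) > 0" using mu_one c by simp
  ultimately show ?thesis by blast
qed

lemma return_probability_power_law:
  "\<exists>D::real. D \<ge> 0 \<and> (\<exists>c C :: real. c > 0 \<and> C > 0 \<and> (\<forall>\<^sub>F n :: nat in sequentially.
     c * real n powr (- D) \<le> p n \<one> \<and> p n \<one> \<le> C * real n powr (- D)))"
proof -
  obtain D where D: "D \<ge> 0" and balls: "growth_le D" and growth: "growth_ge D"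
    using polynomial_growth by blast
  obtain C where C: "C > 0" "\<forall>n\<ge>2. p n \<one> \<le> C * real n powr - D"
    using return_upper_bound[OF D growth] by blast
  obtain c where c: "c > 0" "\<forall>n\<ge>2. c * real n powr - D \<le> p n \<one>"
    using return_lower_bound[OF D balls growth] by blast
  have "\<forall>\<^sub>F n :: nat in sequentially. c * real n powr (- D) \<le> p n \<one> \<and> p n \<one> \<le> C * real n powr (- D)"
    using C(2) c(2) by (intro eventually_sequentiallyI[of 2]) auto
  then show ?thesis using D C(1) c(1) by blast
qed

end

text \<open>Two of the powers of \<open>x\<close> lie in the same coset.\<close>

lemma (in group) finite_index_power_mem:
  assumes "finite_index_subgroup G H" "x \<in> carrier G"
  shows "\<exists>N\<ge>1::nat. x [^] N \<in> H"
proof -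
  have H: "subgroup H G" "finite (rcosets H)" using assms(1) by (auto simp: finite_index_subgroup_def)
  let ?f = "\<lambda>n::nat. H #> x [^] n"
  have "range ?f \<subseteq> rcosets H" using assms(2) by (auto simp: RCOSETS_def)
  then have "finite (range ?f)" using H(2) finite_subset by blast
  then have "\<not> inj ?f" using finite_imageD[of ?f UNIV] by auto
  then obtain c d :: nat where cd: "c \<noteq> d" "?f c = ?f d"
    unfolding inj_def by blast
  obtain a b :: nat where ab: "a < b" "?f a = ?f b"
  proof (cases "c < d")
    case True
    then show ?thesis using that cd by blast
  next
    case False
    then show ?thesis using that[of d c] cd by simp
  qed
  have "x [^] b \<in> H #> x [^] a"
    using rcos_self[of "x [^] b" H] H(1) assms(2) ab(2) by simp
  then have "x [^] b \<otimes> inv (x [^] a) \<in> H"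
    using subgroup.rcos_module_imp[OF H(1) is_group, of "x [^] a"] assms(2) by simp
  moreover have "x [^] b = x [^] (b - a) \<otimes> x [^] a"
    using ab(1) assms(2) by (simp add: nat_pow_mult)
  ultimately have "x [^] (b - a) \<in> H"
    using assms(2) by (simp add: m_assoc)
  then show ?thesis using ab(1) by (intro exI[of _ "b - a"]) auto
qed

theorem theorem1p2:
  fixes G :: "('a, 'b) monoid_scheme" (structure)
    and k :: nat
    and s :: "nat \<Rightarrow> 'a"
    and \<alpha> :: "nat \<Rightarrow> ereal"
  assumes nilpotent: "nilpotent_group G"
    and k_pos: "k \<ge> 1"
    and s_carrier: "\<forall>i\<in>{1..k}. s i \<in> carrier G"
    and generating: "generate G (s ` {1..k}) = carrier G"
    and alpha_pos: "\<forall>i\<in>{1..k}. 0 < \<alpha> i"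
    and finite_index: "finite_index_subgroup G (generate G {s i |i. i \<in> {1..k} \<and> \<alpha> i < 2})"
  shows "\<exists>D::real. D \<ge> 0 \<and>
    (\<exists>c C :: real. c > 0 \<and> C > 0 \<and>
      (\<forall>\<^sub>F n :: nat in sequentially.
        c * real n powr (- D) \<le> convolution_power G (walk_measure G k s \<alpha>) n \<one> \<and>
        convolution_power G (walk_measure G k s \<alpha>) n \<one> \<le> C * real n powr (- D)))"
proof -
  interpret group G using nilpotent by (simp add: nilpotent_group_def)
  define J where "J = {i \<in> {1..k}. \<alpha> i < 2}"
  define v where "v i = 1 / real_of_ereal (\<alpha> i)" for i
  have v: "v i > 1 / 2" if "i \<in> J" for i
  proof -
    have "\<alpha> i < 2" "\<alpha> i > 0" using that alpha_pos by (auto simp: J_def)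
    then show ?thesis by (cases "\<alpha> i") (auto simp: v_def field_simps)
  qed
  \<comment> \<open>The element \<open>1\<close> keeps the minimum meaningful if no generator has \<open>\<alpha> i < 2\<close>; then the group is finite and \<open>D = 0\<close>.\<close>
  define v0 where "v0 = Min (insert 1 (v ` J))"
  have fJ: "finite J" by (simp add: J_def)
  have v0: "v0 > 1 / 2" "\<And>i. i \<in> J \<Longrightarrow> v0 \<le> v i"
    unfolding v0_def by (subst Min_gr_iff; use v fJ in force) (use fJ in auto)
  \<comment> \<open>The value \<open>(1 / 2 + v0) / 2\<close> lies strictly between \<open>1 / 2\<close> and all weights of generators with \<open>\<alpha> i < 2\<close>.\<close>
  define w where "w i = (if \<alpha> i < 2 then v i else (1 / 2 + v0) / 2)" for i
  have J_eq: "s ` J = {s i |i. i \<in> {1..k} \<and> \<alpha> i < 2}" by (auto simp: J_def)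
  interpret power_walk G k s w \<alpha>
  proof unfold_locales
    fix i assume i: "i \<in> {1..k} - {i \<in> {1..k}. \<alpha> i < 2}"
    show "\<exists>N\<ge>1::nat. s i [^] N \<in> generate G (s ` {i \<in> {1..k}. \<alpha> i < 2})"
      using finite_index_power_mem[OF finite_index, of "s i"] i s_carrier J_eq by (auto simp: J_def)
  next
    fix i j assume i: "i \<in> {1..k} - {i \<in> {1..k}. \<alpha> i < 2}" and j: "j \<in> {i \<in> {1..k}. \<alpha> i < 2}"
    then have "v0 \<le> v j" using v0(2) by (auto simp: J_def)
    then show "w i < w j" using i j v0(1) by (auto simp: w_def)
  next
    fix i assume "i \<in> {1..k}"
    then show "w i > 0" using v[of i] v0(1) by (auto simp: w_def J_def)
  qed (use s_carrier generating nilpotent k_pos alpha_pos v0(1) in \<open>auto simp: w_def v_def not_less\<close>)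
  show ?thesis by (rule return_probability_power_law)
qed

end
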